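(* Let $M$ be a connected smooth manifold of dimension $m\ge 1$, let $p\colon\mathbb{R}\times M\to\mathbb{R}$ and $q\colon J^1(\mathbb{R},M)\times\mathbb{R}\to J^1(\mathbb{R},M)$ be the canonical projections, and let $O^2\subset J^2(q)$ be the set of $2$-jets $j^2_{a}\mathcal{L}$ ($a\in J^1(\mathbb{R},M)$) whose Hessian metric $\operatorname{Hess}_a(\mathcal{L})$ is non-singular. Let $\mathcal{D}^2$ be the distribution on $J^2(q)$ generated by all the vector fields $(\tilde{X}^{(1)})^{(2)}$, where $X$ is an arbitrary $p$-projectable vector field on $\mathbb{R}\times M$. Then there is a dense open subset $O'$ of $J^2(q)$ with $O'\subset O^2$ and $\mathcal{L}(a)\neq 0$ for every $j^2_a\mathcal{L}\in O'$, on which the rank of $\mathcal{D}^2$ is $$2m^2+7m+3=(m+3)(2m+1).$$ (Here $\dim J^2(q)=2m^2+7m+4$.) Consequently, the function $I(j^2_a\mathcal{L})=V(j^2_a\mathcal{L})/\mathcal{L}(a)$ is a basis for the invariants of second order; that is, $dI\neq 0$ at every point of $O'$, and every point of $O'$ has an open neighbourhood $U\subset O'$ such that every $F\in C^\infty(U)$ with $(\tilde{X}^{(1)})^{(2)}F=0$ on $U$ for all $p$-projectable vector fields $X$ has the form $F=f\circ I|_U$ for some smooth function $f$ of one real variable.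
   Context: $J^1(\mathbb{R},M)\simeq\mathbb{R}\times TM$ is the bundle of $1$-jets of local sections of $p\colon\mathbb{R}\times M\to\mathbb{R}$, $p(x,y)=x$. Fibred coordinates $(x,y^\alpha)$, $1\le\alpha\le m$, on $\mathbb{R}\times M$ induce coordinates $(x,y^\alpha,\dot y^\alpha)$ on it, with $\dot y^\alpha(j^1_{x_0}\sigma)=\frac{d(y^\alpha\circ\sigma)}{dx}(x_0)$. Let $p^{10}\colon J^1(\mathbb{R},M)\to\mathbb{R}\times M$ be the canonical projection and $V(p^{10})$ its vertical tangent bundle, spanned by the $\partial/\partial\dot y^\alpha$. A function (Lagrangian) $\mathcal{L}\in C^\infty(J^1(\mathbb{R},M))$ is identified with the section $s_{\mathcal{L}}(a)=(a,\mathcal{L}(a))$ of $q$. $J^2(q)$ is the bundle of $2$-jets of local sections of $q$, with coordinates $t^a=(x,y^\alpha,\dot y^\alpha)$, $z$, and $z_I$ ($1\le|I|\le 2$), where $z_I(j^2_\zeta\mathcal{L})=(\partial^{|I|}\mathcal{L}/\partial t^I)(\zeta)$. Hessian metric: the fibres of $p^{10}$ are affine spaces, and $\operatorname{Hess}_a(\mathcal{L})$ is the Hessian at $a$ of the restriction of $\mathcal{L}$ to the fibre through $a$, with respect to the canonical flat affine connection; it is a symmetric bilinear form on $V_a(p^{10})$, with matrix $\left(\frac{\partial^2\mathcal{L}}{\partial\dot y^\alpha\partial\dot y^\beta}(a)\right)$. If it is non-singular, let ${}^\sharp\operatorname{Hess}_a(\mathcal{L})$ be the induced (inverse) bilinear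 form on $V_a^*(p^{10})$, let $d_{10}\mathcal{L}=d\mathcal{L}|_{V(p^{10})}$, and put $V(j^2_a\mathcal{L})={}^\sharp\operatorname{Hess}_a(\mathcal{L})(d_{10}\mathcal{L},d_{10}\mathcal{L})$; in coordinates $V=h^{\alpha\beta}z_{\dot y^\alpha}z_{\dot y^\beta}$ with $(h^{\alpha\beta})$ the inverse matrix of $(z_{\dot y^\alpha\dot y^\beta})$. Prolongations: a $p$-projectable vector field has local expression $X=u\frac{\partial}{\partial x}+v^\alpha\frac{\partial}{\partial y^\alpha}$ with $u\in C^\infty(\mathbb{R})$, $v^\alpha$ functions of $(x,y)$ (summation convention). Its lift to $J^1(\mathbb{R},M)\times\mathbb{R}$ is $$\tilde X^{(1)}=u\tfrac{\partial}{\partial x}+v^\alpha\tfrac{\partial}{\partial y^\alpha}+v_1^\alpha\tfrac{\partial}{\partial\dot y^\alpha}-\tfrac{du}{dx}z\tfrac{\partial}{\partial z},\qquad v_1^\alpha=\tfrac{\partial v^\alpha}{\partial x}-\tfrac{du}{dx}\dot y^\alpha+\tfrac{\partial v^\alpha}{\partial y^\beta}\dot y^\beta .$$ For a $q$-projectable vector field $Y=\xi^a(t)\frac{\partial}{\partial t^a}+\eta(t,z)\frac{\partial}{\partial z}$, its second jet prolongation (lift by infinitesimal contact transformations) to $J^2(q)$ is $$Y^{(2)}=\xi^a\tfrac{\partial}{\partial t^a}+\eta\tfrac{\partial}{\partial z}+\sum_{1\le|I|\le 2}\eta_I\tfrac{\partial}{\partial z_I},\qquad \eta_I=\mathbb{D}^I(\eta-\xi^a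 z_a)+\xi^a z_{I+(a)},$$ where $(a)$ is the multi-index with $1$ in position $a$ and $0$ elsewhere, $\mathbb{D}_{t^a}=\frac{\partial}{\partial t^a}+\sum_{|I|\ge0}z_{I+(a)}\frac{\partial}{\partial z_I}$ is the total derivative, and $\mathbb{D}^I$ is the corresponding composite of total derivatives. *)

theory Defs
  imports
    "HOL-Analysis.Analysis"
    "HOL-Library.Multiset"
    "HOL-Library.Groups_Big_Fun"
begin

section \<open>Smooth functions and smooth manifolds\<close>

text \<open>\<open>Ck_on\<close> and \<open>smooth_on\<close> are only ever used for open sets; on these (and between
  Euclidean spaces) they are the usual \<open>C\<^sup>k\<close> and \<open>C\<^sup>\<infinity>\<close>.\<close>

primrec Ck_on :: "nat \<Rightarrow> 'a::real_normed_vector set \<Rightarrow> ('a \<Rightarrow> 'b::real_normed_vector) \<Rightarrow> bool" where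
  "Ck_on 0 S f \<longleftrightarrow> continuous_on S f"
| "Ck_on (Suc k) S f \<longleftrightarrow>
     (\<forall>x\<in>S. f differentiable (at x)) \<and> (\<forall>v. Ck_on k S (\<lambda>x. frechet_derivative f (at x) v))"

definition smooth_on :: "'a::real_normed_vector set \<Rightarrow> ('a \<Rightarrow> 'b::real_normed_vector) \<Rightarrow> bool" where
  "smooth_on S f \<longleftrightarrow> (\<forall>k. Ck_on k S f)"

text \<open>A chart is a pair of its domain and its coordinate map; the values of the coordinate map
  outside the domain are irrelevant.\<close>

type_synonym ('p, 'e) chart = "'p set \<times> ('p \<Rightarrow> 'e)"

definition chart_inv :: "('p, 'e) chart \<Rightarrow> 'e \<Rightarrow> 'p" where
  "chart_inv c = inv_into (fst c) (snd c)"

definition carrier_of :: "('p, 'e) chart set \<Rightarrow> 'p set" where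
  "carrier_of A = \<Union>(fst ` A)"

definition smooth_manifold :: "'a topology \<Rightarrow> ('a, 'e::euclidean_space) chart set \<Rightarrow> bool" where
  "smooth_manifold M A \<longleftrightarrow>
     Hausdorff_space M \<and> second_countable M \<and> carrier_of A = topspace M \<and>
     (\<forall>c\<in>A. openin M (fst c) \<and> open (snd c ` fst c) \<and>
        homeomorphic_map (subtopology M (fst c)) (top_of_set (snd c ` fst c)) (snd c)) \<and>
     (\<forall>c\<in>A. \<forall>d\<in>A. smooth_on (snd c ` (fst c \<inter> fst d)) (snd d \<circ> chart_inv c))"

text \<open>On the jet bundles below the topology is the one determined by their atlas.\<close>

definition atlas_open :: "('p, 'e::euclidean_space) chart set \<Rightarrow> 'p set \<Rightarrow> bool" where
  "atlas_open A U \<longleftrightarrow> U \<subseteq> carrier_of A \<and> (\<forall>c\<in>A. open (snd c ` (U \<inter> fst c)))"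

definition smooth_fun_on :: "('p, 'e::euclidean_space) chart set \<Rightarrow> 'p set \<Rightarrow> ('p \<Rightarrow> real) \<Rightarrow> bool" where
  "smooth_fun_on A U F \<longleftrightarrow> (\<forall>c\<in>A. smooth_on (snd c ` (U \<inter> fst c)) (F \<circ> chart_inv c))"

definition smooth_near :: "('p, 'e::euclidean_space) chart set \<Rightarrow> 'p \<Rightarrow> ('p \<Rightarrow> real) \<Rightarrow> bool" where
  "smooth_near A a F \<longleftrightarrow> (\<exists>U. atlas_open A U \<and> a \<in> U \<and> smooth_fun_on A U F)"

text \<open>The differential of \<open>F\<close> at \<open>p\<close>, applied to the tangent vector at \<open>p\<close> that has components
  \<open>w\<close> in the chart \<open>c\<close>.\<close>

definition chart_diff :: "('p, 'e::euclidean_space) chart \<Rightarrow> ('p \<Rightarrow> real) \<Rightarrow> 'p \<Rightarrow> 'e \<Rightarrow> real" where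
  "chart_diff c F p w = frechet_derivative (F \<circ> chart_inv c) (at (snd c p)) w"

text \<open>A vector field is given by its components in the charts of the atlas, as functions of the
  coordinates.\<close>

type_synonym ('p, 'e) vfield = "('p, 'e) chart \<Rightarrow> 'e \<Rightarrow> 'e"

definition vector_field :: "('p, 'e::euclidean_space) chart set \<Rightarrow> ('p, 'e) vfield \<Rightarrow> bool" where
  "vector_field A X \<longleftrightarrow>
     (\<forall>c\<in>A. smooth_on (snd c ` fst c) (X c)) \<and>
     (\<forall>c\<in>A. \<forall>d\<in>A. \<forall>p\<in>fst c \<inter> fst d.
        X d (snd d p) = frechet_derivative (snd d \<circ> chart_inv c) (at (snd c p)) (X c (snd c p)))"


section \<open>The bundle \<open>p : \<real> \<times> M \<rightarrow> \<real>\<close> and its 1-jets\<close>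

definition prod_chart :: "('a, 'e) chart \<Rightarrow> (real \<times> 'a, real \<times> 'e) chart" where
  "prod_chart c = (UNIV \<times> fst c, \<lambda>(x, y). (x, snd c y))"

definition prod_atlas :: "('a, 'e) chart set \<Rightarrow> (real \<times> 'a, real \<times> 'e) chart set" where
  "prod_atlas A = prod_chart ` A"

definition p_projectable ::
    "('a, 'e::euclidean_space) chart set \<Rightarrow> (real \<times> 'a, real \<times> 'e) vfield \<Rightarrow> bool" where
  "p_projectable A X \<longleftrightarrow>
     vector_field (prod_atlas A) X \<and>
     (\<exists>u. smooth_on UNIV u \<and>
        (\<forall>c\<in>A. \<forall>x. \<forall>y\<in>snd c ` fst c. fst (X (prod_chart c) (x, y)) = u x))"

definition local_section ::
    "('a, 'e::euclidean_space) chart set \<Rightarrow> real \<Rightarrow> (real \<Rightarrow> real \<times> 'a) \<Rightarrow> bool" where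
  "local_section A x0 \<sigma> \<longleftrightarrow>
     (\<exists>W. open W \<and> x0 \<in> W \<and>
        (\<forall>x\<in>W. fst (\<sigma> x) = x \<and> \<sigma> x \<in> carrier_of (prod_atlas A)) \<and>
        (\<forall>c\<in>prod_atlas A. open (W \<inter> \<sigma> -` fst c) \<and> smooth_on (W \<inter> \<sigma> -` fst c) (snd c \<circ> \<sigma>)))"

text \<open>A jet is the pair of its source and the class of all local sections (functions) representing
  it.\<close>

type_synonym 'a jet1 = "real \<times> (real \<Rightarrow> real \<times> 'a) set"

definition jet1 ::
    "('a, 'e::euclidean_space) chart set \<Rightarrow> real \<Rightarrow> (real \<Rightarrow> real \<times> 'a) \<Rightarrow> 'a jet1" where
  "jet1 A x0 \<sigma> =
     (x0, {\<tau>. local_section A x0 \<tau> \<and> \<tau> x0 = \<sigma> x0 \<and>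
        (\<forall>c\<in>A. snd (\<sigma> x0) \<in> fst c \<longrightarrow>
           vector_derivative (snd c \<circ> snd \<circ> \<tau>) (at x0) =
           vector_derivative (snd c \<circ> snd \<circ> \<sigma>) (at x0))})"

definition J1 :: "('a, 'e::euclidean_space) chart set \<Rightarrow> 'a jet1 set" where
  "J1 A = {jet1 A x0 \<sigma> | x0 \<sigma>. local_section A x0 \<sigma>}"

definition jet1_rep :: "'a jet1 \<Rightarrow> real \<Rightarrow> real \<times> 'a" where
  "jet1_rep a = (SOME \<sigma>. \<sigma> \<in> snd a)"

definition p10 :: "'a jet1 \<Rightarrow> real \<times> 'a" where
  "p10 a = jet1_rep a (fst a)"

text \<open>Indices of the coordinates \<open>t = (x, y\<^sup>\<alpha>, \<dot>y\<^sup>\<alpha>)\<close>.\<close>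

datatype 'm tidx = Ix | Iy 'm | Idot 'm

instance tidx :: (finite) finite
proof
  have "i \<in> insert Ix (range Iy \<union> range Idot)" for i :: "'a tidx"
    by (cases i) simp_all
  then have "(UNIV :: 'a tidx set) \<subseteq> insert Ix (range Iy \<union> range Idot)"
    by blast
  then show "finite (UNIV :: 'a tidx set)"
    by (rule finite_subset) simp
qed

definition J1_coords :: "('a, real ^ 'm) chart \<Rightarrow> 'a jet1 \<Rightarrow> real ^ ('m::finite) tidx" where
  "J1_coords c a =
     (\<chi> i. case i of
        Ix \<Rightarrow> fst a
      | Iy \<alpha> \<Rightarrow> snd c (snd (p10 a)) $ \<alpha>
      | Idot \<alpha> \<Rightarrow> vector_derivative (snd c \<circ> snd \<circ> jet1_rep a) (at (fst a)) $ \<alpha>)"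

definition J1_chart ::
    "('a, real ^ 'm) chart set \<Rightarrow> ('a, real ^ 'm) chart \<Rightarrow> ('a jet1, real ^ ('m::finite) tidx) chart" where
  "J1_chart A c = ({a \<in> J1 A. snd (p10 a) \<in> fst c}, J1_coords c)"

definition J1_atlas :: "('a, real ^ 'm) chart set \<Rightarrow> ('a jet1, real ^ ('m::finite) tidx) chart set" where
  "J1_atlas A = J1_chart A ` A"


section \<open>2-jets of functions on a manifold\<close>

text \<open>Multi-indices are multisets of indices, so that \<open>I + (a)\<close> is \<open>add_mset a I\<close>. The type
  \<open>'i mindex\<close> contains those of order at most 2, including the empty one with \<open>z = z_{#}\<close>.\<close>

typedef 'i mindex = "{I :: 'i multiset. size I \<le> 2}" morphisms mset_of Mindex
  by (rule exI[of _ "{#}"]) simp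

instance mindex :: (finite) finite
proof
  have "I \<in> mset ` {xs. set xs \<subseteq> UNIV \<and> length xs \<le> 2}" if "size I \<le> 2" for I :: "'a multiset"
  proof -
    obtain xs where "mset xs = I" using ex_mset by blast
    with that have "length xs \<le> 2" by auto
    with \<open>mset xs = I\<close> show ?thesis by auto
  qed
  then have "{I :: 'a multiset. size I \<le> 2} \<subseteq> mset ` {xs. set xs \<subseteq> UNIV \<and> length xs \<le> 2}"
    by blast
  moreover have "finite {xs. set xs \<subseteq> (UNIV :: 'a set) \<and> length xs \<le> 2}"
    by (rule finite_lists_length_le) simp
  ultimately have "finite {I :: 'a multiset. size I \<le> 2}"
    by (rule finite_subset[OF _ finite_imageI])
  moreover have "range mset_of = {I :: 'a multiset. size I \<le> 2}"
    by (rule type_definition.Rep_range[OF type_definition_mindex])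
  ultimately show "finite (UNIV :: 'a mindex set)"
    by (intro finite_imageD[of mset_of UNIV]) (simp_all add: inj_on_def mset_of_inject)
qed

text \<open>The composite of the operators \<open>D a\<close> over the elements of a multiset. The order chosen is
  immaterial for the partial derivatives and the total derivatives of smooth functions.\<close>

definition iter_mset :: "('i \<Rightarrow> 'p \<Rightarrow> 'p) \<Rightarrow> 'i multiset \<Rightarrow> 'p \<Rightarrow> 'p" where
  "iter_mset D I = foldr D (SOME xs. mset xs = I)"

definition vec_upd :: "real ^ 'i \<Rightarrow> 'i \<Rightarrow> real \<Rightarrow> real ^ ('i::finite)" where
  "vec_upd t a s = (\<chi> b. if b = a then s else t $ b)"

definition pd :: "'i \<Rightarrow> (real ^ 'i \<Rightarrow> real) \<Rightarrow> real ^ ('i::finite) \<Rightarrow> real" where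
  "pd a f t = deriv (\<lambda>s. f (vec_upd t a s)) (t $ a)"

text \<open>The coordinates \<open>(t, (z_I))\<close>, \<open>|I| \<le> 2\<close>.\<close>

type_synonym 'i jcoords = "(real ^ 'i) \<times> (real ^ ('i mindex))"

type_synonym 'n jet2 = "'n \<times> ('n \<Rightarrow> real) set"

definition jet2 ::
    "('n, real ^ ('i::finite)) chart set \<Rightarrow> 'n \<Rightarrow> ('n \<Rightarrow> real) \<Rightarrow> 'n jet2" where
  "jet2 B a L =
     (a, {L'. smooth_near B a L' \<and>
        (\<forall>c\<in>B. a \<in> fst c \<longrightarrow> (\<forall>I. size I \<le> 2 \<longrightarrow>
           iter_mset pd I (L' \<circ> chart_inv c) (snd c a) =
           iter_mset pd I (L \<circ> chart_inv c) (snd c a)))})"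

definition jets2 :: "('n, real ^ ('i::finite)) chart set \<Rightarrow> 'n jet2 set" where
  "jets2 B = {jet2 B a L | a L. a \<in> carrier_of B \<and> smooth_near B a L}"

definition jet2_rep :: "'n jet2 \<Rightarrow> 'n \<Rightarrow> real" where
  "jet2_rep \<zeta> = (SOME L. L \<in> snd \<zeta>)"

text \<open>\<open>L(a)\<close> for a 2-jet of \<open>L\<close> at \<open>a\<close>.\<close>

definition jet2_value :: "'n jet2 \<Rightarrow> real" where
  "jet2_value \<zeta> = jet2_rep \<zeta> (fst \<zeta>)"

definition jet2_chart ::
    "('n, real ^ ('i::finite)) chart set \<Rightarrow> ('n, real ^ 'i) chart
      \<Rightarrow> ('n jet2, 'i jcoords) chart" where
  "jet2_chart B c =
     ({\<zeta> \<in> jets2 B. fst \<zeta> \<in> fst c},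
      \<lambda>\<zeta>. (snd c (fst \<zeta>),
            \<chi> I. iter_mset pd (mset_of I) (jet2_rep \<zeta> \<circ> chart_inv c) (snd c (fst \<zeta>))))"


section \<open>The bundle \<open>J\<^sup>2(q)\<close>\<close>

definition J2 :: "('a, real ^ ('m::finite)) chart set \<Rightarrow> 'a jet1 jet2 set" where
  "J2 A = jets2 (J1_atlas A)"

definition J2_chart ::
    "('a, real ^ ('m::finite)) chart set \<Rightarrow> ('a, real ^ 'm) chart
      \<Rightarrow> ('a jet1 jet2, 'm tidx jcoords) chart" where
  "J2_chart A c = jet2_chart (J1_atlas A) (J1_chart A c)"

definition J2_atlas ::
    "('a, real ^ ('m::finite)) chart set
      \<Rightarrow> ('a jet1 jet2, 'm tidx jcoords) chart set" where
  "J2_atlas A = J2_chart A ` A"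

definition zcoord ::
    "('a, real ^ ('m::finite)) chart set \<Rightarrow> ('a, real ^ 'm) chart \<Rightarrow> 'm tidx multiset
      \<Rightarrow> 'a jet1 jet2 \<Rightarrow> real" where
  "zcoord A c I \<zeta> = snd (snd (J2_chart A c) \<zeta>) $ Mindex I"

definition Hess_matrix ::
    "('a, real ^ ('m::finite)) chart set \<Rightarrow> ('a, real ^ 'm) chart \<Rightarrow> 'a jet1 jet2 \<Rightarrow> real ^ 'm ^ 'm" where
  "Hess_matrix A c \<zeta> = (\<chi> \<alpha> \<beta>. zcoord A c {#Idot \<alpha>, Idot \<beta>#} \<zeta>)"

text \<open>The charts induced by different charts of \<open>M\<close> differ by linear changes of the \<open>\<dot>y\<^sup>\<alpha>\<close> on each
  fibre, so neither of the next two definitions depends on the chart of \<open>M\<close> used.\<close>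

definition O2 :: "('a, real ^ ('m::finite)) chart set \<Rightarrow> 'a jet1 jet2 set" where
  "O2 A = {\<zeta> \<in> J2 A. \<forall>c\<in>A. \<zeta> \<in> fst (J2_chart A c) \<longrightarrow> invertible (Hess_matrix A c \<zeta>)}"

definition Vfun :: "('a, real ^ ('m::finite)) chart set \<Rightarrow> 'a jet1 jet2 \<Rightarrow> real" where
  "Vfun A \<zeta> =
     (let c = (SOME c. c \<in> A \<and> \<zeta> \<in> fst (J2_chart A c)); h = matrix_inv (Hess_matrix A c \<zeta>)
      in \<Sum>\<alpha>\<in>UNIV. \<Sum>\<beta>\<in>UNIV. h $ \<alpha> $ \<beta> * zcoord A c {#Idot \<alpha>#} \<zeta> * zcoord A c {#Idot \<beta>#} \<zeta>)"

definition Ifun :: "('a, real ^ ('m::finite)) chart set \<Rightarrow> 'a jet1 jet2 \<Rightarrow> real" where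
  "Ifun A \<zeta> = Vfun A \<zeta> / jet2_value \<zeta>"


section \<open>Prolongations\<close>

text \<open>The components, in the coordinates \<open>(t, z)\<close> induced by the chart \<open>c\<close> of \<open>M\<close>, of the lift of a
  projectable vector field to \<open>J\<^sup>1 \<times> \<real>\<close>: \<open>lift1_xi\<close> has the components along \<open>\<partial>/\<partial>t\<close>,
  \<open>lift1_eta\<close> the one along \<open>\<partial>/\<partial>z\<close>.\<close>

definition lift1_xi ::
    "(real \<times> 'a, real \<times> (real ^ ('m::finite))) vfield \<Rightarrow> ('a, real ^ 'm) chart
      \<Rightarrow> real ^ 'm tidx \<Rightarrow> real ^ 'm tidx" where
  "lift1_xi X c t =
     (let x = t $ Ix; y = (\<chi> \<alpha>. t $ Iy \<alpha>); Xc = X (prod_chart c);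
          u' = deriv (\<lambda>s. fst (Xc (s, y))) x;
          v = (\<lambda>s w \<alpha>. snd (Xc (s, w)) $ \<alpha>)
      in \<chi> i. case i of
           Ix \<Rightarrow> fst (Xc (x, y))
         | Iy \<alpha> \<Rightarrow> v x y \<alpha>
         | Idot \<alpha> \<Rightarrow> deriv (\<lambda>s. v s y \<alpha>) x - u' * t $ Idot \<alpha>
                   + (\<Sum>\<beta>\<in>UNIV. pd \<beta> (\<lambda>w. v x w \<alpha>) y * t $ Idot \<beta>))"

definition lift1_eta ::
    "(real \<times> 'a, real \<times> (real ^ ('m::finite))) vfield \<Rightarrow> ('a, real ^ 'm) chart
      \<Rightarrow> real ^ 'm tidx \<Rightarrow> real \<Rightarrow> real" where
  "lift1_eta X c t z = - deriv (\<lambda>s. fst (X (prod_chart c) (s, \<chi> \<alpha>. t $ Iy \<alpha>))) (t $ Ix) * z"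

text \<open>The total derivative acts on functions \<open>P t w\<close> of the coordinates \<open>t\<close> and of the jet
  coordinates \<open>w I = z_I\<close> of all orders. If \<open>P\<close> depends on finitely many of the latter, then
  \<open>Sum_any\<close> is a finite sum.\<close>

definition tot_deriv ::
    "'i \<Rightarrow> (real ^ ('i::finite) \<Rightarrow> ('i multiset \<Rightarrow> real) \<Rightarrow> real)
      \<Rightarrow> (real ^ 'i \<Rightarrow> ('i multiset \<Rightarrow> real) \<Rightarrow> real)" where
  "tot_deriv a P t w =
     deriv (\<lambda>s. P (vec_upd t a s) w) (t $ a)
     + Sum_any (\<lambda>J. w (add_mset a J) * deriv (\<lambda>s. P t (w(J := s))) (w J))"

text \<open>The second prolongation of \<open>\<xi>\<^sup>a(t) \<partial>/\<partial>t\<^sup>a + \<eta>(t,z) \<partial>/\<partial>z\<close>. The third-order coordinates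
  occurring in the two summands of \<open>\<eta>_I\<close> cancel, so they can be set to 0. For \<open>I = 0\<close> the formula
  gives \<open>\<eta>\<close> itself.\<close>

definition prolong2 ::
    "(real ^ 'i \<Rightarrow> real ^ 'i) \<Rightarrow> (real ^ 'i \<Rightarrow> real \<Rightarrow> real)
      \<Rightarrow> ('i::finite) jcoords \<Rightarrow> 'i jcoords" where
  "prolong2 \<xi> \<eta> = (\<lambda>(t, zz).
     let w = (\<lambda>J. if size J \<le> 2 then zz $ Mindex J else 0);
         Q = (\<lambda>t w. \<eta> t (w {#}) - (\<Sum>a\<in>UNIV. \<xi> t $ a * w {#a#}))
     in (\<xi> t, \<chi> I. iter_mset tot_deriv (mset_of I) Q t w
                     + (\<Sum>a\<in>UNIV. \<xi> t $ a * w (add_mset a (mset_of I)))))"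

text \<open>The value at \<open>\<zeta>\<close> of the second prolongation of the lift of \<open>X\<close>, as components in the chart of
  \<open>J\<^sup>2(q)\<close> induced by the chart \<open>c\<close> of \<open>M\<close>.\<close>

definition lift2 ::
    "('a, real ^ ('m::finite)) chart set \<Rightarrow> (real \<times> 'a, real \<times> (real ^ 'm)) vfield
      \<Rightarrow> ('a, real ^ 'm) chart \<Rightarrow> 'a jet1 jet2 \<Rightarrow> 'm tidx jcoords" where
  "lift2 A X c \<zeta> = prolong2 (lift1_xi X c) (lift1_eta X c) (snd (J2_chart A c) \<zeta>)"

definition distribution2 ::
    "('a, real ^ ('m::finite)) chart set \<Rightarrow> ('a, real ^ 'm) chart \<Rightarrow> 'a jet1 jet2
      \<Rightarrow> 'm tidx jcoords set" where
  "distribution2 A c \<zeta> = span {lift2 A X c \<zeta> | X. p_projectable A X}"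

definition invariant_on ::
    "('a, real ^ ('m::finite)) chart set \<Rightarrow> 'a jet1 jet2 set \<Rightarrow> ('a jet1 jet2 \<Rightarrow> real) \<Rightarrow> bool" where
  "invariant_on A U F \<longleftrightarrow>
     (\<forall>X. p_projectable A X \<longrightarrow>
        (\<forall>\<zeta>\<in>U. \<forall>c\<in>A. \<zeta> \<in> fst (J2_chart A c) \<longrightarrow>
           chart_diff (J2_chart A c) F \<zeta> (lift2 A X c \<zeta>) = 0))"

end

theory Submission
  imports Defs
begin

text \<open>Write \<open>z\<close>, \<open>p\<close> and \<open>H\<close> for the value, the vertical differential and the vertical Hessian of a jet, and
  \<open>O'\<close> for the set where \<open>z \<noteq> 0\<close>, \<open>p \<noteq> 0\<close> and \<open>det H \<noteq> 0\<close>. There put \<open>q = H\<^sup>-\<^sup>1p\<close>, so that \<open>I = (p \<cdot> q) / z\<close>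
  and \<open>z dI = 2 q \<cdot> dp - q\<^sup>T dH q - I dz\<close>.

  Every projectable field lifts into the kernel of \<open>dI\<close>. Conversely, a covector annihilating all lifts is
  a multiple of \<open>dI\<close>. Cutoff functions extend polynomial fields from a chart, so the Taylor coefficients
  of the fields at a point are arbitrary. In terms of \<open>x' = x - x\<^sub>0\<close> and \<open>s = y - y\<^sub>0 - v\<^sub>0 x'\<close>, with
  \<open>v\<^sub>0\<close> the velocity at the point, the cubic coefficients kill the components of the covector along \<open>z\<^sub>x\<^sub>x\<close>, \<open>z\<^sub>x\<^sub>y\<close>, \<open>z\<^sub>y\<^sub>y\<close>; the quadratic
  ones and \<open>u''\<close> kill those along \<open>z\<^sub>x\<close>, \<open>z\<^sub>y\<close> and the mixed second derivatives, because an antisymmetric matrix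
  of rank one vanishes and \<open>z \<noteq> 0\<close>; the remaining ones leave a single parameter. So the
  distribution has codimension one, with annihilator spanned by \<open>dI\<close>.

  Finally, where \<open>q\<^sub>\<alpha> \<noteq> 0\<close>, one may use \<open>q\<close> and \<open>I\<close> as coordinates in place of \<open>p\<close> and \<open>H\<^sub>\<alpha>\<^sub>\<alpha>\<close>; in these the
  level sets of \<open>I\<close> are affine, so an invariant on a ball depends on \<open>I\<close> only.\<close>

section \<open>Calculus of smooth functions\<close>

text \<open>The quotient \<open>V / z\<close> is dictated by weights. Along a prolonged field the
  vertical data (z, p, H) move by (-u' z, -N^T p, u' H - H N - N^T H), where N is the y-derivative
  of the field. The N-part is a change of basis, to which V is blind; the u'-part scales V and z by
  the same factor -u'.

  For the rank, no list of 2m^2 + 7m + 3 independent lifts is written down. The span of the lifts is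
  compared with the hyperplane ker dI through its orthogonal complement, so that only the covectors
  killing all lifts have to be found.

  Third-order Taylor coefficients matter because the velocity component of the lift contains first
  derivatives of the field and the second prolongation adds two more. The functions x' and s are
  chosen for their total derivatives: that of x' is 1, that of s vanishes at the point and varies
  with the velocity only. In products of factors x', s and 1 most terms of the product rule
  therefore vanish, and each test field isolates a few components of the covector.\<close>

lemma Ck_on_subset: "Ck_on k S f \<Longrightarrow> T \<subseteq> S \<Longrightarrow> Ck_on k T f"
  by (induction k arbitrary: f) (auto intro: continuous_on_subset)

lemma smooth_on_subset: "smooth_on S f \<Longrightarrow> T \<subseteq> S \<Longrightarrow> smooth_on T f"
  unfolding smooth_on_def by (auto intro: Ck_on_subset)

text \<open>Derivatives are taken in the full space, so agreement on \<open>S\<close> passes to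
  derivatives because \<open>S\<close> is open.\<close>

lemma Ck_on_cong:
  assumes "open S" "\<And>x. x \<in> S \<Longrightarrow> f x = g x"
  shows "Ck_on k S f \<longleftrightarrow> Ck_on k S g"
  using assms(2)
proof (induction k arbitrary: f g)
  case 0
  then show ?case by (simp cong: continuous_on_cong)
next
  case (Suc k)
  have d: "f differentiable (at x) \<longleftrightarrow> g differentiable (at x)" if "x \<in> S" for x
    using assms(1) that Suc.prems
    unfolding differentiable_def
    by (metis has_derivative_transform_within_open)
  have fd: "frechet_derivative f (at x) = frechet_derivative g (at x)"
    if "x \<in> S" "f differentiable (at x)" for x
    using frechet_derivative_transform_within_open[OF that(2) assms(1) that(1)] Suc.prems by blast
  show ?case
  proof (cases "\<forall>x\<in>S. f differentiable (at x)")
    case True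
    then have "Ck_on k S (\<lambda>x. frechet_derivative f (at x) v)
        \<longleftrightarrow> Ck_on k S (\<lambda>x. frechet_derivative g (at x) v)" for v
      using fd by (intro Suc.IH) auto
    with d True show ?thesis by auto
  qed (use d in auto)
qed

lemma smooth_on_cong:
  assumes "open S" "\<And>x. x \<in> S \<Longrightarrow> f x = g x"
  shows "smooth_on S f \<longleftrightarrow> smooth_on S g"
  unfolding smooth_on_def using Ck_on_cong[OF assms] by auto

text \<open>Lets a derivative found by the usual rules replace the opaque
  \<open>frechet_derivative\<close>; the inductions on \<open>k\<close> below go through it.\<close>

lemma Ck_on_SucI:
  assumes "open S" "\<And>x. x \<in> S \<Longrightarrow> (f has_derivative f' x) (at x)" "\<And>v. Ck_on k S (\<lambda>x. f' x v)"
  shows "Ck_on (Suc k) S f"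
proof -
  have "frechet_derivative f (at x) = f' x" if "x \<in> S" for x
    using assms(2)[OF that] frechet_derivative_at by metis
  then have "Ck_on k S (\<lambda>x. frechet_derivative f (at x) v)" for v
    using assms(3)[of v] by (subst Ck_on_cong[OF assms(1)]) auto
  moreover have "f differentiable (at x)" if "x \<in> S" for x
    using assms(2)[OF that] by (auto simp: differentiable_def)
  ultimately show ?thesis by simp
qed

lemma Ck_on_imp_continuous_on: "Ck_on k S f \<Longrightarrow> continuous_on S f"
  by (cases k)
    (auto intro!: continuous_at_imp_continuous_on differentiable_imp_continuous_within)

lemma Ck_on_SucD: "Ck_on (Suc k) S f \<Longrightarrow> Ck_on k S f"
proof (induction k arbitrary: f)
  case 0
  then show ?case using Ck_on_imp_continuous_on[OF 0] by simp
next
  case (Suc k)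
  have "Ck_on k S (\<lambda>x. frechet_derivative f (at x) v)" for v
    using Suc.prems Suc.IH unfolding Ck_on.simps(2)[of "Suc k"] by blast
  moreover have "\<forall>x\<in>S. f differentiable (at x)"
    using Suc.prems unfolding Ck_on.simps(2)[of "Suc k"] by blast
  ultimately show ?case unfolding Ck_on.simps(2) by blast
qed

text \<open>Every derivative in \<open>Ck_on\<close> is a two-sided one at a point, so smoothness
  can be checked on neighbourhoods. This later glues the two pieces of an extended vector
  field.\<close>

lemma Ck_on_local:
  assumes "\<And>x. x \<in> S \<Longrightarrow> \<exists>T. open T \<and> x \<in> T \<and> Ck_on k T f"
  shows "Ck_on k S f"
  using assms
proof (induction k arbitrary: f)
  case 0
  show ?case unfolding Ck_on.simps
  proof (rule continuous_at_imp_continuous_on, rule)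
    fix x assume "x \<in> S"
    from 0[OF this] obtain T where "open T" "x \<in> T" "continuous_on T f" by auto
    then show "isCont f x" by (simp add: continuous_on_eq_continuous_at)
  qed
next
  case (Suc k)
  show ?case unfolding Ck_on.simps
  proof safe
    fix x assume "x \<in> S"
    from Suc.prems[OF this] show "f differentiable (at x)" by auto
  next
    fix v
    show "Ck_on k S (\<lambda>x. frechet_derivative f (at x) v)"
    proof (rule Suc.IH)
      fix x assume "x \<in> S"
      from Suc.prems[OF this]
      show "\<exists>T. open T \<and> x \<in> T \<and> Ck_on k T (\<lambda>x. frechet_derivative f (at x) v)" by auto
    qed
  qed
qed

lemma smooth_on_local:
  assumes "\<And>x. x \<in> S \<Longrightarrow> \<exists>T. open T \<and> x \<in> T \<and> smooth_on T f"
  shows "smooth_on S f"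
  unfolding smooth_on_def
proof
  fix k
  show "Ck_on k S f" using assms by (intro Ck_on_local) (meson smooth_on_def)
qed

lemma smooth_on_imp_continuous_on: "smooth_on S f \<Longrightarrow> continuous_on S f"
  using Ck_on_imp_continuous_on smooth_on_def by blast

lemma smooth_on_differentiable: "smooth_on S f \<Longrightarrow> x \<in> S \<Longrightarrow> f differentiable (at x)"
  unfolding smooth_on_def using Ck_on.simps(2) by blast

lemma smooth_on_has_derivative:
  "smooth_on S f \<Longrightarrow> x \<in> S \<Longrightarrow> (f has_derivative frechet_derivative f (at x)) (at x)"
  using smooth_on_differentiable frechet_derivative_works by blast

lemma smooth_on_frechet: "smooth_on S f \<Longrightarrow> smooth_on S (\<lambda>x. frechet_derivative f (at x) v)"
  unfolding smooth_on_def using Ck_on.simps(2) by blast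

lemma Ck_on_Suc_has_derivative:
  "Ck_on (Suc k) S f \<Longrightarrow> x \<in> S \<Longrightarrow> (f has_derivative frechet_derivative f (at x)) (at x)"
  unfolding Ck_on.simps using frechet_derivative_works by blast

lemma Ck_on_Suc_frechet: "Ck_on (Suc k) S f \<Longrightarrow> Ck_on k S (\<lambda>x. frechet_derivative f (at x) v)"
  unfolding Ck_on.simps by blast

lemma Ck_on_const: "Ck_on k S (\<lambda>x. c)"
  by (induction k arbitrary: c) (auto simp: frechet_derivative_const)

lemma Ck_on_bounded_linear:
  assumes "open S" "bounded_linear L" "Ck_on k S f"
  shows "Ck_on k S (\<lambda>x. L (f x))"
  using assms(3)
proof (induction k arbitrary: f)
  case 0
  then show ?case unfolding Ck_on.simps by (rule bounded_linear.continuous_on[OF assms(2)])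
next
  case (Suc k)
  have "((\<lambda>x. L (f x)) has_derivative (\<lambda>v. L (frechet_derivative f (at x) v))) (at x)" if "x \<in> S" for x
    by (rule bounded_linear.has_derivative[OF assms(2) Ck_on_Suc_has_derivative[OF Suc.prems that]])
  then show ?case
    by (rule Ck_on_SucI[OF assms(1) _ Suc.IH[OF Ck_on_Suc_frechet[OF Suc.prems]]])
qed

lemma Ck_on_id: "open S \<Longrightarrow> Ck_on k S (\<lambda>x. x)"
proof (cases k)
  case (Suc j)
  assume "open S"
  then show ?thesis unfolding Suc
    by (intro Ck_on_SucI[where f' = "\<lambda>x v. v"] Ck_on_const) auto
qed auto

lemma Ck_on_add:
  assumes "open S" "Ck_on k S f" "Ck_on k S g"
  shows "Ck_on k S (\<lambda>x. f x + g x)"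
  using assms(2,3)
proof (induction k arbitrary: f g)
  case (Suc k)
  have "((\<lambda>x. f x + g x) has_derivative (\<lambda>v. frechet_derivative f (at x) v + frechet_derivative g (at x) v)) (at x)"
    if "x \<in> S" for x
    by (rule has_derivative_add[OF Suc.prems[THEN Ck_on_Suc_has_derivative, OF that]])
  then show ?case
    by (rule Ck_on_SucI[OF assms(1) _ Suc.IH[OF Suc.prems[THEN Ck_on_Suc_frechet]]])
qed (auto intro: continuous_on_add)

lemma Ck_on_bilinear:
  assumes "open S" "bounded_bilinear B" "Ck_on k S f" "Ck_on k S g"
  shows "Ck_on k S (\<lambda>x. B (f x) (g x))"
  using assms(3,4)
proof (induction k arbitrary: f g)
  case 0
  then show ?case unfolding Ck_on.simps by (rule bounded_bilinear.continuous_on[OF assms(2)])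
next
  case (Suc k)
  have d: "((\<lambda>x. B (f x) (g x)) has_derivative
      (\<lambda>v. B (f x) (frechet_derivative g (at x) v) + B (frechet_derivative f (at x) v) (g x))) (at x)"
    if "x \<in> S" for x
    by (rule bounded_bilinear.FDERIV[OF assms(2) Suc.prems[THEN Ck_on_Suc_has_derivative, OF that]])
  show ?case
    by (intro Ck_on_SucI[OF assms(1) d] Ck_on_add[OF assms(1)] Suc.IH
        Suc.prems[THEN Ck_on_SucD] Suc.prems[THEN Ck_on_Suc_frechet])
qed

lemma Ck_on_sum:
  assumes "open S" "\<And>i. i \<in> I \<Longrightarrow> Ck_on k S (f i)"
  shows "Ck_on k S (\<lambda>x. \<Sum>i\<in>I. f i x)"
  using assms(2)
  by (induction I rule: infinite_finite_induct) (auto intro: Ck_on_add[OF assms(1)] Ck_on_const)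

lemma linear_euclidean_expand:
  fixes L :: "'a::euclidean_space \<Rightarrow> 'b::real_vector"
  assumes "linear L"
  shows "(\<Sum>b\<in>Basis. (v \<bullet> b) *\<^sub>R L b) = L v"
proof -
  have "L v = L (\<Sum>b\<in>Basis. (v \<bullet> b) *\<^sub>R b)" by (simp only: euclidean_representation)
  then show ?thesis using assms by (simp only: linear_sum linear_scale)
qed

text \<open>\<open>Ck_on\<close> controls derivatives in fixed directions, whereas the chain rule
  applies the derivative of \<open>g\<close> to the moving direction \<open>?Df x v\<close>.
  Expansion in a basis turns this into finitely many products with fixed directions, whence the
  Euclidean middle space.\<close>

lemma Ck_on_compose:
  fixes f :: "'a::real_normed_vector \<Rightarrow> 'b::euclidean_space"
  assumes "open S" "open T" "Ck_on k S f" "Ck_on k T g" "f ` S \<subseteq> T"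
  shows "Ck_on k S (\<lambda>x. g (f x))"
  using assms(3-5)
proof (induction k arbitrary: f g)
  case 0
  then show ?case using continuous_on_compose2[of T g S f] by auto
next
  case (Suc k)
  let ?Df = "\<lambda>x. frechet_derivative f (at x)" and ?Dg = "\<lambda>x. frechet_derivative g (at x)"
  have d: "((\<lambda>x. g (f x)) has_derivative (\<lambda>v. \<Sum>b\<in>Basis. (?Df x v \<bullet> b) *\<^sub>R ?Dg (f x) b)) (at x)"
    if "x \<in> S" for x
  proof -
    have f: "(f has_derivative ?Df x) (at x)"
      by (rule Ck_on_Suc_has_derivative[OF Suc.prems(1) that])
    have g: "(g has_derivative ?Dg (f x)) (at (f x))"
      using Suc.prems(3) that by (intro Ck_on_Suc_has_derivative[OF Suc.prems(2)]) auto
    have "?Dg (f x) (?Df x v) = (\<Sum>b\<in>Basis. (?Df x v \<bullet> b) *\<^sub>R ?Dg (f x) b)" for v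
      using linear_euclidean_expand[OF has_derivative_linear[OF g]] by simp
    with has_derivative_compose[OF f g] show ?thesis by (simp add: o_def)
  qed
  show ?case
  proof (rule Ck_on_SucI[OF assms(1) d], assumption, intro Ck_on_sum[OF assms(1)])
    fix v b
    have "Ck_on k S (\<lambda>x. ?Df x v \<bullet> b)"
      by (rule Ck_on_bounded_linear[OF assms(1) bounded_linear_inner_left Ck_on_Suc_frechet[OF Suc.prems(1)]])
    moreover have "Ck_on k S (\<lambda>x. ?Dg (f x) b)"
      by (rule Suc.IH[OF Ck_on_SucD[OF Suc.prems(1)] Ck_on_Suc_frechet[OF Suc.prems(2)] Suc.prems(3)])
    ultimately show "Ck_on k S (\<lambda>x. (?Df x v \<bullet> b) *\<^sub>R ?Dg (f x) b)"
      by (intro Ck_on_bilinear[OF assms(1) bounded_bilinear_scaleR])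
  qed
qed

text \<open>The derivative of 1/f is a product of copies of 1/f and a derivative of f, so the
  induction hypothesis for 1/f itself closes the step.\<close>

lemma Ck_on_inverse:
  fixes f :: "'a::real_normed_vector \<Rightarrow> real"
  assumes "open S" "Ck_on k S f" "\<And>x. x \<in> S \<Longrightarrow> f x \<noteq> 0"
  shows "Ck_on k S (\<lambda>x. inverse (f x))"
  using assms(2)
proof (induction k)
  case 0
  then show ?case using assms(3) by (simp add: continuous_on_inverse)
next
  case (Suc k)
  have d: "((\<lambda>x. inverse (f x)) has_derivative
     (\<lambda>v. - (inverse (f x) * frechet_derivative f (at x) v * inverse (f x)))) (at x)" if "x \<in> S" for x
    by (rule Deriv.has_derivative_inverse[OF assms(3)[OF that] Ck_on_Suc_has_derivative[OF Suc.prems that]])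
  note neg = Ck_on_bounded_linear[OF assms(1) bounded_linear_minus[OF bounded_linear_ident]]
  note mult = Ck_on_bilinear[OF assms(1) bounded_bilinear_mult]
  show ?case
    by (intro Ck_on_SucI[OF assms(1) d] neg mult Suc.IH Ck_on_SucD[OF Suc.prems] Ck_on_Suc_frechet[OF Suc.prems])
qed

named_theorems smooth_intros

lemma smooth_on_const[smooth_intros]: "smooth_on S (\<lambda>x. c)"
  by (simp add: smooth_on_def Ck_on_const)

lemma smooth_on_id[smooth_intros]: "open S \<Longrightarrow> smooth_on S (\<lambda>x. x)"
  by (simp add: smooth_on_def Ck_on_id)

lemma smooth_on_bounded_linear:
  "bounded_linear L \<Longrightarrow> open S \<Longrightarrow> smooth_on S f \<Longrightarrow> smooth_on S (\<lambda>x. L (f x))"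
  by (simp add: smooth_on_def Ck_on_bounded_linear)

lemma smooth_on_bilinear:
  "bounded_bilinear B \<Longrightarrow> open S \<Longrightarrow> smooth_on S f \<Longrightarrow> smooth_on S g \<Longrightarrow> smooth_on S (\<lambda>x. B (f x) (g x))"
  by (simp add: smooth_on_def Ck_on_bilinear)

lemma smooth_on_add[smooth_intros]:
  "open S \<Longrightarrow> smooth_on S f \<Longrightarrow> smooth_on S g \<Longrightarrow> smooth_on S (\<lambda>x. f x + g x)"
  by (simp add: smooth_on_def Ck_on_add)

lemma smooth_on_sum[smooth_intros]:
  "open S \<Longrightarrow> (\<And>i. i \<in> I \<Longrightarrow> smooth_on S (f i)) \<Longrightarrow> smooth_on S (\<lambda>x. \<Sum>i\<in>I. f i x)"
  by (simp add: smooth_on_def Ck_on_sum)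

lemmas smooth_on_minus[smooth_intros] = smooth_on_bounded_linear[OF bounded_linear_minus[OF bounded_linear_ident]]
lemmas smooth_on_fst[smooth_intros] = smooth_on_bounded_linear[OF bounded_linear_fst]
lemmas smooth_on_snd[smooth_intros] = smooth_on_bounded_linear[OF bounded_linear_snd]
lemmas smooth_on_vec_nth[smooth_intros] = smooth_on_bounded_linear[OF bounded_linear_vec_nth]
lemmas smooth_on_inner[smooth_intros] = smooth_on_bilinear[OF bounded_bilinear_inner]
lemmas smooth_on_mult[smooth_intros] =
  smooth_on_bilinear[OF bounded_bilinear_mult[where 'a = real]]
lemmas smooth_on_scaleR[smooth_intros] = smooth_on_bilinear[OF bounded_bilinear_scaleR]

lemma smooth_on_diff[smooth_intros]:
  "open S \<Longrightarrow> smooth_on S f \<Longrightarrow> smooth_on S g \<Longrightarrow> smooth_on S (\<lambda>x. f x - g x)"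
  using smooth_on_add[of S f "\<lambda>x. - g x"] smooth_on_minus[of S g] by simp

lemma smooth_on_Pair[smooth_intros]:
  assumes "open S" "smooth_on S f" "smooth_on S g"
  shows "smooth_on S (\<lambda>x. (f x, g x))"
proof -
  have "bounded_linear (\<lambda>x::'b. (x, 0::'c))" "bounded_linear (\<lambda>y::'c. (0::'b, y))"
    by (auto intro!: bounded_linear_Pair bounded_linear_ident bounded_linear_zero)
  then have "smooth_on S (\<lambda>x. (f x, 0) + (0, g x))"
    using assms by (intro smooth_on_add smooth_on_bounded_linear[of "\<lambda>x. (x, 0)"]
        smooth_on_bounded_linear[of "\<lambda>y. (0, y)"]) auto
  then show ?thesis by simp
qed

lemma smooth_on_vec:
  fixes f :: "'a::real_normed_vector \<Rightarrow> real ^ 'n"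
  assumes "open S" "\<And>i. smooth_on S (\<lambda>x. f x $ i)"
  shows "smooth_on S f"
proof -
  have "smooth_on S (\<lambda>x. \<Sum>i\<in>UNIV. (f x $ i) *\<^sub>R axis i 1)"
    by (intro smooth_on_sum smooth_on_scaleR smooth_on_const assms)
  moreover have "(\<lambda>x. \<Sum>i\<in>UNIV. (f x $ i) *\<^sub>R axis i 1) = f"
    using basis_expansion[where 'a = real] by (auto simp: scalar_mult_eq_scaleR)
  ultimately show ?thesis by (rule back_subst[where P = "smooth_on S"])
qed

lemma smooth_on_vec_lambda[smooth_intros]:
  "open S \<Longrightarrow> (\<And>i. smooth_on S (\<lambda>x. f x i)) \<Longrightarrow> smooth_on S (\<lambda>x. (\<chi> i. f x i) :: real ^ 'n)"
  by (rule smooth_on_vec) auto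

lemma smooth_on_compose:
  fixes f :: "'a::real_normed_vector \<Rightarrow> 'b::euclidean_space"
  shows "open S \<Longrightarrow> open T \<Longrightarrow> smooth_on T g \<Longrightarrow> smooth_on S f \<Longrightarrow> f ` S \<subseteq> T
    \<Longrightarrow> smooth_on S (\<lambda>x. g (f x))"
  by (auto simp add: smooth_on_def intro: Ck_on_compose)

lemma smooth_on_inverse[smooth_intros]:
  fixes f :: "'a::real_normed_vector \<Rightarrow> real"
  shows "open S \<Longrightarrow> smooth_on S f \<Longrightarrow> (\<And>x. x \<in> S \<Longrightarrow> f x \<noteq> 0) \<Longrightarrow> smooth_on S (\<lambda>x. inverse (f x))"
  by (simp add: smooth_on_def Ck_on_inverse)

lemma smooth_on_divide[smooth_intros]:
  fixes f :: "'a::real_normed_vector \<Rightarrow> real"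
  shows "open S \<Longrightarrow> smooth_on S f \<Longrightarrow> smooth_on S g \<Longrightarrow> (\<And>x. x \<in> S \<Longrightarrow> g x \<noteq> 0)
    \<Longrightarrow> smooth_on S (\<lambda>x. f x / g x)"
  unfolding divide_inverse by (intro smooth_intros)

lemma smooth_on_prod[smooth_intros]:
  fixes f :: "'i \<Rightarrow> 'a::real_normed_vector \<Rightarrow> real"
  assumes "open S" "\<And>i. i \<in> I \<Longrightarrow> smooth_on S (f i)"
  shows "smooth_on S (\<lambda>x. \<Prod>i\<in>I. f i x)"
  using assms(2)
  by (induction I rule: infinite_finite_induct) (auto intro!: smooth_intros assms(1))

lemma smooth_on_det[smooth_intros]:
  fixes f :: "'a::real_normed_vector \<Rightarrow> 'n \<Rightarrow> 'n::finite \<Rightarrow> real"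
  assumes "open S" "\<And>i j. smooth_on S (\<lambda>x. f x i j)"
  shows "smooth_on S (\<lambda>x. det (\<chi> i j. f x i j))"
  unfolding det_def using assms by (simp, intro smooth_intros) auto

text \<open>Again a basis expansion, now with a direction \<open>h x\<close> that moves with the
  point. This is the form in which tangent maps occur in velocities, pushed fields and
  lifts.\<close>

lemma smooth_on_frechet_compose:
  fixes f :: "'a::real_normed_vector \<Rightarrow> 'b::euclidean_space" and g :: "'b \<Rightarrow> 'c::real_normed_vector"
  assumes "open S" "open T" "smooth_on T g" "smooth_on S f" "f ` S \<subseteq> T" "smooth_on S h"
  shows "smooth_on S (\<lambda>x. frechet_derivative g (at (f x)) (h x))"
proof -
  have "smooth_on S (\<lambda>x. \<Sum>b\<in>Basis. (h x \<bullet> b) *\<^sub>R frechet_derivative g (at (f x)) b)"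
    by (intro smooth_on_sum smooth_on_scaleR smooth_on_inner smooth_on_const assms
        smooth_on_compose[OF assms(1,2) smooth_on_frechet[OF assms(3)] assms(4,5)])
  moreover have "(\<Sum>b\<in>Basis. (h x \<bullet> b) *\<^sub>R frechet_derivative g (at (f x)) b)
      = frechet_derivative g (at (f x)) (h x)" if "x \<in> S" for x
  proof -
    have "linear (frechet_derivative g (at (f x)))"
      using assms that smooth_on_has_derivative has_derivative_linear by blast
    then show ?thesis by (rule linear_euclidean_expand)
  qed
  ultimately show ?thesis by (subst (asm) smooth_on_cong[OF assms(1)])
qed

subsection \<open>Smooth cutoff functions\<close>

text \<open>The powers of 1/x are carried along because differentiating exp(-1/x) creates them: the
  linear span of the family is closed under differentiation, so one induction over all
  \<open>n\<close> gives smoothness.\<close>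

definition exp_recip :: "nat \<Rightarrow> real \<Rightarrow> real" where
  "exp_recip n x = (if x > 0 then inverse x ^ n * exp (- inverse x) else 0)"

lemma exp_recip_tendsto_0: "((\<lambda>x. inverse x ^ n * exp (- inverse x)) \<longlongrightarrow> (0::real)) (at_right 0)"
proof -
  have "((\<lambda>x::real. x ^ n / exp x) \<longlongrightarrow> 0) at_top"
    by (rule tendsto_power_div_exp_0)
  then have "((\<lambda>x::real. inverse x ^ n / exp (inverse x)) \<longlongrightarrow> 0) (at_right 0)"
    using filterlim_compose[OF _ filterlim_inverse_at_top_right] by blast
  then show ?thesis by (simp add: exp_minus divide_inverse)
qed

lemma exp_recip_has_derivative:
  "(exp_recip n has_real_derivative exp_recip (n + 2) x - n * exp_recip (n + 1) x) (at x)"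
proof -
  consider "x > 0" | "x < 0" | "x = 0" by linarith
  then show ?thesis
  proof cases
    case 1
    have "((\<lambda>x. inverse x ^ n * exp (- inverse x)) has_real_derivative
        inverse x ^ (n + 2) * exp (- inverse x) - n * (inverse x ^ (n + 1) * exp (- inverse x))) (at x)"
      using 1 by (cases n) (auto intro!: derivative_eq_intros simp: field_simps power2_eq_square,
        metis One_nat_def mult.commute neq0_conv power_minus_mult)
    then have "((\<lambda>x. inverse x ^ n * exp (- inverse x)) has_real_derivative
        exp_recip (n + 2) x - n * exp_recip (n + 1) x) (at x)"
      using 1 by (simp add: exp_recip_def)
    then show ?thesis
      by (rule has_field_derivative_transform_within_open[where S = "{0<..}"])
        (use 1 in \<open>auto simp: exp_recip_def\<close>)
  next
    case 2
    have "((\<lambda>x. 0) has_real_derivative exp_recip (n + 2) x - n * exp_recip (n + 1) x) (at x)"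
      using 2 by (simp add: exp_recip_def)
    then show ?thesis
      by (rule has_field_derivative_transform_within_open[where S = "{..<0}"])
        (use 2 in \<open>auto simp: exp_recip_def\<close>)
  next
    case 3
    have "((\<lambda>y. (exp_recip n y - exp_recip n 0) / (y - 0)) \<longlongrightarrow> 0) (at_right 0)"
      using exp_recip_tendsto_0[of "Suc n"]
      by (rule Lim_transform_eventually)
        (auto simp: eventually_at_right_field exp_recip_def field_simps intro!: exI[of _ 1])
    moreover have "((\<lambda>y. (exp_recip n y - exp_recip n 0) / (y - 0)) \<longlongrightarrow> 0) (at_left 0)"
      by (rule tendsto_eventually)
        (auto simp: eventually_at_left_field exp_recip_def intro!: exI[of _ "-1"])
    ultimately have "((\<lambda>y. (exp_recip n y - exp_recip n 0) / (y - 0)) \<longlongrightarrow> 0) (at 0)"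
      by (simp add: filterlim_split_at)
    then show ?thesis using 3 by (simp add: has_field_derivative_iff exp_recip_def)
  qed
qed

lemma smooth_on_exp_recip: "smooth_on UNIV (exp_recip n)"
  unfolding smooth_on_def
proof
  fix k show "Ck_on k UNIV (exp_recip n)"
  proof (induction k arbitrary: n)
    case 0
    then show ?case
      using exp_recip_has_derivative
      by (auto intro!: continuous_at_imp_continuous_on DERIV_isCont)
  next
    case (Suc k)
    note mult = Ck_on_bilinear[OF open_UNIV bounded_bilinear_mult[where 'a = real]]
    have "(exp_recip n has_derivative (\<lambda>v. (exp_recip (n + 2) x + (- real n) * exp_recip (n + 1) x) * v)) (at x)" for x
      using exp_recip_has_derivative[of n x] by (simp add: has_field_derivative_def)
    then show ?case
      by (rule Ck_on_SucI[OF open_UNIV]) (intro mult Ck_on_add Ck_on_const Suc.IH open_UNIV)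
  qed
qed

text \<open>The function is N / (N + D), with N positive exactly inside radius r and D positive
  exactly outside radius r/2, so the denominator never vanishes. The squared distance is used
  because it is smooth at the centre too.\<close>

lemma smooth_bump:
  fixes y0 :: "'e::euclidean_space"
  assumes "r > 0"
  obtains \<phi> :: "'e \<Rightarrow> real" where "smooth_on UNIV \<phi>"
    "\<And>y. dist y0 y < r / 2 \<Longrightarrow> \<phi> y = 1" "\<And>y. dist y0 y \<ge> r \<Longrightarrow> \<phi> y = 0"
proof -
  define s where "s = (\<lambda>y. (y - y0) \<bullet> (y - y0))"
  have s: "s y = (dist y0 y)\<^sup>2" for y
    unfolding s_def by (subst dist_commute) (simp only: dist_norm power2_norm_eq_inner)
  define N where "N = (\<lambda>y. exp_recip 0 (r\<^sup>2 - s y))"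
  define D where "D = (\<lambda>y. exp_recip 0 (s y - (r/2)\<^sup>2))"
  have nn: "N y \<ge> 0" "D y \<ge> 0" for y by (simp_all add: N_def D_def exp_recip_def)
  have lt: "(r/2)\<^sup>2 < r\<^sup>2" using assms by (simp add: power2_eq_square)
  have ne: "N y + D y \<noteq> 0" for y
  proof (cases "s y < r\<^sup>2")
    case True
    then have "N y > 0" by (simp add: N_def exp_recip_def)
    then show ?thesis using nn[of y] by linarith
  next
    case False
    then have "D y > 0" using lt by (simp add: D_def exp_recip_def)
    then show ?thesis using nn[of y] by linarith
  qed
  have sm: "smooth_on UNIV s" unfolding s_def by (intro smooth_intros) auto
  have smN: "smooth_on UNIV N" and smD: "smooth_on UNIV D"
    unfolding N_def D_def
    by (rule smooth_on_compose[OF open_UNIV open_UNIV smooth_on_exp_recip];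
        (intro smooth_intros sm)?; simp)+
  show ?thesis
  proof (rule that)
    show "smooth_on UNIV (\<lambda>y. N y / (N y + D y))"
      using smN smD ne by (intro smooth_intros) auto
    fix y
    show "N y / (N y + D y) = 1" if "dist y0 y < r / 2"
    proof -
      have "s y < (r/2)\<^sup>2" unfolding s using that by (intro power_strict_mono) auto
      then have "D y = 0" by (simp add: D_def exp_recip_def)
      then show ?thesis using ne[of y] by simp
    qed
    show "N y / (N y + D y) = 0" if "dist y0 y \<ge> r"
    proof -
      have "s y \<ge> r\<^sup>2" unfolding s using that assms by (intro power_mono) auto
      then show ?thesis by (simp add: N_def exp_recip_def)
    qed
  qed
qed

subsection \<open>Partial derivatives\<close>

lemma vec_upd_eq: "vec_upd t a s = t + (s - t $ a) *\<^sub>R axis a 1"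
  by (simp add: vec_upd_def vec_eq_iff axis_def)

lemma vec_upd_same[simp]: "vec_upd t a (t $ a) = t"
  by (simp add: vec_upd_eq)

lemma has_derivative_partial:
  assumes "(f has_derivative f') (at t)"
  shows "((\<lambda>s. f (vec_upd t a s)) has_derivative (\<lambda>h. h *\<^sub>R f' (axis a 1))) (at (t $ a))"
proof -
  have "((\<lambda>s. vec_upd t a s) has_derivative (\<lambda>h. h *\<^sub>R axis a 1)) (at (t $ a))"
    unfolding vec_upd_eq by (auto intro!: derivative_eq_intros)
  moreover have "(f has_derivative f') (at (vec_upd t a (t $ a)))" using assms by simp
  ultimately have "((\<lambda>s. f (vec_upd t a s)) has_derivative (\<lambda>h. f' (h *\<^sub>R axis a 1))) (at (t $ a))"
    using has_derivative_compose by fastforce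
  moreover have "f' (h *\<^sub>R axis a 1) = h *\<^sub>R f' (axis a 1)" for h
    using linear_scale[OF has_derivative_linear[OF assms]] .
  ultimately show ?thesis by simp
qed

lemma pd_eqI:
  assumes "(f has_derivative f') (at t)"
  shows "pd a f t = f' (axis a 1)"
proof -
  have *: "((\<lambda>s. f (vec_upd t a s)) has_field_derivative f' (axis a 1)) (at (t $ a))"
    using has_derivative_partial[OF assms, of a]
    by (simp add: has_field_derivative_def mult_commute_abs)
  then show ?thesis unfolding pd_def by (rule DERIV_imp_deriv)
qed

lemma pd_eq_frechet: "f differentiable (at t) \<Longrightarrow> pd a f t = frechet_derivative f (at t) (axis a 1)"
  by (rule pd_eqI) (simp add: frechet_derivative_works[symmetric])

lemma pd_cong:
  assumes "open S" "t \<in> S" "\<And>x. x \<in> S \<Longrightarrow> f x = g x"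
  shows "pd a f t = pd a g t"
proof -
  have "continuous_on UNIV (vec_upd t a)"
    unfolding vec_upd_eq[abs_def] by (intro continuous_intros)
  then have "open (vec_upd t a -` S)" using assms(1) continuous_open_vimage
    by (metis continuous_on_open_vimage inf_top_right open_UNIV)
  moreover have "t $ a \<in> vec_upd t a -` S" using assms(2) by simp
  ultimately have "eventually (\<lambda>s. f (vec_upd t a s) = g (vec_upd t a s)) (nhds (t $ a))"
    using assms(3) unfolding eventually_nhds by (intro exI[of _ "vec_upd t a -` S"]) auto
  then show ?thesis unfolding pd_def by (intro deriv_cong_ev) auto
qed

lemma pd_const[simp]: "pd a (\<lambda>t. c) t = 0"
  by (simp add: pd_def)

lemma pd_add: "f differentiable (at t) \<Longrightarrow> g differentiable (at t) \<Longrightarrow>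
    pd a (\<lambda>x. f x + g x) t = pd a f t + pd a g t"
  by (subst pd_eqI[OF has_derivative_add]) (auto simp: pd_eq_frechet frechet_derivative_works[symmetric])

lemma pd_minus: "f differentiable (at t) \<Longrightarrow> pd a (\<lambda>x. - f x) t = - pd a f t"
  by (subst pd_eqI[OF has_derivative_minus]) (auto simp: pd_eq_frechet frechet_derivative_works[symmetric])

lemma pd_mult: "f differentiable (at t) \<Longrightarrow> g differentiable (at t) \<Longrightarrow>
    pd a (\<lambda>x. f x * g x) t = f t * pd a g t + pd a f t * g t"
  by (subst pd_eqI[OF has_derivative_mult]) (auto simp: pd_eq_frechet frechet_derivative_works[symmetric])

lemma pd_sum: "(\<And>i. i \<in> I \<Longrightarrow> f i differentiable (at t)) \<Longrightarrow>
    pd a (\<lambda>x. \<Sum>i\<in>I. f i x) t = (\<Sum>i\<in>I. pd a (f i) t)"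
  by (subst pd_eqI[OF has_derivative_sum[where f' = "\<lambda>i. frechet_derivative (f i) (at t)"]])
    (auto simp: pd_eq_frechet frechet_derivative_works[symmetric])

lemma smooth_on_pd:
  assumes "open S" "smooth_on S f"
  shows "smooth_on S (pd a f)"
  using smooth_on_frechet[OF assms(2), of "axis a 1"]
  by (subst smooth_on_cong[OF assms(1)]) (auto simp: pd_eq_frechet smooth_on_differentiable[OF assms(2)])

lemma pd_compose:
  fixes \<tau> :: "real ^ 'i \<Rightarrow> real ^ 'j" and f :: "real ^ 'j \<Rightarrow> real"
  assumes "\<tau> differentiable (at t)" "f differentiable (at (\<tau> t))"
  shows "pd a (\<lambda>x. f (\<tau> x)) t = (\<Sum>c\<in>UNIV. pd c f (\<tau> t) * pd a (\<lambda>x. \<tau> x $ c) t)"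
proof -
  obtain D E where D: "(\<tau> has_derivative D) (at t)" and E: "(f has_derivative E) (at (\<tau> t))"
    using assms by (auto simp: differentiable_def)
  have "pd a (\<lambda>x. f (\<tau> x)) t = E (D (axis a 1))"
    by (rule pd_eqI) (use has_derivative_compose[OF D E] in simp)
  also have "D (axis a 1) = (\<Sum>c\<in>UNIV. (D (axis a 1) $ c) *\<^sub>R axis c 1)"
    using basis_expansion[of "D (axis a 1)"] by (simp add: scalar_mult_eq_scaleR)
  also have "E \<dots> = (\<Sum>c\<in>UNIV. (D (axis a 1) $ c) * E (axis c 1))"
    using has_derivative_linear[OF E] by (simp add: linear_sum linear_scale)
  also have "\<dots> = (\<Sum>c\<in>UNIV. pd c f (\<tau> t) * pd a (\<lambda>x. \<tau> x $ c) t)"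
  proof (rule sum.cong)
    fix c
    have "pd a (\<lambda>x. \<tau> x $ c) t = D (axis a 1) $ c"
      by (rule pd_eqI) (rule bounded_linear.has_derivative[OF bounded_linear_vec_nth D])
    then show "(D (axis a 1) $ c) * E (axis c 1) = pd c f (\<tau> t) * pd a (\<lambda>x. \<tau> x $ c) t"
      by (simp add: pd_eqI[OF E])
  qed simp
  finally show ?thesis .
qed

text \<open>The first sum, with second derivatives of \<open>\<tau>\<close>, is what prevents second
  derivatives from being tensorial. It will vanish in vertical directions, where the transitions of
  1-jets are linear in the velocity.\<close>

lemma pd_pd_compose:
  fixes \<tau> :: "real ^ 'i \<Rightarrow> real ^ 'j" and f :: "real ^ 'j \<Rightarrow> real"
  assumes S: "open S" "smooth_on S \<tau>" and T: "open T" "smooth_on T f" and sub: "\<tau> ` S \<subseteq> T" and t: "t \<in> S"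
  shows "pd a (pd b (\<lambda>x. f (\<tau> x))) t = (\<Sum>c\<in>UNIV. pd c f (\<tau> t) * pd a (pd b (\<lambda>x. \<tau> x $ c)) t)
    + (\<Sum>c\<in>UNIV. (\<Sum>d\<in>UNIV. pd d (pd c f) (\<tau> t) * pd a (\<lambda>x. \<tau> x $ d) t) * pd b (\<lambda>x. \<tau> x $ c) t)"
proof -
  have sc: "smooth_on S (\<lambda>x. \<tau> x $ c)" for c using S by (intro smooth_intros)
  have d1: "(\<lambda>x. pd c f (\<tau> x)) differentiable (at t)" for c
    using smooth_on_compose[OF S(1) T(1) smooth_on_pd[OF T] S(2) sub] smooth_on_differentiable t by blast
  have d2: "pd b (\<lambda>x. \<tau> x $ c) differentiable (at t)" for c
    using smooth_on_pd[OF S(1) sc] smooth_on_differentiable t by blast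
  have "pd a (pd b (\<lambda>x. f (\<tau> x))) t
      = pd a (\<lambda>x. \<Sum>c\<in>UNIV. pd c f (\<tau> x) * pd b (\<lambda>x. \<tau> x $ c) x) t"
    using S T sub t
    by (intro pd_cong[OF S(1) t] pd_compose) (auto intro: smooth_on_differentiable)
  also have "\<dots> = (\<Sum>c\<in>UNIV. pd c f (\<tau> t) * pd a (pd b (\<lambda>x. \<tau> x $ c)) t
      + pd a (\<lambda>x. pd c f (\<tau> x)) t * pd b (\<lambda>x. \<tau> x $ c) t)"
    using d1 d2 by (simp add: pd_sum pd_mult)
  also have "\<dots> = (\<Sum>c\<in>UNIV. pd c f (\<tau> t) * pd a (pd b (\<lambda>x. \<tau> x $ c)) t
      + (\<Sum>d\<in>UNIV. pd d (pd c f) (\<tau> t) * pd a (\<lambda>x. \<tau> x $ d) t) * pd b (\<lambda>x. \<tau> x $ c) t)"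
  proof -
    have "\<tau> differentiable (at t)" using S t smooth_on_differentiable by blast
    moreover have "pd c f differentiable (at (\<tau> t))" for c
      using smooth_on_pd[OF T] sub t smooth_on_differentiable by blast
    ultimately show ?thesis by (simp add: pd_compose)
  qed
  finally show ?thesis by (simp add: sum.distrib)
qed

text \<open>The mean value theorem is applied twice, along \<open>v\<close> to a difference in
  direction \<open>w\<close> and then along \<open>w\<close>. The second difference is symmetric in
  \<open>v\<close> and \<open>w\<close>, while the right-hand side fixes an order of
  differentiation.\<close>

lemma second_difference_mvt:
  fixes f :: "'a::real_normed_vector \<Rightarrow> real"
  assumes S: "open S" "smooth_on S f" and h: "h > 0"
    and box: "\<And>r s. \<lbrakk>0 \<le> r; r \<le> h; 0 \<le> s; s \<le> h\<rbrakk> \<Longrightarrow> t + r *\<^sub>R v + s *\<^sub>R w \<in> S"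
  shows "\<exists>r s. 0 < r \<and> r < h \<and> 0 < s \<and> s < h \<and>
    f (t + h *\<^sub>R v + h *\<^sub>R w) - f (t + h *\<^sub>R v) - f (t + h *\<^sub>R w) + f t =
    h * (h * frechet_derivative (\<lambda>x. frechet_derivative f (at x) v) (at (t + r *\<^sub>R v + s *\<^sub>R w)) w)"
proof -
  have line: "((\<lambda>x. g (p + x *\<^sub>R u)) has_real_derivative frechet_derivative g (at (p + x *\<^sub>R u)) u) (at x)"
    if "smooth_on S g" "p + x *\<^sub>R u \<in> S" for g p u x
  proof -
    have g: "(g has_derivative frechet_derivative g (at (p + x *\<^sub>R u))) (at (p + x *\<^sub>R u))"
      using that smooth_on_has_derivative by blast
    have "((\<lambda>x. p + x *\<^sub>R u) has_derivative (\<lambda>h. h *\<^sub>R u)) (at x)"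
      by (auto intro!: derivative_eq_intros)
    from has_derivative_compose[OF this g] show ?thesis
      using linear_scale[OF has_derivative_linear[OF g]]
      by (simp add: has_field_derivative_def mult_commute_abs)
  qed
  define g where "g = (\<lambda>r. f ((t + h *\<^sub>R w) + r *\<^sub>R v) - f (t + r *\<^sub>R v))"
  have "\<exists>r. 0 < r \<and> r < h \<and> g h - g 0 = (h - 0) *
      (frechet_derivative f (at ((t + h *\<^sub>R w) + r *\<^sub>R v)) v - frechet_derivative f (at (t + r *\<^sub>R v)) v)"
  proof -
    have "(g has_real_derivative (frechet_derivative f (at ((t + h *\<^sub>R w) + r *\<^sub>R v)) v
        - frechet_derivative f (at (t + r *\<^sub>R v)) v)) (at r)" if "0 \<le> r" "r \<le> h" for r
      unfolding g_def using box[of r h] box[of r 0] that h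
      by (intro DERIV_diff line S) (auto simp: algebra_simps)
    from MVT2[OF h this] show ?thesis by blast
  qed
  then obtain r where r: "0 < r" "r < h" and gr: "g h - g 0 = h *
      (frechet_derivative f (at ((t + h *\<^sub>R w) + r *\<^sub>R v)) v - frechet_derivative f (at (t + r *\<^sub>R v)) v)"
    by auto
  define k where "k = (\<lambda>s. frechet_derivative f (at ((t + r *\<^sub>R v) + s *\<^sub>R w)) v)"
  have "\<exists>s. 0 < s \<and> s < h \<and> k h - k 0 = (h - 0) *
      frechet_derivative (\<lambda>x. frechet_derivative f (at x) v) (at ((t + r *\<^sub>R v) + s *\<^sub>R w)) w"
  proof -
    have "(k has_real_derivative
        frechet_derivative (\<lambda>x. frechet_derivative f (at x) v) (at ((t + r *\<^sub>R v) + s *\<^sub>R w)) w) (at s)"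
      if "0 \<le> s" "s \<le> h" for s
      unfolding k_def using box[of r s] that r
      by (intro line smooth_on_frechet S) (auto simp: algebra_simps)
    from MVT2[OF h this] show ?thesis by blast
  qed
  then obtain s where s: "0 < s" "s < h" and ks: "k h - k 0 = h *
      frechet_derivative (\<lambda>x. frechet_derivative f (at x) v) (at ((t + r *\<^sub>R v) + s *\<^sub>R w)) w"
    by auto
  have "f (t + h *\<^sub>R v + h *\<^sub>R w) - f (t + h *\<^sub>R v) - f (t + h *\<^sub>R w) + f t = g h - g 0"
    by (simp add: g_def algebra_simps)
  also have "\<dots> = h * (k h - k 0)"
    unfolding gr k_def by (simp add: algebra_simps)
  finally show ?thesis unfolding ks using r s by blast
qed

text \<open>Exchanging \<open>v\<close> and \<open>w\<close> in the symmetric second difference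
  makes the two mixed derivatives agree at two points of an arbitrarily small parallelogram; by
  continuity they cannot differ at \<open>t\<close>.\<close>

lemma frechet_derivative_commute:
  fixes f :: "'a::real_normed_vector \<Rightarrow> real"
  assumes S: "open S" "smooth_on S f" and t: "t \<in> S"
  shows "frechet_derivative (\<lambda>x. frechet_derivative f (at x) v) (at t) w
    = frechet_derivative (\<lambda>x. frechet_derivative f (at x) w) (at t) v"
proof (rule ccontr)
  define G where "G = (\<lambda>v w x. frechet_derivative (\<lambda>x. frechet_derivative f (at x) v) (at x) w)"
  assume "\<not> ?thesis"
  then have ne: "G v w t \<noteq> G w v t" by (simp add: G_def)
  define e where "e = \<bar>G v w t - G w v t\<bar> / 2"
  have e: "e > 0" using ne by (simp add: e_def)
  have cont: "isCont (G v w) t" for v w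
    using smooth_on_imp_continuous_on[OF smooth_on_frechet[OF smooth_on_frechet[OF S(2)]]] S t
    by (simp add: G_def continuous_on_eq_continuous_at)
  obtain d1 where d1: "d1 > 0" "\<And>x. dist x t < d1 \<Longrightarrow> dist (G v w x) (G v w t) < e"
    using cont[of v w] e unfolding continuous_at_eps_delta by blast
  obtain d2 where d2: "d2 > 0" "\<And>x. dist x t < d2 \<Longrightarrow> dist (G w v x) (G w v t) < e"
    using cont[of w v] e unfolding continuous_at_eps_delta by blast
  obtain d3 where d3: "d3 > 0" "ball t d3 \<subseteq> S" using S t open_contains_ball by blast
  define d where "d = min d1 (min d2 d3)"
  have d: "d > 0" using d1 d2 d3 by (simp add: d_def)
  \<comment> \<open>Small enough for the whole parallelogram with sides \<open>h *\<^sub>R v\<close>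
    and \<open>h *\<^sub>R w\<close> to lie within \<open>d\<close> of \<open>t\<close>; the summand
    1 covers the case that both vectors are zero.\<close>
  define h where "h = d / (2 * (norm v + norm w + 1))"
  have h: "h > 0" using d by (simp add: h_def add_nonneg_pos)
  have hd: "h * (norm v + norm w) < d"
  proof -
    have "h * (norm v + norm w) \<le> h * (norm v + norm w + 1)" using h by (intro mult_left_mono) auto
    also have "\<dots> = d / 2"
    proof -
      have "norm v + norm w + 1 > 0" by (simp add: add_nonneg_pos)
      then show ?thesis by (simp add: h_def field_simps)
    qed
    finally show ?thesis using d by simp
  qed
  have near: "dist (t + r *\<^sub>R v + s *\<^sub>R w) t < d" if "0 \<le> r" "r \<le> h" "0 \<le> s" "s \<le> h" for r s
  proof -
    have "dist (t + r *\<^sub>R v + s *\<^sub>R w) t = norm (r *\<^sub>R v + s *\<^sub>R w)" by (simp add: dist_norm)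
    also have "\<dots> \<le> r * norm v + s * norm w" using that norm_triangle_ineq[of "r *\<^sub>R v" "s *\<^sub>R w"] by simp
    also have "\<dots> \<le> h * norm v + h * norm w" using that by (intro add_mono mult_right_mono) auto
    finally show ?thesis using hd by (simp add: distrib_left)
  qed
  have inS: "t + r *\<^sub>R v + s *\<^sub>R w \<in> S" if "0 \<le> r" "r \<le> h" "0 \<le> s" "s \<le> h" for r s
    using near[OF that] d3 by (auto simp: d_def dist_commute subset_eq)
  have inS': "t + r *\<^sub>R w + s *\<^sub>R v \<in> S" if "0 \<le> r" "r \<le> h" "0 \<le> s" "s \<le> h" for r s
    using inS[OF that(3,4,1,2)] by (simp add: algebra_simps)
  from second_difference_mvt[OF S h inS] obtain r s where rs: "0 < r" "r < h" "0 < s" "s < h"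
    and 1: "f (t + h *\<^sub>R v + h *\<^sub>R w) - f (t + h *\<^sub>R v) - f (t + h *\<^sub>R w) + f t
      = h * (h * G v w (t + r *\<^sub>R v + s *\<^sub>R w))" unfolding G_def by blast
  from second_difference_mvt[OF S h inS'] obtain r' s' where rs': "0 < r'" "r' < h" "0 < s'" "s' < h"
    and 2: "f (t + h *\<^sub>R w + h *\<^sub>R v) - f (t + h *\<^sub>R w) - f (t + h *\<^sub>R v) + f t
      = h * (h * G w v (t + r' *\<^sub>R w + s' *\<^sub>R v))" unfolding G_def by blast
  have "h * (h * G v w (t + r *\<^sub>R v + s *\<^sub>R w)) = h * (h * G w v (t + r' *\<^sub>R w + s' *\<^sub>R v))"
    unfolding 1[symmetric] 2[symmetric] by (simp add: algebra_simps)
  then have eq: "G v w (t + r *\<^sub>R v + s *\<^sub>R w) = G w v (t + s' *\<^sub>R v + r' *\<^sub>R w)"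
    using h by (simp add: algebra_simps)
  have "dist (G v w (t + r *\<^sub>R v + s *\<^sub>R w)) (G v w t) < e"
    using near[of r s] rs by (intro d1) (simp add: d_def)
  moreover have "dist (G w v (t + s' *\<^sub>R v + r' *\<^sub>R w)) (G w v t) < e"
    using near[of s' r'] rs' by (intro d2) (simp add: d_def)
  ultimately have "\<bar>G v w t - G w v t\<bar> < 2 * e"
    unfolding eq dist_real_def by linarith
  then show False by (simp add: e_def)
qed

lemma pd_commute:
  assumes S: "open S" "smooth_on S f" and t: "t \<in> S"
  shows "pd a (pd b f) t = pd b (pd a f) t"
proof -
  have "pd a (pd b f) t = pd a (\<lambda>x. frechet_derivative f (at x) (axis b 1)) t" for a b
    by (rule pd_cong[OF S(1) t]) (simp add: pd_eq_frechet smooth_on_differentiable[OF S(2)])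
  also have "\<dots> a b = frechet_derivative (\<lambda>x. frechet_derivative f (at x) (axis b 1)) (at t) (axis a 1)" for a b
    by (rule pd_eq_frechet) (rule smooth_on_differentiable[OF smooth_on_frechet[OF S(2)] t])
  finally show ?thesis using frechet_derivative_commute[OF S t] by simp
qed

subsection \<open>Multi-indices of order at most two\<close>

lemma iter_mset_empty: "iter_mset D {#} = id"
  by (simp add: iter_mset_def)

lemma iter_mset_single: "iter_mset D {#a#} = D a"
  by (auto simp: iter_mset_def)

text \<open>The enumeration behind \<open>iter_mset\<close> is an arbitrary choice, so only a
  disjunction can be proved for general operators. Wherever it is used, a symmetry makes both cases
  equal.\<close>

lemma iter_mset_pair: "iter_mset D {#a, b#} = D a \<circ> D b \<or> iter_mset D {#a, b#} = D b \<circ> D a"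
proof -
  define xs where "xs = (SOME xs. mset xs = {#a, b#})"
  have xs: "mset xs = {#a, b#}"
    unfolding xs_def by (rule someI[of _ "[a, b]"]) simp
  then have "length xs = 2" using size_mset[of xs] by simp
  then obtain x y where "xs = [x, y]" by (auto simp: numeral_2_eq_2 length_Suc_conv)
  with xs have "xs = [a, b] \<or> xs = [b, a]"
    by (auto simp: add_eq_conv_ex)
  then show ?thesis unfolding iter_mset_def xs_def[symmetric] by auto
qed

lemma iter_mset_pd_pair:
  assumes "open S" "smooth_on S f" "t \<in> S"
  shows "iter_mset pd {#a, b#} f t = pd a (pd b f) t"
  using iter_mset_pair[of pd a b] pd_commute[OF assms, of a b] by auto

lemma multiset_size_le_2_cases:
  assumes "size I \<le> 2"
  obtains "I = {#}" | a where "I = {#a#}" | a b where "I = {#a, b#}"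
proof -
  consider "size I = 0" | "size I = 1" | "size I = Suc (Suc 0)" using assms by linarith
  then show ?thesis
  proof cases
    case 3
    then obtain a J where I: "I = add_mset a J" using size_eq_Suc_imp_eq_union by blast
    with 3 have "size J = 1" by simp
    then obtain b where "J = {#b#}" using size_1_singleton_mset by blast
    with I that(3) show ?thesis by blast
  next
    case 2
    then show ?thesis using size_1_singleton_mset that(2) by blast
  qed (use that(1) in simp)
qed

lemma mindex_cases:
  obtains "I = Mindex {#}" | a where "I = Mindex {#a#}" | a b where "I = Mindex {#a, b#}"
  by (metis mset_of mset_of_inverse mem_Collect_eq multiset_size_le_2_cases)

lemma mset_of_Mindex[simp]:
  "mset_of (Mindex {#}) = {#}" "mset_of (Mindex {#a#}) = {#a#}" "mset_of (Mindex {#a, b#}) = {#a, b#}"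
  by (simp_all add: Mindex_inverse)

lemma Mindex_eq_iff[simp]:
  "Mindex {#} \<noteq> Mindex {#a#}" "Mindex {#a#} \<noteq> Mindex {#}"
  "Mindex {#} \<noteq> Mindex {#a, b#}" "Mindex {#a, b#} \<noteq> Mindex {#}"
  "Mindex {#a#} = Mindex {#b#} \<longleftrightarrow> a = b"
  "Mindex {#a#} \<noteq> Mindex {#b, c#}" "Mindex {#b, c#} \<noteq> Mindex {#a#}"
  "Mindex {#a, b#} = Mindex {#c, d#} \<longleftrightarrow> a = c \<and> b = d \<or> a = d \<and> b = c"
  by (auto simp: Mindex_inject add_eq_conv_ex)

lemma jcoords_eqI:
  assumes "fst x = fst y" "snd x $ Mindex {#} = snd y $ Mindex {#}"
    "\<And>a. snd x $ Mindex {#a#} = snd y $ Mindex {#a#}"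
    "\<And>a b. snd x $ Mindex {#a, b#} = snd y $ Mindex {#a, b#}"
  shows "x = (y :: 'i::finite jcoords)"
proof (rule prod_eqI)
  show "snd x = snd y"
    unfolding vec_eq_iff
  proof
    fix I show "snd x $ I = snd y $ I"
      by (cases I rule: mindex_cases) (simp_all add: assms)
  qed
qed (rule assms(1))

lemma CARD_tidx: "CARD('m::finite tidx) = 2 * CARD('m) + 1"
proof -
  have "i \<in> insert Ix (range Iy \<union> range Idot)" for i :: "'m tidx" by (cases i) auto
  then have "(UNIV :: 'm tidx set) = insert Ix (range Iy \<union> range Idot)" by blast
  then have "CARD('m tidx) = card (insert (Ix :: 'm tidx) (range Iy \<union> range Idot))" by metis
  also have "\<dots> = Suc (card (range Iy \<union> range Idot :: 'm tidx set))"
    by (rule card_insert_disjoint) auto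
  also have "card (range Iy \<union> range Idot :: 'm tidx set) = CARD('m) + CARD('m)"
    by (subst card_Un_disjoint) (auto simp: card_image inj_on_def)
  finally show ?thesis by simp
qed

text \<open>There are 1 + n + binom(n+1, 2) multisets of size at most 2 over n indices; the count is
  doubled to stay free of division.\<close>

lemma CARD_mindex: "2 * CARD('i::finite mindex) = (CARD('i) + 1) * (CARD('i) + 2)"
proof -
  let ?n = "CARD('i)"
  let ?M = "multisets_of_size (UNIV :: 'i set)"
  have "CARD('i mindex) = card {I :: 'i multiset. size I \<le> 2}"
    using type_definition.Rep_range[OF type_definition_mindex]
    by (metis card_image inj_on_def mset_of_inject)
  also have "{I :: 'i multiset. size I \<le> 2} = ?M 0 \<union> (?M 1 \<union> ?M 2)"
    by (auto simp: multisets_of_size_def le_Suc_eq numeral_2_eq_2)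
  also have "card \<dots> = card (?M 0) + (card (?M 1) + card (?M 2))"
  proof -
    have "?M 0 \<inter> (?M 1 \<union> ?M 2) = {}" "?M 1 \<inter> ?M 2 = {}"
      by (auto simp: multisets_of_size_def)
    then show ?thesis by (simp add: card_Un_disjoint finite_multisets_of_size)
  qed
  also have "\<dots> = 1 + (?n + (?n + 1 choose 2))"
    by (simp add: card_multisets_of_size)
  finally have "CARD('i mindex) = 1 + (?n + (?n + 1 choose 2))" .
  moreover have "2 * (?n + 1 choose 2) = (?n + 1) * ?n"
    by (simp add: choose_two)
  ultimately show ?thesis by (simp add: algebra_simps)
qed

section \<open>Atlases\<close>

lemma chart_inv_right: "y \<in> snd c ` fst c \<Longrightarrow> snd c (chart_inv c y) = y"
  unfolding chart_inv_def by (rule f_inv_into_f)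

lemma chart_inv_in: "y \<in> snd c ` fst c \<Longrightarrow> chart_inv c y \<in> fst c"
  unfolding chart_inv_def by (rule inv_into_into)

text \<open>Continuous transitions are all that is needed to handle open sets. The bundle of 2-jets
  is only shown to be of this kind; the atlases of \<open>M\<close>, of the product and of the
  1-jets are smooth.\<close>

locale cont_atlas =
  fixes B :: "('p, 'e::euclidean_space) chart set"
  assumes chart_inj: "c \<in> B \<Longrightarrow> inj_on (snd c) (fst c)"
    and overlap_open: "c \<in> B \<Longrightarrow> d \<in> B \<Longrightarrow> open (snd c ` (fst c \<inter> fst d))"
    and trans_continuous:
      "c \<in> B \<Longrightarrow> d \<in> B \<Longrightarrow> continuous_on (snd c ` (fst c \<inter> fst d)) (snd d \<circ> chart_inv c)"
begin

lemma chart_open: "c \<in> B \<Longrightarrow> open (snd c ` fst c)"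
  using overlap_open[of c c] by simp

lemma chart_inv_left: "c \<in> B \<Longrightarrow> p \<in> fst c \<Longrightarrow> chart_inv c (snd c p) = p"
  unfolding chart_inv_def by (rule inv_into_f_f[OF chart_inj])

lemma chart_image_mem_iff: "c \<in> B \<Longrightarrow> p \<in> fst c \<Longrightarrow> U \<subseteq> fst c \<Longrightarrow> snd c p \<in> snd c ` U \<longleftrightarrow> p \<in> U"
  by (metis chart_inj inj_on_image_mem_iff)

lemma overlap_memD:
  assumes "c \<in> B" "y \<in> snd c ` (fst c \<inter> fst d)"
  shows "chart_inv c y \<in> fst c" "chart_inv c y \<in> fst d" "snd c (chart_inv c y) = y"
    "snd d (chart_inv c y) \<in> snd d ` (fst d \<inter> fst c)"
  using assms by (auto simp: chart_inv_left)

text \<open>Openness may be tested in a single chart, because the image in any other chart is the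
  preimage under a continuous transition map.\<close>

lemma atlas_openI_chart:
  assumes "c \<in> B" "U \<subseteq> fst c" "open (snd c ` U)"
  shows "atlas_open B U"
  unfolding atlas_open_def
proof (intro conjI ballI)
  show "U \<subseteq> carrier_of B" using assms by (auto simp: carrier_of_def)
  fix d assume d: "d \<in> B"
  let ?S = "snd d ` (fst d \<inter> fst c)"
  have "snd d ` (U \<inter> fst d) = (snd c \<circ> chart_inv d) -` (snd c ` U) \<inter> ?S"
  proof (intro equalityI subsetI)
    fix x assume "x \<in> snd d ` (U \<inter> fst d)"
    then show "x \<in> (snd c \<circ> chart_inv d) -` (snd c ` U) \<inter> ?S"
      using assms d by (auto simp: chart_inv_left)
  next
    fix x assume x: "x \<in> (snd c \<circ> chart_inv d) -` (snd c ` U) \<inter> ?S"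
    then obtain p where p: "x = snd d p" "p \<in> fst d" "p \<in> fst c" by auto
    with x have "snd c p \<in> snd c ` U" using d by (simp add: chart_inv_left)
    then have "p \<in> U" using p assms(1,2) chart_image_mem_iff by blast
    with p show "x \<in> snd d ` (U \<inter> fst d)" by blast
  qed
  then show "open (snd d ` (U \<inter> fst d))"
    using continuous_on_open_vimage[OF overlap_open[OF d assms(1)]] trans_continuous[OF d assms(1)] assms(3)
    by metis
qed

lemma atlas_open_Int_chart: "atlas_open B U \<Longrightarrow> c \<in> B \<Longrightarrow> open (snd c ` (U \<inter> fst c))"
  by (simp add: atlas_open_def)

end

locale smooth_atlas =
  fixes B :: "('p, 'e::euclidean_space) chart set"
  assumes chart_inj: "c \<in> B \<Longrightarrow> inj_on (snd c) (fst c)"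
    and overlap_open: "c \<in> B \<Longrightarrow> d \<in> B \<Longrightarrow> open (snd c ` (fst c \<inter> fst d))"
    and trans_smooth:
      "c \<in> B \<Longrightarrow> d \<in> B \<Longrightarrow> smooth_on (snd c ` (fst c \<inter> fst d)) (snd d \<circ> chart_inv c)"
begin

sublocale cont_atlas B
  by unfold_locales (fact chart_inj overlap_open smooth_on_imp_continuous_on[OF trans_smooth])+

lemma trans_has_derivative:
  "c \<in> B \<Longrightarrow> d \<in> B \<Longrightarrow> y \<in> snd c ` (fst c \<inter> fst d) \<Longrightarrow>
    ((snd d \<circ> chart_inv c) has_derivative frechet_derivative (snd d \<circ> chart_inv c) (at y)) (at y)"
  by (rule smooth_on_has_derivative[OF trans_smooth])

text \<open>The cocycle rule for tangent maps. It makes pushed fields consistent between charts and,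
  with \<open>e = c\<close>, shows that tangent maps of transitions are invertible.\<close>

lemma trans_frechet_compose:
  assumes "c \<in> B" "d \<in> B" "e \<in> B" "p \<in> fst c" "p \<in> fst d" "p \<in> fst e"
  shows "frechet_derivative (snd e \<circ> chart_inv c) (at (snd c p)) v =
    frechet_derivative (snd e \<circ> chart_inv d) (at (snd d p))
      (frechet_derivative (snd d \<circ> chart_inv c) (at (snd c p)) v)"
proof -
  let ?cd = "snd d \<circ> chart_inv c" and ?de = "snd e \<circ> chart_inv d" and ?ce = "snd e \<circ> chart_inv c"
  let ?O = "snd c ` (fst c \<inter> fst d) \<inter> snd c ` (fst c \<inter> fst e)"
  have O: "open ?O" "snd c p \<in> ?O" using assms by (auto intro!: open_Int overlap_open)
  have p: "?cd (snd c p) = snd d p" using assms by (simp add: chart_inv_left)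
  have 1: "(?cd has_derivative frechet_derivative ?cd (at (snd c p))) (at (snd c p))"
    using assms by (intro trans_has_derivative) auto
  have 2: "(?de has_derivative frechet_derivative ?de (at (snd d p))) (at (snd d p))"
    using assms by (intro trans_has_derivative) auto
  have der: "((\<lambda>x. ?de (?cd x)) has_derivative
      (\<lambda>v. frechet_derivative ?de (at (snd d p)) (frechet_derivative ?cd (at (snd c p)) v))) (at (snd c p))"
    by (rule has_derivative_compose[OF 1]) (simp only: p 2)
  have eq: "?de (?cd x) = ?ce x" if "x \<in> ?O" for x
  proof -
    from that have "chart_inv c x \<in> fst d" using overlap_memD(2)[OF assms(1)] by blast
    then show ?thesis using assms by (simp add: chart_inv_left)
  qed
  have "(?ce has_derivative
      (\<lambda>v. frechet_derivative ?de (at (snd d p)) (frechet_derivative ?cd (at (snd c p)) v))) (at (snd c p))"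
    by (rule has_derivative_transform_within_open[OF der O eq])
  then show ?thesis using frechet_derivative_at by metis
qed

lemma trans_frechet_same:
  assumes "c \<in> B" "p \<in> fst c"
  shows "frechet_derivative (snd c \<circ> chart_inv c) (at (snd c p)) v = v"
proof -
  have "((\<lambda>x. x) has_derivative (\<lambda>v. v)) (at (snd c p))" by (rule has_derivative_ident)
  then have "((snd c \<circ> chart_inv c) has_derivative (\<lambda>v. v)) (at (snd c p))"
    using chart_open[OF assms(1)]
    by (rule has_derivative_transform_within_open) (use assms in \<open>auto simp: chart_inv_left\<close>)
  then show ?thesis using frechet_derivative_at by metis
qed

lemma smooth_fun_onI_chart:
  assumes "c \<in> B" "U \<subseteq> fst c" "open (snd c ` U)" "smooth_on (snd c ` U) (F \<circ> chart_inv c)"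
  shows "smooth_fun_on B U F"
  unfolding smooth_fun_on_def
proof
  fix d assume d: "d \<in> B"
  have o: "open (snd d ` (U \<inter> fst d))"
    using atlas_openI_chart[OF assms(1-3)] d by (simp add: atlas_open_def)
  have "smooth_on (snd d ` (U \<inter> fst d)) (snd c \<circ> chart_inv d)"
    using trans_smooth[OF d assms(1)] by (rule smooth_on_subset) (use assms in auto)
  then have "smooth_on (snd d ` (U \<inter> fst d)) (\<lambda>x. (F \<circ> chart_inv c) ((snd c \<circ> chart_inv d) x))"
    by (rule smooth_on_compose[OF o assms(3,4)]) (use assms(2) d in \<open>auto simp: chart_inv_left\<close>)
  moreover have "(F \<circ> chart_inv c) ((snd c \<circ> chart_inv d) x) = (F \<circ> chart_inv d) x"
    if "x \<in> snd d ` (U \<inter> fst d)" for x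
    using that assms d by (auto simp: chart_inv_left subset_eq)
  ultimately show "smooth_on (snd d ` (U \<inter> fst d)) (F \<circ> chart_inv d)"
    by (subst (asm) smooth_on_cong[OF o])
qed

text \<open>Shrinks the neighbourhoods until the two coordinate expressions of \<open>L\<close> are
  smooth and related by the transition map, as the chain rule requires.\<close>

lemma smooth_nearE:
  assumes "smooth_near B a L" "c \<in> B" "d \<in> B" "a \<in> fst c" "a \<in> fst d"
  obtains S T where "open S" "open T" "snd d a \<in> S" "S \<subseteq> snd d ` (fst d \<inter> fst c)"
    "smooth_on S (L \<circ> chart_inv d)" "smooth_on T (L \<circ> chart_inv c)"
    "(snd c \<circ> chart_inv d) ` S \<subseteq> T"
    "\<And>x. x \<in> S \<Longrightarrow> (L \<circ> chart_inv d) x = (L \<circ> chart_inv c) ((snd c \<circ> chart_inv d) x)"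
proof -
  obtain U where U: "atlas_open B U" "a \<in> U" "smooth_fun_on B U L"
    using assms(1) by (auto simp: smooth_near_def)
  define S where "S = snd d ` (U \<inter> fst d) \<inter> snd d ` (fst d \<inter> fst c)"
  define T where "T = snd c ` (U \<inter> fst c)"
  show ?thesis
  proof (rule that)
    show "open S" unfolding S_def
      by (intro open_Int atlas_open_Int_chart[OF U(1)] overlap_open assms)
    show "open T" unfolding T_def by (intro atlas_open_Int_chart[OF U(1)] assms)
    show "snd d a \<in> S" using U assms by (auto simp: S_def)
    show "S \<subseteq> snd d ` (fst d \<inter> fst c)" by (simp add: S_def)
    show "smooth_on T (L \<circ> chart_inv c)" using U assms by (simp add: T_def smooth_fun_on_def)
    have "smooth_on (snd d ` (U \<inter> fst d)) (L \<circ> chart_inv d)" using U assms by (simp add: smooth_fun_on_def)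
    then show "smooth_on S (L \<circ> chart_inv d)" by (rule smooth_on_subset) (simp add: S_def)
    have *: "chart_inv d x \<in> U \<inter> fst c \<inter> fst d" if "x \<in> S" for x
    proof -
      obtain p where "p \<in> U" "p \<in> fst d" "x = snd d p" using \<open>x \<in> S\<close> by (auto simp: S_def)
      moreover have "chart_inv d x \<in> fst c"
        using \<open>x \<in> S\<close> by (intro overlap_memD(2)[OF assms(3)]) (simp add: S_def)
      ultimately show ?thesis using chart_inv_left[OF assms(3)] by simp
    qed
    then show "(snd c \<circ> chart_inv d) ` S \<subseteq> T" by (auto simp: T_def)
    show "(L \<circ> chart_inv d) x = (L \<circ> chart_inv c) ((snd c \<circ> chart_inv d) x)" if "x \<in> S" for x
      using *[OF that] assms by (simp add: chart_inv_left)
  qed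
qed

end

section \<open>Charts of the bundle of 2-jets\<close>

text \<open>The quadratic Taylor polynomial with prescribed jet coordinates \<open>e\<close>. The
  double sum runs over ordered pairs, so the factor 1/2 is right both on and off the
  diagonal.\<close>

definition quad_poly :: "'i jcoords \<Rightarrow> real ^ ('i::finite) \<Rightarrow> real" where
  "quad_poly e x = snd e $ Mindex {#} + (\<Sum>a\<in>UNIV. snd e $ Mindex {#a#} * (x $ a - fst e $ a))
    + (\<Sum>a\<in>UNIV. \<Sum>b\<in>UNIV. snd e $ Mindex {#a, b#} / 2 * ((x $ a - fst e $ a) * (x $ b - fst e $ b)))"

lemma smooth_on_quad_poly: "smooth_on UNIV (quad_poly e)"
  unfolding quad_poly_def[abs_def] by (intro smooth_intros open_UNIV)

lemma pd_quad_poly: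
  "pd a (quad_poly e) x = snd e $ Mindex {#a#} + (\<Sum>b\<in>UNIV. snd e $ Mindex {#a, b#} * (x $ b - fst e $ b))"
proof -
  define h where "h = x - fst e"
  let ?z = "\<lambda>a b. snd e $ Mindex {#a, b#}"
  have sym: "?z a b = ?z b a" for a b by (simp add: add_mset_commute)
  have "(quad_poly e has_derivative (\<lambda>v. (\<Sum>a\<in>UNIV. snd e $ Mindex {#a#} * v $ a)
    + (\<Sum>a\<in>UNIV. \<Sum>b\<in>UNIV. ?z a b / 2 * ((x $ a - fst e $ a) * v $ b + v $ a * (x $ b - fst e $ b))))) (at x)"
    unfolding quad_poly_def[abs_def]
    by (auto intro!: derivative_eq_intros bounded_linear_imp_has_derivative bounded_linear_vec_nth)
  from pd_eqI[OF this] have "pd a (quad_poly e) x = (\<Sum>c\<in>UNIV. snd e $ Mindex {#c#} * axis a 1 $ c)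
    + (\<Sum>c\<in>UNIV. \<Sum>b\<in>UNIV. ?z c b / 2 * (h $ c * axis a 1 $ b + axis a 1 $ c * h $ b))"
    by (simp add: h_def)
  also have "(\<Sum>c\<in>UNIV. snd e $ Mindex {#c#} * axis a 1 $ c) = snd e $ Mindex {#a#}"
    by (simp add: axis_def if_distrib cong: if_cong)
  also have "(\<Sum>c\<in>UNIV. \<Sum>b\<in>UNIV. ?z c b / 2 * (h $ c * axis a 1 $ b + axis a 1 $ c * h $ b))
      = (\<Sum>c\<in>UNIV. \<Sum>b\<in>UNIV. ?z c b / 2 * h $ c * axis a 1 $ b) + (\<Sum>c\<in>UNIV. \<Sum>b\<in>UNIV. ?z c b / 2 * h $ b * axis a 1 $ c)"
    by (simp add: algebra_simps flip: sum.distrib)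
  also have "(\<Sum>c\<in>UNIV. \<Sum>b\<in>UNIV. ?z c b / 2 * h $ c * axis a 1 $ b) = (\<Sum>c\<in>UNIV. ?z a c / 2 * h $ c)"
    by (simp add: axis_def if_distrib sym[of a] cong: if_cong)
  also have "(\<Sum>c\<in>UNIV. \<Sum>b\<in>UNIV. ?z c b / 2 * h $ b * axis a 1 $ c) = (\<Sum>c\<in>UNIV. ?z a c / 2 * h $ c)"
    by (subst sum.swap) (simp add: axis_def if_distrib cong: if_cong)
  also have "(\<Sum>c\<in>UNIV. ?z a c / 2 * h $ c) + (\<Sum>c\<in>UNIV. ?z a c / 2 * h $ c) = (\<Sum>c\<in>UNIV. ?z a c * h $ c)"
    by (simp add: mult.commute flip: sum.distrib)
  finally show ?thesis by (simp add: h_def)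
qed

lemma pd_pd_quad_poly: "pd a (pd b (quad_poly e)) x = snd e $ Mindex {#a, b#}"
proof -
  have "(pd b (quad_poly e) has_derivative (\<lambda>v. \<Sum>c\<in>UNIV. snd e $ Mindex {#b, c#} * v $ c)) (at x)"
    unfolding pd_quad_poly[abs_def]
    by (auto intro!: derivative_eq_intros bounded_linear_imp_has_derivative bounded_linear_vec_nth)
  from pd_eqI[OF this] show ?thesis
    by (simp add: axis_def if_distrib add_mset_commute cong: if_cong)
qed

lemma iter_mset_pd_quad_poly: "iter_mset pd (mset_of I) (quad_poly e) (fst e) = snd e $ I"
proof (cases I rule: mindex_cases)
  case 1
  then show ?thesis by (simp add: iter_mset_empty quad_poly_def)
next
  case (2 a)
  then show ?thesis by (simp add: iter_mset_single pd_quad_poly)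
next
  case (3 a b)
  then show ?thesis
    using iter_mset_pd_pair[OF open_UNIV smooth_on_quad_poly] by (simp add: pd_pd_quad_poly)
qed

lemma iter_mset_pd_cong:
  assumes S: "open S" "t \<in> S" and eq: "\<And>x. x \<in> S \<Longrightarrow> f x = g x"
  shows "iter_mset pd (mset_of I) f t = iter_mset pd (mset_of I) g t"
proof -
  have 1: "pd a f x = pd a g x" if "x \<in> S" for a x by (rule pd_cong[OF S(1) that eq])
  have 2: "pd a (pd b f) x = pd a (pd b g) x" if "x \<in> S" for a b x by (rule pd_cong[OF S(1) that 1])
  show ?thesis
  proof (cases I rule: mindex_cases)
    case 1
    then show ?thesis using eq S by (simp add: iter_mset_empty)
  next
    case (2 a)
    then show ?thesis using 1 S by (simp add: iter_mset_single)
  next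
    case (3 a b)
    then show ?thesis using 2 S iter_mset_pair[of pd a b] by auto
  qed
qed

section \<open>Coordinates of 2-jets and their behaviour under change of chart\<close>

locale jet_base = smooth_atlas B for B :: "('n, real ^ ('i::finite)) chart set"
begin

definition jcoord :: "('n, real ^ 'i) chart \<Rightarrow> ('n \<Rightarrow> real) \<Rightarrow> 'n \<Rightarrow> 'i jcoords" where
  "jcoord c L a = (snd c a, \<chi> I. iter_mset pd (mset_of I) (L \<circ> chart_inv c) (snd c a))"

lemma jcoord_smooth:
  assumes "smooth_near B a L" "c \<in> B" "a \<in> fst c"
  shows "snd (jcoord c L a) $ Mindex {#} = L a"
    "snd (jcoord c L a) $ Mindex {#i#} = pd i (L \<circ> chart_inv c) (snd c a)"
    "snd (jcoord c L a) $ Mindex {#i, j#} = pd i (pd j (L \<circ> chart_inv c)) (snd c a)"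
proof -
  obtain S where "open S" "snd c a \<in> S" "smooth_on S (L \<circ> chart_inv c)"
    using smooth_nearE[OF assms(1,2,2,3,3)] by metis
  then show "snd (jcoord c L a) $ Mindex {#i, j#} = pd i (pd j (L \<circ> chart_inv c)) (snd c a)"
    by (simp add: jcoord_def iter_mset_pd_pair)
qed (use assms in \<open>simp_all add: jcoord_def iter_mset_empty iter_mset_single chart_inv_left\<close>)

lemma jcoord_change:
  assumes "smooth_near B a L" "c \<in> B" "d \<in> B" "a \<in> fst c" "a \<in> fst d"
  defines "\<tau> \<equiv> snd c \<circ> chart_inv d"
  shows "snd (jcoord d L a) $ Mindex {#} = snd (jcoord c L a) $ Mindex {#}"
    and "snd (jcoord d L a) $ Mindex {#i#} =
      (\<Sum>k\<in>UNIV. snd (jcoord c L a) $ Mindex {#k#} * pd i (\<lambda>x. \<tau> x $ k) (snd d a))"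
    and "snd (jcoord d L a) $ Mindex {#i, j#} =
      (\<Sum>k\<in>UNIV. snd (jcoord c L a) $ Mindex {#k#} * pd i (pd j (\<lambda>x. \<tau> x $ k)) (snd d a))
      + (\<Sum>k\<in>UNIV. (\<Sum>l\<in>UNIV. snd (jcoord c L a) $ Mindex {#l, k#} * pd i (\<lambda>x. \<tau> x $ l) (snd d a))
          * pd j (\<lambda>x. \<tau> x $ k) (snd d a))"
proof -
  note jc = jcoord_smooth[OF assms(1,2,4)] and jd = jcoord_smooth[OF assms(1,3,5)]
  obtain S T where S: "open S" "snd d a \<in> S" "S \<subseteq> snd d ` (fst d \<inter> fst c)" "smooth_on S (L \<circ> chart_inv d)"
    and T: "open T" "smooth_on T (L \<circ> chart_inv c)" and sub: "\<tau> ` S \<subseteq> T"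
    and eq: "\<And>x. x \<in> S \<Longrightarrow> (L \<circ> chart_inv d) x = (L \<circ> chart_inv c) (\<tau> x)"
    using smooth_nearE[OF assms(1-5)] unfolding \<tau>_def by metis
  have \<tau>: "smooth_on S \<tau>" unfolding \<tau>_def by (rule smooth_on_subset[OF trans_smooth[OF assms(3,2)] S(3)])
  have \<tau>a: "\<tau> (snd d a) = snd c a" using assms by (simp add: chart_inv_left)
  show "snd (jcoord d L a) $ Mindex {#} = snd (jcoord c L a) $ Mindex {#}"
    by (simp add: jc jd)
  have 1: "pd i (L \<circ> chart_inv d) x = pd i (\<lambda>x. (L \<circ> chart_inv c) (\<tau> x)) x" if "x \<in> S" for i x
    by (rule pd_cong[OF S(1) that eq])
  have "pd i (\<lambda>x. (L \<circ> chart_inv c) (\<tau> x)) (snd d a) =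
      (\<Sum>k\<in>UNIV. pd k (L \<circ> chart_inv c) (\<tau> (snd d a)) * pd i (\<lambda>x. \<tau> x $ k) (snd d a))"
    using S(2) sub
    by (intro pd_compose smooth_on_differentiable[OF \<tau>] smooth_on_differentiable[OF T(2)]) auto
  then show "snd (jcoord d L a) $ Mindex {#i#} =
      (\<Sum>k\<in>UNIV. snd (jcoord c L a) $ Mindex {#k#} * pd i (\<lambda>x. \<tau> x $ k) (snd d a))"
    using 1[OF S(2)] by (simp only: jc jd \<tau>a)
  have "pd i (pd j (L \<circ> chart_inv d)) (snd d a) = pd i (pd j (\<lambda>x. (L \<circ> chart_inv c) (\<tau> x))) (snd d a)"
    by (rule pd_cong[OF S(1,2) 1])
  with pd_pd_compose[OF S(1) \<tau> T sub S(2), of i j]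
  show "snd (jcoord d L a) $ Mindex {#i, j#} =
      (\<Sum>k\<in>UNIV. snd (jcoord c L a) $ Mindex {#k#} * pd i (pd j (\<lambda>x. \<tau> x $ k)) (snd d a))
      + (\<Sum>k\<in>UNIV. (\<Sum>l\<in>UNIV. snd (jcoord c L a) $ Mindex {#l, k#} * pd i (\<lambda>x. \<tau> x $ l) (snd d a))
          * pd j (\<lambda>x. \<tau> x $ k) (snd d a))"
    by (simp only: jc jd \<tau>a)
qed

lemma jcoord_eq_change:
  assumes "smooth_near B a L" "smooth_near B a L'" "c \<in> B" "d \<in> B" "a \<in> fst c" "a \<in> fst d"
    and "jcoord c L a = jcoord c L' a"
  shows "jcoord d L a = jcoord d L' a"
proof (rule jcoords_eqI)
  show "fst (jcoord d L a) = fst (jcoord d L' a)" by (simp add: jcoord_def)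
qed (simp_all only: jcoord_change[OF assms(1,3-6)] jcoord_change[OF assms(2,3-6)] assms(7))

text \<open>The definition of a jet compares derivatives in all charts around the point; by the
  chain rule the coordinates in one chart determine those in every other.\<close>

lemma jet2_eq_iff:
  assumes "smooth_near B a L" "smooth_near B a L'" "c \<in> B" "a \<in> fst c"
  shows "jet2 B a L = jet2 B a L' \<longleftrightarrow> jcoord c L a = jcoord c L' a"
proof -
  have *: "L' \<in> snd (jet2 B a L) \<longleftrightarrow> jcoord c L a = jcoord c L' a"
    if L: "smooth_near B a L" "smooth_near B a L'" for L L'
  proof
    assume "L' \<in> snd (jet2 B a L)"
    then have "iter_mset pd I (L' \<circ> chart_inv c) (snd c a) = iter_mset pd I (L \<circ> chart_inv c) (snd c a)"
      if "size I \<le> 2" for I using that assms by (auto simp: jet2_def)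
    then have "iter_mset pd (mset_of I) (L' \<circ> chart_inv c) (snd c a) =
        iter_mset pd (mset_of I) (L \<circ> chart_inv c) (snd c a)" for I using mset_of[of I] by simp
    then show "jcoord c L a = jcoord c L' a" by (simp add: jcoord_def)
  next
    assume eq: "jcoord c L a = jcoord c L' a"
    have "iter_mset pd I (L' \<circ> chart_inv d) (snd d a) = iter_mset pd I (L \<circ> chart_inv d) (snd d a)"
      if d: "d \<in> B" "a \<in> fst d" and I: "size I \<le> 2" for d I
    proof -
      have "snd (jcoord d L a) $ Mindex I = snd (jcoord d L' a) $ Mindex I"
        using jcoord_eq_change[OF L assms(3) d(1) assms(4) d(2) eq] by simp
      then show ?thesis using I by (simp add: jcoord_def Mindex_inverse)
    qed
    with L show "L' \<in> snd (jet2 B a L)" by (auto simp: jet2_def)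
  qed
  show ?thesis
  proof
    assume "jet2 B a L = jet2 B a L'"
    moreover have "L' \<in> snd (jet2 B a L')" using *[OF assms(2,2)] by simp
    ultimately show "jcoord c L a = jcoord c L' a" using *[OF assms(1,2)] by simp
  next
    assume eq: "jcoord c L a = jcoord c L' a"
    have "L'' \<in> snd (jet2 B a L) \<longleftrightarrow> L'' \<in> snd (jet2 B a L')" for L''
    proof (cases "smooth_near B a L''")
      case True
      then show ?thesis using *[OF assms(1) True] *[OF assms(2) True] eq by simp
    qed (simp add: jet2_def)
    then show "jet2 B a L = jet2 B a L'" by (auto simp: jet2_def)
  qed
qed

lemma fst_jet2[simp]: "fst (jet2 B a L) = a"
  by (simp add: jet2_def)

lemma jet2_rep:
  assumes "smooth_near B a L"
  shows "smooth_near B a (jet2_rep (jet2 B a L))"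
    "c \<in> B \<Longrightarrow> a \<in> fst c \<Longrightarrow> jcoord c (jet2_rep (jet2 B a L)) a = jcoord c L a"
proof -
  have "L \<in> snd (jet2 B a L)" using assms by (simp add: jet2_def)
  then have *: "jet2_rep (jet2 B a L) \<in> snd (jet2 B a L)"
    unfolding jet2_rep_def by (rule someI[of "\<lambda>K. K \<in> snd (jet2 B a L)"])
  then show "smooth_near B a (jet2_rep (jet2 B a L))" by (simp add: jet2_def)
  show "jcoord c (jet2_rep (jet2 B a L)) a = jcoord c L a" if "c \<in> B" "a \<in> fst c"
  proof -
    have "iter_mset pd (mset_of I) (jet2_rep (jet2 B a L) \<circ> chart_inv c) (snd c a)
      = iter_mset pd (mset_of I) (L \<circ> chart_inv c) (snd c a)" for I
      using * that mset_of[of I] unfolding jet2_def by auto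
    then show ?thesis by (simp add: jcoord_def)
  qed
qed

lemma jet2_coords:
  assumes "smooth_near B a L" "c \<in> B" "a \<in> fst c"
  shows "snd (jet2_chart B c) (jet2 B a L) = jcoord c L a"
proof -
  have "snd (jet2_chart B c) (jet2 B a L) = jcoord c (jet2_rep (jet2 B a L)) a"
    by (simp add: jet2_chart_def jcoord_def)
  then show ?thesis using jet2_rep(2)[OF assms] by simp
qed

lemma jet2_value_coords:
  assumes "c \<in> B" "\<zeta> \<in> fst (jet2_chart B c)"
  shows "jet2_value \<zeta> = snd (snd (jet2_chart B c) \<zeta>) $ Mindex {#}"
  using assms
  by (auto simp: jet2_chart_def jet2_value_def iter_mset_empty chart_inv_left)

lemma jet2_chartE:
  assumes "\<zeta> \<in> fst (jet2_chart B c)" "c \<in> B"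
  obtains a L where "\<zeta> = jet2 B a L" "smooth_near B a L" "a \<in> fst c" "snd (jet2_chart B c) \<zeta> = jcoord c L a"
proof -
  from assms obtain a L where "\<zeta> = jet2 B a L" "smooth_near B a L" "a \<in> fst c"
    by (auto simp: jet2_chart_def jets2_def)
  with jet2_coords assms that show ?thesis by blast
qed

lemma jet2_in_chart_iff:
  assumes "smooth_near B a L"
  shows "c \<in> B \<Longrightarrow> jet2 B a L \<in> fst (jet2_chart B c) \<longleftrightarrow> a \<in> fst c"
  using assms by (auto simp: jet2_chart_def jets2_def carrier_of_def)

text \<open>The representative is \<open>quad_poly e\<close> read through the chart. It matters only
  near \<open>a\<close>, which is all that \<open>smooth_near\<close> asks for.\<close>

lemma jet2_exists:
  assumes c: "c \<in> B" and e: "fst e \<in> snd c ` fst c"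
  obtains a L where "smooth_near B a L" "a \<in> fst c" "jcoord c L a = e"
proof -
  from e obtain a where a: "a \<in> fst c" "fst e = snd c a" by auto
  define L where "L = quad_poly e \<circ> snd c"
  have eq: "(L \<circ> chart_inv c) x = quad_poly e x" if "x \<in> snd c ` fst c" for x
    using that chart_inv_right[of x c] by (simp add: L_def)
  have "smooth_on (snd c ` fst c) (L \<circ> chart_inv c)"
    by (subst smooth_on_cong[OF chart_open[OF c] eq])
      (auto intro: smooth_on_subset[OF smooth_on_quad_poly])
  then have "smooth_fun_on B (fst c) L"
    using c chart_open[OF c] by (intro smooth_fun_onI_chart[OF c]) auto
  moreover have "atlas_open B (fst c)" using atlas_openI_chart[OF c] chart_open[OF c] by simp
  ultimately have "smooth_near B a L" using a by (auto simp: smooth_near_def)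
  moreover have "jcoord c L a = e"
  proof -
    have "iter_mset pd (mset_of I) (L \<circ> chart_inv c) (snd c a) = snd e $ I" for I
    proof -
      have "iter_mset pd (mset_of I) (L \<circ> chart_inv c) (snd c a) = iter_mset pd (mset_of I) (quad_poly e) (snd c a)"
        by (rule iter_mset_pd_cong[OF chart_open[OF c] _ eq]) (use a in auto)
      then show ?thesis using iter_mset_pd_quad_poly[of I e] a by simp
    qed
    then show ?thesis using a by (simp add: jcoord_def prod_eq_iff vec_eq_iff)
  qed
  ultimately show ?thesis using a that by blast
qed

text \<open>An overlap restricts the base point only: every fibre is a full vector space by
  \<open>jet2_exists\<close>.\<close>

lemma jet2_overlap_image:
  assumes "c \<in> B" "d \<in> B"
  shows "snd (jet2_chart B c) ` (fst (jet2_chart B c) \<inter> fst (jet2_chart B d)) = (snd c ` (fst c \<inter> fst d)) \<times> UNIV"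
proof (intro equalityI subsetI)
  fix e assume "e \<in> snd (jet2_chart B c) ` (fst (jet2_chart B c) \<inter> fst (jet2_chart B d))"
  then obtain \<zeta> where z: "e = snd (jet2_chart B c) \<zeta>" "\<zeta> \<in> fst (jet2_chart B c)" "\<zeta> \<in> fst (jet2_chart B d)" by auto
  from jet2_chartE[OF z(2) assms(1)] obtain a L where
    "\<zeta> = jet2 B a L" "smooth_near B a L" "a \<in> fst c" "e = jcoord c L a" unfolding z(1) .
  with z(3) assms show "e \<in> (snd c ` (fst c \<inter> fst d)) \<times> UNIV"
    by (auto simp: jet2_in_chart_iff jcoord_def)
next
  fix e assume "e \<in> (snd c ` (fst c \<inter> fst d)) \<times> (UNIV :: (real ^ 'i mindex) set)"
  then have fe: "fst e \<in> snd c ` (fst c \<inter> fst d)" by auto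
  then have "fst e \<in> snd c ` fst c" by auto
  from jet2_exists[OF assms(1) this] obtain a L where aL: "smooth_near B a L" "a \<in> fst c" "jcoord c L a = e" .
  then have "snd c a \<in> snd c ` (fst c \<inter> fst d)" using fe by (auto simp: jcoord_def)
  then have "a \<in> fst d" using assms(1) aL(2) chart_image_mem_iff[of c a "fst c \<inter> fst d"] by auto
  with aL assms show "e \<in> snd (jet2_chart B c) ` (fst (jet2_chart B c) \<inter> fst (jet2_chart B d))"
    by (intro image_eqI[of _ _ "jet2 B a L"]) (auto simp: jet2_coords jet2_in_chart_iff)
qed

lemma jet2_chart_image:
  "c \<in> B \<Longrightarrow> snd (jet2_chart B c) ` fst (jet2_chart B c) = (snd c ` fst c) \<times> UNIV"
  using jet2_overlap_image[of c c] by simp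

text \<open>The fibre coordinates change linearly, with coefficients built from first and second
  partial derivatives of the base transition. These depend continuously on the base point, so the
  transition is jointly continuous.\<close>

lemma jet2_cont_atlas: "cont_atlas (jet2_chart B ` B)"
proof
  fix C assume "C \<in> jet2_chart B ` B"
  then obtain c where c: "c \<in> B" "C = jet2_chart B c" by auto
  show inj: "inj_on (snd C) (fst C)"
  proof (rule inj_onI)
    fix \<zeta> \<zeta>' assume a: "\<zeta> \<in> fst C" "\<zeta>' \<in> fst C" "snd C \<zeta> = snd C \<zeta>'"
    from a(1) jet2_chartE[OF _ c(1)] obtain a L where
      1: "\<zeta> = jet2 B a L" "smooth_near B a L" "a \<in> fst c" "snd C \<zeta> = jcoord c L a" unfolding c(2) by metis
    from a(2) jet2_chartE[OF _ c(1)] obtain a' L' where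
      2: "\<zeta>' = jet2 B a' L'" "smooth_near B a' L'" "a' \<in> fst c" "snd C \<zeta>' = jcoord c L' a'" unfolding c(2) by metis
    have "snd c a = snd c a'" using 1 2 a(3) by (simp add: jcoord_def)
    then have "a = a'" using 1(3) 2(3) chart_inj[OF c(1)] by (simp add: inj_on_eq_iff)
    then show "\<zeta> = \<zeta>'" using 1 2 a(3) jet2_eq_iff[OF 1(2) _ c(1) 1(3)] by auto
  qed
  fix D assume "D \<in> jet2_chart B ` B"
  then obtain d where d: "d \<in> B" "D = jet2_chart B d" by auto
  show "open (snd C ` (fst C \<inter> fst D))"
    unfolding c(2) d(2) jet2_overlap_image[OF c(1) d(1)]
    using overlap_open[OF c(1) d(1)] by (intro open_Times) auto
  let ?S = "snd c ` (fst c \<inter> fst d)"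
  let ?E = "?S \<times> (UNIV :: (real ^ 'i mindex) set)"
  have S: "snd C ` (fst C \<inter> fst D) = ?E"
    unfolding c(2) d(2) by (rule jet2_overlap_image[OF c(1) d(1)])
  let ?t = "snd d \<circ> chart_inv c" and ?\<tau> = "snd c \<circ> chart_inv d"
  let ?f = "snd D \<circ> chart_inv C"
  have f: "?f e = jcoord d L a \<and> e = jcoord c L a \<and> fst e = snd c a \<and> snd d a = ?t (fst e)"
    if "\<zeta> = jet2 B a L" "smooth_near B a L" "a \<in> fst c" "a \<in> fst d" "e = snd C \<zeta>" for e \<zeta> a L
  proof -
    have "chart_inv C e = \<zeta>" using that inj c(1) unfolding chart_inv_def that(5)
      by (intro inv_into_f_f) (auto simp: c(2) jet2_in_chart_iff)
    then show ?thesis using that c d by (simp add: jet2_coords jcoord_def chart_inv_left)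
  qed
  have ex: "\<exists>a L. smooth_near B a L \<and> a \<in> fst c \<and> a \<in> fst d \<and> ?f e = jcoord d L a \<and> e = jcoord c L a
      \<and> fst e = snd c a \<and> snd d a = ?t (fst e)" if "e \<in> ?E" for e
  proof -
    from that[folded S] obtain \<zeta> where z: "\<zeta> \<in> fst C" "\<zeta> \<in> fst D" "e = snd C \<zeta>" by auto
    from z(1) jet2_chartE[OF _ c(1)] obtain a L where
      1: "\<zeta> = jet2 B a L" "smooth_near B a L" "a \<in> fst c" "snd C \<zeta> = jcoord c L a" unfolding c(2) by metis
    then have "a \<in> fst d" using z(2) d jet2_in_chart_iff[OF 1(2) d(1)] by simp
    with f[OF 1(1-3) this z(3)] 1 show ?thesis by blast
  qed
  have ct: "continuous_on ?E (\<lambda>e. ?t (fst e))"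
    by (rule continuous_on_compose2[OF trans_continuous[OF c(1) d(1)]]) (auto intro: continuous_on_fst)
  have im: "?t ` ?S \<subseteq> snd d ` (fst d \<inter> fst c)"
    using c(1) by (auto simp: chart_inv_left)
  have c\<tau>: "smooth_on (snd d ` (fst d \<inter> fst c)) (\<lambda>x. ?\<tau> x $ k)" for k
    using trans_smooth[OF d(1) c(1)] overlap_open[OF d(1) c(1)] by (intro smooth_on_vec_nth)
  have cpd: "continuous_on ?E (\<lambda>e. pd i (\<lambda>x. ?\<tau> x $ k) (?t (fst e)))" for i k
    by (rule continuous_on_compose2[OF smooth_on_imp_continuous_on[OF smooth_on_pd[OF overlap_open[OF d(1) c(1)] c\<tau>]] ct])
      (use im in auto)
  have cpd2: "continuous_on ?E (\<lambda>e. pd i (pd j (\<lambda>x. ?\<tau> x $ k)) (?t (fst e)))" for i j k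
    by (rule continuous_on_compose2[OF smooth_on_imp_continuous_on[OF smooth_on_pd[OF overlap_open[OF d(1) c(1)]
      smooth_on_pd[OF overlap_open[OF d(1) c(1)] c\<tau>]]] ct]) (use im in auto)
  have cz: "continuous_on ?E (\<lambda>e. snd e $ I)" for I by (intro continuous_intros)
  have "continuous_on ?E (\<lambda>e. snd (?f e) $ I)" for I
  proof (cases I rule: mindex_cases)
    case 1
    have "snd (?f e) $ I = snd e $ I" if "e \<in> ?E" for e
    proof -
      from ex[OF that] obtain a L where a: "smooth_near B a L" "a \<in> fst c" "a \<in> fst d"
        and e: "?f e = jcoord d L a" "e = jcoord c L a" by blast
      show ?thesis unfolding e(1) 1 jcoord_change(1)[OF a(1) c(1) d(1) a(2,3)] unfolding e(2) ..
    qed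
    then show ?thesis using cz[of I] by (subst continuous_on_cong[OF refl]) auto
  next
    case (2 i)
    have "snd (?f e) $ I = (\<Sum>k\<in>UNIV. snd e $ Mindex {#k#} * pd i (\<lambda>x. ?\<tau> x $ k) (?t (fst e)))" if "e \<in> ?E" for e
    proof -
      from ex[OF that] obtain a L where a: "smooth_near B a L" "a \<in> fst c" "a \<in> fst d"
        and e: "?f e = jcoord d L a" "e = jcoord c L a" and t: "snd d a = ?t (fst e)" by blast
      show ?thesis
        unfolding e(1) 2 jcoord_change(2)[OF a(1) c(1) d(1) a(2,3)] t unfolding e(2) ..
    qed
    then show ?thesis
      by (subst continuous_on_cong[OF refl]) (auto intro!: continuous_on_sum continuous_on_mult cz cpd simp del: o_apply)
  next
    case (3 i j)
    have "snd (?f e) $ I = (\<Sum>k\<in>UNIV. snd e $ Mindex {#k#} * pd i (pd j (\<lambda>x. ?\<tau> x $ k)) (?t (fst e)))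
      + (\<Sum>k\<in>UNIV. (\<Sum>l\<in>UNIV. snd e $ Mindex {#l, k#} * pd i (\<lambda>x. ?\<tau> x $ l) (?t (fst e)))
          * pd j (\<lambda>x. ?\<tau> x $ k) (?t (fst e)))" if "e \<in> ?E" for e
    proof -
      from ex[OF that] obtain a L where a: "smooth_near B a L" "a \<in> fst c" "a \<in> fst d"
        and e: "?f e = jcoord d L a" "e = jcoord c L a" and t: "snd d a = ?t (fst e)" by blast
      show ?thesis
        unfolding e(1) 3 jcoord_change(3)[OF a(1) c(1) d(1) a(2,3)] t unfolding e(2) ..
    qed
    then show ?thesis
      by (subst continuous_on_cong[OF refl])
        (auto intro!: continuous_on_add continuous_on_sum continuous_on_mult cz cpd cpd2 simp del: o_apply)
  qed
  then have cs: "continuous_on ?E (\<lambda>e. \<chi> I. snd (?f e) $ I)" by (rule continuous_on_vec_lambda)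
  have cf: "continuous_on ?E (\<lambda>e. fst (?f e))"
  proof -
    have "fst (?f e) = ?t (fst e)" if "e \<in> ?E" for e
      using ex[OF that] by (auto simp: jcoord_def)
    then show ?thesis using ct by (subst continuous_on_cong[OF refl]) auto
  qed
  have "continuous_on ?E (\<lambda>e. (fst (?f e), \<chi> I. snd (?f e) $ I))" by (rule continuous_on_Pair[OF cf cs])
  then show "continuous_on (snd C ` (fst C \<inter> fst D)) ?f" unfolding S by (simp add: o_def)
qed

end

section \<open>Charts of the bundle of 1-jets\<close>

definition tvec :: "real \<Rightarrow> real ^ 'm \<Rightarrow> real ^ 'm \<Rightarrow> real ^ ('m::finite) tidx" where
  "tvec x y w = (\<chi> i. case i of Ix \<Rightarrow> x | Iy \<alpha> \<Rightarrow> y $ \<alpha> | Idot \<alpha> \<Rightarrow> w $ \<alpha>)"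

definition tpos :: "real ^ ('m::finite) tidx \<Rightarrow> real ^ 'm" where
  "tpos t = (\<chi> \<alpha>. t $ Iy \<alpha>)"

definition tdot :: "real ^ ('m::finite) tidx \<Rightarrow> real ^ 'm" where
  "tdot t = (\<chi> \<alpha>. t $ Idot \<alpha>)"

lemma tvec_nth[simp]: "tvec x y w $ Ix = x" "tvec x y w $ Iy \<alpha> = y $ \<alpha>" "tvec x y w $ Idot \<alpha> = w $ \<alpha>"
  by (simp_all add: tvec_def)

lemma tpos_nth[simp]: "tpos t $ \<alpha> = t $ Iy \<alpha>" and tdot_nth[simp]: "tdot t $ \<alpha> = t $ Idot \<alpha>"
  by (simp_all add: tpos_def tdot_def)

lemma tvec_tpos_tdot[simp]: "tvec (t $ Ix) (tpos t) (tdot t) = t"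
proof -
  have "tvec (t $ Ix) (tpos t) (tdot t) $ i = t $ i" for i by (cases i) auto
  then show ?thesis by (simp add: vec_eq_iff)
qed

lemma tpos_tvec[simp]: "tpos (tvec x y w) = y" and tdot_tvec[simp]: "tdot (tvec x y w) = w"
  by (simp_all add: vec_eq_iff)

lemma tvec_eq_iff: "tvec x y w = tvec x' y' w' \<longleftrightarrow> x = x' \<and> y = y' \<and> w = w'"
  by (metis tvec_nth(1) tpos_tvec tdot_tvec)

lemma smooth_on_tpos: "open S \<Longrightarrow> smooth_on S tpos"
  unfolding tpos_def by (intro smooth_intros)

lemma smooth_on_tdot: "open S \<Longrightarrow> smooth_on S tdot"
  unfolding tdot_def by (intro smooth_intros)

lemma continuous_on_tpos: "continuous_on S tpos"
  using smooth_on_imp_continuous_on[OF smooth_on_tpos[OF open_UNIV]] continuous_on_subset by blast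

lemma smooth_on_tvec:
  assumes "open S" "smooth_on S f" "smooth_on S g" "smooth_on S h"
  shows "smooth_on S (\<lambda>x. tvec (f x) (g x) (h x))"
proof (rule smooth_on_vec[OF assms(1)])
  fix i show "smooth_on S (\<lambda>x. tvec (f x) (g x) (h x) $ i)"
    using assms by (cases i) (auto intro!: smooth_on_vec_nth)
qed

lemma open_tpos_vimage: "open Y \<Longrightarrow> open {t. tpos t \<in> Y}"
  using open_vimage[OF _ continuous_on_tpos[of UNIV]] by (simp add: vimage_def)

lemma local_section_fst: "local_section A x0 \<sigma> \<Longrightarrow> fst (\<sigma> x0) = x0"
  by (auto simp: local_section_def)

locale smfd =
  fixes M :: "'a topology" and A :: "('a, real ^ ('m::finite)) chart set"
  assumes manifold: "smooth_manifold M A"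
begin

lemma chart_homeomorphic:
  assumes "c \<in> A"
  shows "openin M (fst c)" "homeomorphic_map (subtopology M (fst c)) (top_of_set (snd c ` fst c)) (snd c)"
    "open (snd c ` fst c)" "topspace (subtopology M (fst c)) = fst c"
proof -
  show *: "openin M (fst c)" "homeomorphic_map (subtopology M (fst c)) (top_of_set (snd c ` fst c)) (snd c)"
    "open (snd c ` fst c)"
    using manifold assms by (auto simp: smooth_manifold_def)
  show "topspace (subtopology M (fst c)) = fst c"
    using openin_subset[OF *(1)] by auto
qed

lemma chart_open_image:
  assumes "c \<in> A" "openin M U" "U \<subseteq> fst c"
  shows "open (snd c ` U)"
proof -
  have "openin (subtopology M (fst c)) U"
    using assms chart_homeomorphic(1) by (simp add: openin_open_subtopology)
  then have "openin (top_of_set (snd c ` fst c)) (snd c ` U)"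
    using homeomorphic_imp_open_map[OF chart_homeomorphic(2)[OF assms(1)]] by (simp add: open_map_def)
  then show ?thesis using chart_homeomorphic(3)[OF assms(1)] openin_open_eq by blast
qed

sublocale base: smooth_atlas A
proof
  fix c assume c: "c \<in> A"
  show "inj_on (snd c) (fst c)"
    using homeomorphic_imp_injective_map[OF chart_homeomorphic(2)[OF c]] chart_homeomorphic(4)[OF c] by simp
  fix d assume d: "d \<in> A"
  show "open (snd c ` (fst c \<inter> fst d))"
    by (intro chart_open_image c openin_Int chart_homeomorphic(1) d Int_lower1)
  show "smooth_on (snd c ` (fst c \<inter> fst d)) (snd d \<circ> chart_inv c)"
    using manifold c d by (simp add: smooth_manifold_def)
qed

text \<open>The Hausdorff property enters here: a compact part of a chart domain is closed in all of
  \<open>M\<close>. This is what allows a field supported in \<open>K\<close> to be continued by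
  zero.\<close>

lemma compact_chart_complement:
  assumes c: "c \<in> A" and K: "K \<subseteq> fst c" "compact (snd c ` K)" and d: "d \<in> A"
  shows "open (snd d ` (fst d - K))"
proof (rule chart_open_image[OF d])
  obtain g where g: "homeomorphic_maps (subtopology M (fst c)) (top_of_set (snd c ` fst c)) (snd c) g"
    using chart_homeomorphic(2)[OF c] by (auto simp: homeomorphic_map_maps)
  have "g (snd c p) = p" if "p \<in> fst c" for p
    using g that chart_homeomorphic(4)[OF c] by (simp add: homeomorphic_maps_def)
  then have "g ` (snd c ` K) = K" using K(1) by force
  moreover have "compactin (top_of_set (snd c ` fst c)) (snd c ` K)"
    using K by (auto simp: compactin_subtopology)
  moreover have "continuous_map (top_of_set (snd c ` fst c)) (subtopology M (fst c)) g"
    using g by (simp add: homeomorphic_maps_def)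
  ultimately have "compactin (subtopology M (fst c)) K"
    using image_compactin by metis
  then have "compactin M K" by (simp add: compactin_subtopology)
  moreover have "Hausdorff_space M" using manifold by (simp add: smooth_manifold_def)
  ultimately have "closedin M K" by (rule compactin_imp_closedin[rotated])
  then show "openin M (fst d - K)"
    using chart_homeomorphic(1)[OF d] by (rule openin_diff[rotated])
qed auto

subsection \<open>The product atlas\<close>

lemma fst_prod_chart[simp]: "fst (prod_chart c) = UNIV \<times> fst c"
  and snd_prod_chart[simp]: "snd (prod_chart c) = (\<lambda>(x, y). (x, snd c y))"
  by (simp_all add: prod_chart_def)

lemma prod_chart_image: "(\<lambda>(x, y). (x, f y)) ` (UNIV \<times> S) = UNIV \<times> f ` S"
  by force

lemma chart_inv_prod_chart:
  assumes "c \<in> A" "y \<in> snd c ` fst c"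
  shows "chart_inv (prod_chart c) (x, y) = (x, chart_inv c y)"
proof -
  have "inj_on (snd (prod_chart c)) (fst (prod_chart c))"
    using base.chart_inj[OF assms(1)] by (auto simp: inj_on_def)
  then have "chart_inv (prod_chart c) (snd (prod_chart c) (x, chart_inv c y)) = (x, chart_inv c y)"
    unfolding chart_inv_def[of "prod_chart c"] using chart_inv_in[OF assms(2)] by (intro inv_into_f_f) auto
  then show ?thesis using chart_inv_right[OF assms(2)] by simp
qed

lemma prod_overlap_image:
  "snd (prod_chart c) ` (fst (prod_chart c) \<inter> fst (prod_chart d)) = UNIV \<times> snd c ` (fst c \<inter> fst d)"
  by (simp add: Times_Int_Times prod_chart_image)

lemma prod_trans:
  assumes "c \<in> A" "e \<in> UNIV \<times> snd c ` (fst c \<inter> fst d)"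
  shows "(snd (prod_chart d) \<circ> chart_inv (prod_chart c)) e = (fst e, (snd d \<circ> chart_inv c) (snd e))"
proof -
  obtain x y where "e = (x, y)" "y \<in> snd c ` fst c" using assms(2) by (cases e) auto
  then show ?thesis using chart_inv_prod_chart[OF assms(1)] by simp
qed

sublocale prod: smooth_atlas "prod_atlas A"
proof
  fix C assume "C \<in> prod_atlas A"
  then obtain c where c: "c \<in> A" "C = prod_chart c" by (auto simp: prod_atlas_def)
  show "inj_on (snd C) (fst C)"
    using base.chart_inj[OF c(1)] by (auto simp: inj_on_def c(2))
  fix D assume "D \<in> prod_atlas A"
  then obtain d where d: "d \<in> A" "D = prod_chart d" by (auto simp: prod_atlas_def)
  let ?S = "snd c ` (fst c \<inter> fst d)"
  have o: "open ?S" by (rule base.overlap_open[OF c(1) d(1)])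
  then have o': "open ((UNIV :: real set) \<times> ?S)" by (intro open_Times) auto
  show "open (snd C ` (fst C \<inter> fst D))"
    unfolding c(2) d(2) prod_overlap_image by (rule o')
  have "smooth_on ((UNIV :: real set) \<times> ?S) (\<lambda>e. (fst e, (snd d \<circ> chart_inv c) (snd e)))"
    by (intro smooth_on_Pair[OF o'] smooth_on_fst[OF o' smooth_on_id[OF o']]
      smooth_on_compose[OF o' o base.trans_smooth[OF c(1) d(1)]] smooth_on_snd[OF o' smooth_on_id[OF o']]) auto
  then show "smooth_on (snd C ` (fst C \<inter> fst D)) (snd D \<circ> chart_inv C)"
    unfolding c(2) d(2) prod_overlap_image
    by (subst smooth_on_cong[OF o' prod_trans[OF c(1)]])
qed

lemma prod_trans_frechet:
  assumes "c \<in> A" "d \<in> A" "y \<in> snd c ` (fst c \<inter> fst d)"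
  shows "frechet_derivative (snd (prod_chart d) \<circ> chart_inv (prod_chart c)) (at (x, y)) v =
    (fst v, frechet_derivative (snd d \<circ> chart_inv c) (at y) (snd v))"
proof -
  let ?S = "snd c ` (fst c \<inter> fst d)"
  let ?T = "snd d \<circ> chart_inv c"
  have o': "open ((UNIV :: real set) \<times> ?S)"
    using base.overlap_open[OF assms(1,2)] by (intro open_Times) auto
  have T: "(?T has_derivative frechet_derivative ?T (at (snd (x, y)))) (at (snd (x, y)))"
    using base.trans_has_derivative[OF assms] by simp
  have der: "((\<lambda>e. (fst e, ?T (snd e))) has_derivative (\<lambda>v. (fst v, frechet_derivative ?T (at (snd (x, y))) (snd v)))) (at (x, y))"
    by (intro has_derivative_Pair has_derivative_fst has_derivative_ident
      has_derivative_compose[OF has_derivative_snd[OF has_derivative_ident] T])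
  have "((snd (prod_chart d) \<circ> chart_inv (prod_chart c)) has_derivative
      (\<lambda>v. (fst v, frechet_derivative ?T (at (snd (x, y))) (snd v)))) (at (x, y))"
    by (rule has_derivative_transform_within_open[OF der o' _ prod_trans[OF assms(1), symmetric]])
      (use assms(3) in auto)
  from fun_cong[OF frechet_derivative_at[OF this], of v] show ?thesis by simp
qed

subsection \<open>Velocities of sections\<close>

abbreviation vel :: "('a, real ^ 'm) chart \<Rightarrow> (real \<Rightarrow> real \<times> 'a) \<Rightarrow> real \<Rightarrow> real ^ 'm" where
  "vel c \<sigma> x \<equiv> vector_derivative (snd c \<circ> snd \<circ> \<sigma>) (at x)"

lemma section_in_chart:
  assumes "local_section A x0 \<sigma>" "c \<in> A" "snd (\<sigma> x0) \<in> fst c"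
  obtains W where "open W" "x0 \<in> W" "\<And>x. x \<in> W \<Longrightarrow> snd (\<sigma> x) \<in> fst c" "smooth_on W (snd c \<circ> snd \<circ> \<sigma>)"
proof -
  obtain W where W: "open W" "x0 \<in> W" and sm: "\<forall>C\<in>prod_atlas A. open (W \<inter> \<sigma> -` fst C) \<and> smooth_on (W \<inter> \<sigma> -` fst C) (snd C \<circ> \<sigma>)"
    using assms(1) by (auto simp: local_section_def)
  let ?V = "W \<inter> \<sigma> -` fst (prod_chart c)"
  have V: "open ?V" "smooth_on ?V (snd (prod_chart c) \<circ> \<sigma>)"
    using sm assms(2) by (auto simp: prod_atlas_def)
  from smooth_on_snd[OF V] have "smooth_on ?V (snd c \<circ> snd \<circ> \<sigma>)"
    by (simp add: o_def case_prod_beta)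
  with V(1) W(2) assms(3) show ?thesis by (intro that[of ?V]) (auto simp: mem_Times_iff)
qed

lemma vel_has_derivative:
  assumes "local_section A x0 \<sigma>" "c \<in> A" "snd (\<sigma> x0) \<in> fst c"
  shows "((snd c \<circ> snd \<circ> \<sigma>) has_vector_derivative vel c \<sigma> x0) (at x0)"
proof -
  from section_in_chart[OF assms] obtain W where "x0 \<in> W" "smooth_on W (snd c \<circ> snd \<circ> \<sigma>)" by metis
  then have "(snd c \<circ> snd \<circ> \<sigma>) differentiable (at x0)" by (blast intro: smooth_on_differentiable)
  then show ?thesis by (simp add: vector_derivative_works)
qed

lemma vel_change:
  assumes "local_section A x0 \<sigma>" "c \<in> A" "d \<in> A" "snd (\<sigma> x0) \<in> fst c" "snd (\<sigma> x0) \<in> fst d"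
  shows "vel d \<sigma> x0 = frechet_derivative (snd d \<circ> chart_inv c) (at (snd c (snd (\<sigma> x0)))) (vel c \<sigma> x0)"
proof -
  let ?T = "snd d \<circ> chart_inv c"
  let ?D = "frechet_derivative ?T (at (snd c (snd (\<sigma> x0))))"
  obtain W where W: "open W" "x0 \<in> W" "\<And>x. x \<in> W \<Longrightarrow> snd (\<sigma> x) \<in> fst c"
    using section_in_chart[OF assms(1,2,4)] by metis
  have T: "(?T has_derivative ?D) (at ((snd c \<circ> snd \<circ> \<sigma>) x0))"
    using base.trans_has_derivative[OF assms(2,3)] assms by auto
  have "((\<lambda>x. ?T ((snd c \<circ> snd \<circ> \<sigma>) x)) has_derivative (\<lambda>h. ?D (h *\<^sub>R vel c \<sigma> x0))) (at x0)"
    using has_derivative_compose[OF vel_has_derivative[OF assms(1,2,4), unfolded has_vector_derivative_def] T] .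
  then have "((snd d \<circ> snd \<circ> \<sigma>) has_derivative (\<lambda>h. ?D (h *\<^sub>R vel c \<sigma> x0))) (at x0)"
    by (rule has_derivative_transform_within_open[OF _ W(1,2)]) (use W(3) assms(2) in \<open>simp add: base.chart_inv_left\<close>)
  moreover have "?D (h *\<^sub>R vel c \<sigma> x0) = h *\<^sub>R ?D (vel c \<sigma> x0)" for h
    by (rule linear_scale[OF has_derivative_linear[OF T]])
  ultimately show ?thesis by (intro vector_derivative_at) (simp add: has_vector_derivative_def)
qed

lemma jet1_rep:
  assumes "local_section A x0 \<sigma>"
  shows "local_section A x0 (jet1_rep (jet1 A x0 \<sigma>))" "jet1_rep (jet1 A x0 \<sigma>) x0 = \<sigma> x0"
    "c \<in> A \<Longrightarrow> snd (\<sigma> x0) \<in> fst c \<Longrightarrow> vel c (jet1_rep (jet1 A x0 \<sigma>)) x0 = vel c \<sigma> x0"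
proof -
  have "\<sigma> \<in> snd (jet1 A x0 \<sigma>)" using assms by (simp add: jet1_def)
  then have "jet1_rep (jet1 A x0 \<sigma>) \<in> snd (jet1 A x0 \<sigma>)"
    unfolding jet1_rep_def by (rule someI[of "\<lambda>\<tau>. \<tau> \<in> snd (jet1 A x0 \<sigma>)"])
  then show "local_section A x0 (jet1_rep (jet1 A x0 \<sigma>))" "jet1_rep (jet1 A x0 \<sigma>) x0 = \<sigma> x0"
    "c \<in> A \<Longrightarrow> snd (\<sigma> x0) \<in> fst c \<Longrightarrow> vel c (jet1_rep (jet1 A x0 \<sigma>)) x0 = vel c \<sigma> x0"
    unfolding jet1_def snd_conv by blast+
qed

lemma fst_jet1[simp]: "fst (jet1 A x0 \<sigma>) = x0"
  by (simp add: jet1_def)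

lemma p10_jet1: "local_section A x0 \<sigma> \<Longrightarrow> p10 (jet1 A x0 \<sigma>) = \<sigma> x0"
  using jet1_rep(2) by (simp add: p10_def)

lemma J1_coords_jet1:
  assumes "local_section A x0 \<sigma>" "c \<in> A" "snd (\<sigma> x0) \<in> fst c"
  shows "snd (J1_chart A c) (jet1 A x0 \<sigma>) = tvec x0 (snd c (snd (\<sigma> x0))) (vel c \<sigma> x0)"
  unfolding J1_chart_def snd_conv J1_coords_def tvec_def fst_jet1 p10_jet1[OF assms(1)] jet1_rep(3)[OF assms]
  by simp

lemma jet1_in_chart_iff:
  assumes "local_section A x0 \<sigma>"
  shows "jet1 A x0 \<sigma> \<in> fst (J1_chart A c) \<longleftrightarrow> snd (\<sigma> x0) \<in> fst c"
  using assms by (auto simp: J1_chart_def J1_def p10_jet1)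

lemma J1_chartE:
  assumes "a \<in> fst (J1_chart A c)" "c \<in> A"
  obtains x0 \<sigma> where "local_section A x0 \<sigma>" "a = jet1 A x0 \<sigma>" "snd (\<sigma> x0) \<in> fst c"
    "snd (J1_chart A c) a = tvec x0 (snd c (snd (\<sigma> x0))) (vel c \<sigma> x0)"
proof -
  from assms(1) obtain x0 \<sigma> where "local_section A x0 \<sigma>" "a = jet1 A x0 \<sigma>"
    by (auto simp: J1_chart_def J1_def)
  moreover with assms(1) have "snd (\<sigma> x0) \<in> fst c" by (simp add: jet1_in_chart_iff)
  ultimately show ?thesis using that J1_coords_jet1 assms(2) by metis
qed

text \<open>A 1-jet compares velocities in all charts around the point; by \<open>vel_change\<close>
  the velocity in one chart determines the others.\<close>

lemma jet1_eqI:
  assumes s: "local_section A x0 \<sigma>" "local_section A x0 \<tau>" and c: "c \<in> A" "snd (\<sigma> x0) \<in> fst c"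
    and eq: "\<sigma> x0 = \<tau> x0" "vel c \<sigma> x0 = vel c \<tau> x0"
  shows "jet1 A x0 \<sigma> = jet1 A x0 \<tau>"
proof -
  have "vel d \<sigma> x0 = vel d \<tau> x0" if "d \<in> A" "snd (\<sigma> x0) \<in> fst d" for d
    using vel_change[OF s(1) c(1) that(1) c(2) that(2)] vel_change[OF s(2) c(1) that(1)] c(2) that(2) eq by simp
  then have "(\<forall>d\<in>A. snd (\<sigma> x0) \<in> fst d \<longrightarrow> vel d \<rho> x0 = vel d \<sigma> x0) \<longleftrightarrow>
      (\<forall>d\<in>A. snd (\<tau> x0) \<in> fst d \<longrightarrow> vel d \<rho> x0 = vel d \<tau> x0)" for \<rho>
    using eq(1) by auto
  then show ?thesis using eq(1) by (simp add: jet1_def)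
qed

text \<open>Straight lines in a chart realise every prescribed position and velocity, so the induced
  charts of the 1-jets have full fibres.\<close>

lemma linear_section:
  fixes x0 :: real and w :: "real ^ 'm"
  assumes c: "c \<in> A" and y: "y \<in> snd c ` fst c"
  defines "\<sigma> \<equiv> (\<lambda>x. (x, chart_inv c (y + (x - x0) *\<^sub>R w)))"
  shows "local_section A x0 \<sigma>" "snd (\<sigma> x0) \<in> fst c" "snd c (snd (\<sigma> x0)) = y" "vel c \<sigma> x0 = w"
proof -
  define line where "line x = y + (x - x0) *\<^sub>R w" for x
  have line_smooth: "smooth_on S line" if "open S" for S
    unfolding line_def[abs_def] using that by (intro smooth_intros)
  have line_open: "open {x. line x \<in> Y}" if "open Y" for Y
    using open_vimage[OF that smooth_on_imp_continuous_on[OF line_smooth[OF open_UNIV]]] by (simp add: vimage_def)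
  let ?W = "{x. line x \<in> snd c ` fst c}"
  have W: "open ?W" by (rule line_open[OF base.chart_open[OF c]])
  have x0: "x0 \<in> ?W" using y by (simp add: line_def)
  have \<sigma>: "\<sigma> x = (x, chart_inv c (line x))" for x by (simp add: \<sigma>_def line_def)
  have in_c: "chart_inv c (line x) \<in> fst c" "snd c (chart_inv c (line x)) = line x" if "x \<in> ?W" for x
    using that chart_inv_in[of "line x" c] chart_inv_right[of "line x" c] by (simp_all only: mem_Collect_eq)
  show "local_section A x0 \<sigma>"
    unfolding local_section_def
  proof (intro exI[of _ ?W] conjI W x0 ballI)
    fix x assume x: "x \<in> ?W"
    show "fst (\<sigma> x) = x" by (simp add: \<sigma>)
    show "\<sigma> x \<in> carrier_of (prod_atlas A)"
      using in_c(1)[OF x] c by (auto simp: carrier_of_def prod_atlas_def \<sigma>)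
  next
    fix D assume "D \<in> prod_atlas A"
    then obtain d where d: "d \<in> A" "D = prod_chart d" by (auto simp: prod_atlas_def)
    have "x \<in> ?W \<inter> \<sigma> -` fst D \<longleftrightarrow> line x \<in> snd c ` (fst c \<inter> fst d)" for x
    proof
      assume "x \<in> ?W \<inter> \<sigma> -` fst D"
      then show "line x \<in> snd c ` (fst c \<inter> fst d)"
        using in_c[of x] by (intro image_eqI[of _ _ "chart_inv c (line x)"]) (auto simp: \<sigma> d(2))
    next
      assume "line x \<in> snd c ` (fst c \<inter> fst d)"
      then show "x \<in> ?W \<inter> \<sigma> -` fst D"
        using base.overlap_memD[OF c(1)] by (auto simp: \<sigma> d(2))
    qed
    then have V: "?W \<inter> \<sigma> -` fst D = {x. line x \<in> snd c ` (fst c \<inter> fst d)}" by blast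
    show o: "open (?W \<inter> \<sigma> -` fst D)"
      unfolding V by (rule line_open[OF base.overlap_open[OF c d(1)]])
    have "smooth_on (?W \<inter> \<sigma> -` fst D) (\<lambda>x. (x, (snd d \<circ> chart_inv c) (line x)))"
      using o unfolding V
      by (intro smooth_on_Pair smooth_on_id smooth_on_compose[OF _ base.overlap_open[OF c d(1)] base.trans_smooth[OF c d(1)]] line_smooth) auto
    then show "smooth_on (?W \<inter> \<sigma> -` fst D) (snd D \<circ> \<sigma>)"
      by (simp add: d(2) \<sigma>[abs_def] o_def)
  qed
  show "snd (\<sigma> x0) \<in> fst c" "snd c (snd (\<sigma> x0)) = y"
    using in_c[OF x0] by (simp_all add: \<sigma>) (simp add: line_def)
  have der: "(line has_derivative (\<lambda>h. h *\<^sub>R w)) (at x0)"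
    unfolding line_def[abs_def] by (auto intro!: derivative_eq_intros)
  have "((snd c \<circ> snd \<circ> \<sigma>) has_derivative (\<lambda>h. h *\<^sub>R w)) (at x0)"
    by (rule has_derivative_transform_within_open[OF der W x0]) (use in_c(2) in \<open>simp add: \<sigma>\<close>)
  then show "vel c \<sigma> x0 = w" by (intro vector_derivative_at) (simp add: has_vector_derivative_def)
qed

section \<open>The smooth atlas of the 1-jet bundle\<close>

lemma J1_overlap_image:
  assumes c: "c \<in> A" and d: "d \<in> A"
  shows "snd (J1_chart A c) ` (fst (J1_chart A c) \<inter> fst (J1_chart A d)) = {t. tpos t \<in> snd c ` (fst c \<inter> fst d)}"
proof (intro equalityI subsetI)
  fix t assume "t \<in> snd (J1_chart A c) ` (fst (J1_chart A c) \<inter> fst (J1_chart A d))"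
  then obtain a where a: "a \<in> fst (J1_chart A c)" "a \<in> fst (J1_chart A d)" "t = snd (J1_chart A c) a" by auto
  from J1_chartE[OF a(1) c] obtain x0 \<sigma> where s: "local_section A x0 \<sigma>" "a = jet1 A x0 \<sigma>" "snd (\<sigma> x0) \<in> fst c"
    "t = tvec x0 (snd c (snd (\<sigma> x0))) (vel c \<sigma> x0)" unfolding a(3) .
  then show "t \<in> {t. tpos t \<in> snd c ` (fst c \<inter> fst d)}"
    using a(2) by (simp add: jet1_in_chart_iff)
next
  fix t assume "t \<in> {t. tpos t \<in> snd c ` (fst c \<inter> fst d)}"
  then have t: "tpos t \<in> snd c ` fst c" "chart_inv c (tpos t) \<in> fst d"
    using base.overlap_memD[OF c] by auto
  note L = linear_section[OF c t(1), of "t $ Ix" "tdot t"]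
  show "t \<in> snd (J1_chart A c) ` (fst (J1_chart A c) \<inter> fst (J1_chart A d))"
    using J1_coords_jet1[OF L(1) c L(2)] L(2-4) t(2) jet1_in_chart_iff[OF L(1)]
    by (intro image_eqI[of _ _ "jet1 A (t $ Ix) (\<lambda>x. (x, chart_inv c (tpos t + (x - t $ Ix) *\<^sub>R tdot t)))"]) simp_all
qed

lemma J1_chart_image: "c \<in> A \<Longrightarrow> snd (J1_chart A c) ` fst (J1_chart A c) = {t. tpos t \<in> snd c ` fst c}"
  using J1_overlap_image[of c c] by simp

lemma J1_chart_inj: "c \<in> A \<Longrightarrow> inj_on (snd (J1_chart A c)) (fst (J1_chart A c))"
proof (rule inj_onI)
  fix a b assume c: "c \<in> A" and ab: "a \<in> fst (J1_chart A c)" "b \<in> fst (J1_chart A c)"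
    "snd (J1_chart A c) a = snd (J1_chart A c) b"
  from J1_chartE[OF ab(1) c] obtain x0 \<sigma> where s: "local_section A x0 \<sigma>" "a = jet1 A x0 \<sigma>" "snd (\<sigma> x0) \<in> fst c"
    "snd (J1_chart A c) a = tvec x0 (snd c (snd (\<sigma> x0))) (vel c \<sigma> x0)" .
  from J1_chartE[OF ab(2) c] obtain x1 \<tau> where t: "local_section A x1 \<tau>" "b = jet1 A x1 \<tau>" "snd (\<tau> x1) \<in> fst c"
    "snd (J1_chart A c) b = tvec x1 (snd c (snd (\<tau> x1))) (vel c \<tau> x1)" .
  have "x0 = x1 \<and> snd c (snd (\<sigma> x0)) = snd c (snd (\<tau> x1)) \<and> vel c \<sigma> x0 = vel c \<tau> x1"
    using ab(3) unfolding s(4) t(4) tvec_eq_iff .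
  then have eq: "x0 = x1" "snd c (snd (\<sigma> x0)) = snd c (snd (\<tau> x1))" "vel c \<sigma> x0 = vel c \<tau> x1"
    by blast+
  then have "snd (\<sigma> x0) = snd (\<tau> x0)"
    using base.chart_inj[OF c] s(3) t(3) by (simp add: inj_on_eq_iff)
  moreover have "fst (\<sigma> x0) = fst (\<tau> x0)"
    using local_section_fst[OF s(1)] local_section_fst[OF t(1)] eq(1) by simp
  ultimately have "\<sigma> x0 = \<tau> x0" by (rule prod_eqI[rotated])
  then have "jet1 A x0 \<sigma> = jet1 A x0 \<tau>"
    by (rule jet1_eqI[OF s(1) t(1)[folded eq(1)] c s(3) _ eq(3)[folded eq(1)]])
  then show "a = b" unfolding s(2) t(2) eq(1)[symmetric] .
qed

text \<open>Under the identification of 1-jets with R x TM this is the identity of R times the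
  tangent map of the transition. Linearity in the velocity is what later makes the vertical Hessian
  a tensor.\<close>

definition J1_trans :: "('a, real ^ 'm) chart \<Rightarrow> ('a, real ^ 'm) chart \<Rightarrow> real ^ 'm tidx \<Rightarrow> real ^ 'm tidx" where
  "J1_trans c d t = tvec (t $ Ix) ((snd d \<circ> chart_inv c) (tpos t))
     (frechet_derivative (snd d \<circ> chart_inv c) (at (tpos t)) (tdot t))"

lemma J1_trans_eq:
  assumes c: "c \<in> A" and d: "d \<in> A" and t: "tpos t \<in> snd c ` (fst c \<inter> fst d)"
  shows "(snd (J1_chart A d) \<circ> chart_inv (J1_chart A c)) t = J1_trans c d t"
proof -
  from t have "t \<in> snd (J1_chart A c) ` (fst (J1_chart A c) \<inter> fst (J1_chart A d))"
    using J1_overlap_image[OF c d] by blast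
  then obtain a where a: "a \<in> fst (J1_chart A c)" "a \<in> fst (J1_chart A d)" "t = snd (J1_chart A c) a" by auto
  have inv: "chart_inv (J1_chart A c) t = a"
    unfolding chart_inv_def a(3) by (rule inv_into_f_f[OF J1_chart_inj[OF c] a(1)])
  from J1_chartE[OF a(1) c] obtain x0 \<sigma> where s: "local_section A x0 \<sigma>" "a = jet1 A x0 \<sigma>" "snd (\<sigma> x0) \<in> fst c"
    "t = tvec x0 (snd c (snd (\<sigma> x0))) (vel c \<sigma> x0)" unfolding a(3) .
  from a(2) have sd: "snd (\<sigma> x0) \<in> fst d" using s by (simp add: jet1_in_chart_iff)
  have "(snd (J1_chart A d) \<circ> chart_inv (J1_chart A c)) t = snd (J1_chart A d) (jet1 A x0 \<sigma>)"
    using inv s(2) by simp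
  also have "\<dots> = tvec x0 (snd d (snd (\<sigma> x0))) (vel d \<sigma> x0)"
    by (rule J1_coords_jet1[OF s(1) d sd])
  also have "\<dots> = J1_trans c d t"
    unfolding J1_trans_def s(4) vel_change[OF s(1) c d s(3) sd] using base.chart_inv_left[OF c s(3)] by simp
  finally show ?thesis .
qed

sublocale J1: jet_base "J1_atlas A"
proof
  fix C assume "C \<in> J1_atlas A"
  then obtain c where c: "c \<in> A" "C = J1_chart A c" by (auto simp: J1_atlas_def)
  show "inj_on (snd C) (fst C)" unfolding c(2) by (rule J1_chart_inj[OF c(1)])
  fix D assume "D \<in> J1_atlas A"
  then obtain d where d: "d \<in> A" "D = J1_chart A d" by (auto simp: J1_atlas_def)
  let ?Y = "snd c ` (fst c \<inter> fst d)"
  let ?S = "{t :: real ^ 'm tidx. tpos t \<in> ?Y}"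
  have Y: "open ?Y" by (rule base.overlap_open[OF c(1) d(1)])
  then have S: "open ?S" by (rule open_tpos_vimage)
  show "open (snd C ` (fst C \<inter> fst D))"
    unfolding c(2) d(2) J1_overlap_image[OF c(1) d(1)] by (rule S)
  note T = base.trans_smooth[OF c(1) d(1)]
  have "smooth_on ?S (J1_trans c d)"
    unfolding J1_trans_def[abs_def]
    by (intro smooth_on_tvec[OF S] smooth_on_vec_nth[OF S smooth_on_id[OF S]]
      smooth_on_compose[OF S Y T smooth_on_tpos[OF S]]
      smooth_on_frechet_compose[OF S Y T smooth_on_tpos[OF S] _ smooth_on_tdot[OF S]]) auto
  then show "smooth_on (snd C ` (fst C \<inter> fst D)) (snd D \<circ> chart_inv C)"
    unfolding c(2) d(2) J1_overlap_image[OF c(1) d(1)]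
    by (subst smooth_on_cong[OF S J1_trans_eq[OF c(1) d(1)]]) auto
qed

end

section \<open>Extending local vector fields\<close>

text \<open>A field known in the chart \<open>c\<close> only is carried to the other charts by
  tangent maps and continued by zero outside the domain of \<open>c\<close>.\<close>

definition (in smooth_atlas) push_field :: "('p, 'e) chart \<Rightarrow> ('e \<Rightarrow> 'e) \<Rightarrow> ('p, 'e) vfield" where
  "push_field c V d y =
     (if chart_inv d y \<in> fst c
      then frechet_derivative (snd d \<circ> chart_inv c) (at (snd c (chart_inv d y))) (V (snd c (chart_inv d y)))
      else 0)"

lemma (in smooth_atlas) push_field_same:
  assumes "c \<in> B" "y \<in> snd c ` fst c"
  shows "push_field c V c y = V y"
proof -
  obtain p where p: "p \<in> fst c" "y = snd c p" using assms(2) by auto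
  then show ?thesis using assms(1) trans_frechet_same[OF assms(1) p(1)]
    by (simp add: push_field_def chart_inv_left)
qed

text \<open>Every chart is covered by two open pieces: the overlap with \<open>c\<close>, where the
  field is a composite of smooth maps, and the complement of the support set \<open>K\<close>, where
  it vanishes.\<close>

lemma (in smooth_atlas) vector_field_push_field:
  assumes c: "c \<in> B" and V: "smooth_on (snd c ` fst c) V"
    and K: "K \<subseteq> fst c" "\<And>d. d \<in> B \<Longrightarrow> open (snd d ` (fst d - K))" "\<And>p. p \<in> fst c - K \<Longrightarrow> V (snd c p) = 0"
  shows "vector_field B (push_field c V)"
  unfolding vector_field_def
proof (intro conjI ballI)
  have lin0: "frechet_derivative (snd d \<circ> chart_inv e) (at (snd e p)) 0 = 0"
    if "d \<in> B" "e \<in> B" "p \<in> fst d" "p \<in> fst e" for d e p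
    using that by (intro linear_0 has_derivative_linear[OF trans_has_derivative]) auto
  fix d assume d: "d \<in> B"
  show "smooth_on (snd d ` fst d) (push_field c V d)"
  proof (rule smooth_on_local)
    fix y assume "y \<in> snd d ` fst d"
    then obtain p where p: "p \<in> fst d" "y = snd d p" by auto
    show "\<exists>T. open T \<and> y \<in> T \<and> smooth_on T (push_field c V d)"
    proof (cases "p \<in> fst c")
      case True
      let ?T = "snd d ` (fst d \<inter> fst c)"
      have T: "open ?T" by (rule overlap_open[OF d c])
      have sub: "(snd c \<circ> chart_inv d) ` ?T \<subseteq> snd c ` (fst c \<inter> fst d)"
        using d by (auto simp: chart_inv_left)
      have sub': "(snd c \<circ> chart_inv d) ` ?T \<subseteq> snd c ` fst c" using sub by blast
      have "smooth_on ?T (\<lambda>y. frechet_derivative (snd d \<circ> chart_inv c) (at ((snd c \<circ> chart_inv d) y))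
          (V ((snd c \<circ> chart_inv d) y)))"
        by (rule smooth_on_frechet_compose[OF T overlap_open[OF c d] trans_smooth[OF c d] trans_smooth[OF d c] sub
          smooth_on_compose[OF T chart_open[OF c] V trans_smooth[OF d c] sub']])
      then have "smooth_on ?T (push_field c V d)"
        by (subst smooth_on_cong[OF T]) (use d in \<open>auto simp: push_field_def chart_inv_left\<close>)
      then show ?thesis using T True p by blast
    next
      case False
      let ?T = "snd d ` (fst d - K)"
      have "push_field c V d x = 0" if x: "x \<in> ?T" for x
      proof -
        obtain p' where p': "p' \<in> fst d" "p' \<notin> K" "x = snd d p'" using x by auto
        then show ?thesis using d c K(3)[of p'] lin0[OF d c p'(1)] by (simp add: push_field_def chart_inv_left)
      qed
      then have "smooth_on ?T (push_field c V d)"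
        using smooth_on_const[of ?T 0] by (subst smooth_on_cong[OF K(2)[OF d]]) auto
      moreover have "y \<in> ?T" using p False K(1) by blast
      ultimately show ?thesis using K(2)[OF d] by blast
    qed
  qed
  fix e p assume e: "e \<in> B" and p: "p \<in> fst d \<inter> fst e"
  show "push_field c V e (snd e p) =
      frechet_derivative (snd e \<circ> chart_inv d) (at (snd d p)) (push_field c V d (snd d p))"
  proof (cases "p \<in> fst c")
    case True
    then show ?thesis using p trans_frechet_compose[OF c d e True, of "V (snd c p)"] d e
      by (simp add: push_field_def chart_inv_left)
  next
    case False
    then show ?thesis using p d e lin0 by (simp add: push_field_def chart_inv_left)
  qed
qed

context smfd
begin

text \<open>A vanishing y-component is the same in every chart, so u(x) d/dx exists globally and no
  cutoff is involved.\<close>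

lemma time_field_projectable:
  assumes u: "smooth_on UNIV u"
  shows "p_projectable A (\<lambda>d (x, y). (u x, 0))"
  unfolding p_projectable_def vector_field_def
proof (intro conjI ballI exI[of _ u] u)
  fix C assume "C \<in> prod_atlas A"
  then obtain c where c: "c \<in> A" "C = prod_chart c" by (auto simp: prod_atlas_def)
  have o: "open (snd C ` fst C)" using prod.chart_open \<open>C \<in> prod_atlas A\<close> by blast
  have "smooth_on (snd C ` fst C) (\<lambda>e. (u (fst e), 0 :: real ^ 'm))"
    by (intro smooth_on_Pair[OF o] smooth_on_const smooth_on_compose[OF o open_UNIV u]
      smooth_on_fst[OF o smooth_on_id[OF o]]) auto
  then show "smooth_on (snd C ` fst C) (\<lambda>(x, y). (u x, 0 :: real ^ 'm))" by (simp add: case_prod_unfold)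
  fix D p assume "D \<in> prod_atlas A" and p: "p \<in> fst C \<inter> fst D"
  then obtain d where d: "d \<in> A" "D = prod_chart d" by (auto simp: prod_atlas_def)
  have in_ov: "snd c (snd p) \<in> snd c ` (fst c \<inter> fst d)" using p c d by (auto simp: mem_Times_iff)
  have "frechet_derivative (snd d \<circ> chart_inv c) (at (snd c (snd p))) 0 = 0"
    by (rule linear_0[OF has_derivative_linear[OF base.trans_has_derivative[OF c(1) d(1) in_ov]]])
  then show "(case snd D p of (x, y) \<Rightarrow> (u x, 0 :: real ^ 'm)) =
      frechet_derivative (snd D \<circ> chart_inv C) (at (snd C p)) (case snd C p of (x, y) \<Rightarrow> (u x, 0))"
    using prod_trans_frechet[OF c(1) d(1) in_ov, of "fst p" "(u (fst p), 0)"]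
    unfolding c(2) d(2) by (simp add: case_prod_beta)
qed auto

text \<open>The cutoff depends on y alone and the time component is zero. Hence the extension is
  projectable with u = 0 and agrees with the given field over \<open>S\<close> at all times.\<close>

lemma local_field_extends:
  assumes c: "c \<in> A" and y0: "y0 \<in> snd c ` fst c" and w: "smooth_on UNIV w"
  obtains X S where "p_projectable A X" "open S" "y0 \<in> S" "S \<subseteq> snd c ` fst c"
    "\<And>x y. y \<in> S \<Longrightarrow> X (prod_chart c) (x, y) = (0, w (x, y))"
proof -
  obtain r where r: "r > 0" "cball y0 r \<subseteq> snd c ` fst c"
    using base.chart_open[OF c] y0 open_contains_cball by blast
  obtain \<phi> :: "real ^ 'm \<Rightarrow> real" where \<phi>: "smooth_on UNIV \<phi>" "\<And>y. dist y0 y < r / 2 \<Longrightarrow> \<phi> y = 1" "\<And>y. dist y0 y \<ge> r \<Longrightarrow> \<phi> y = 0"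
    using smooth_bump[OF r(1), where ?y0.0 = y0] by blast
  define V where "V = (\<lambda>e. (0 :: real, \<phi> (snd e) *\<^sub>R w e))"
  define X where "X = prod.push_field (prod_chart c) V"
  define K where "K = chart_inv c ` cball y0 r"
  have C: "prod_chart c \<in> prod_atlas A" using c by (simp add: prod_atlas_def)
  have V: "smooth_on UNIV V"
    unfolding V_def
    by (intro smooth_on_Pair[OF open_UNIV] smooth_on_const smooth_on_scaleR[OF open_UNIV] w
      smooth_on_compose[OF open_UNIV open_UNIV \<phi>(1)] smooth_on_snd[OF open_UNIV] smooth_on_id[OF open_UNIV]) auto
  have Kc: "K \<subseteq> fst c" 
  proof -
    have "chart_inv c y \<in> fst c" if "y \<in> cball y0 r" for y using that r(2) by (intro chart_inv_in) blast
    then show ?thesis by (auto simp: K_def)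
  qed
  have "snd c ` K = cball y0 r"
  proof -
    have "snd c (chart_inv c y) = y" if "y \<in> cball y0 r" for y using that r(2) by (intro chart_inv_right) blast
    then have "(\<lambda>y. snd c (chart_inv c y)) ` cball y0 r = (\<lambda>y. y) ` cball y0 r"
      by (rule image_cong[OF refl])
    then show ?thesis by (simp only: K_def image_image image_ident)
  qed
  then have cK: "compact (snd c ` K)" by simp
  have "vector_field (prod_atlas A) X"
    unfolding X_def
  proof (rule prod.vector_field_push_field[OF C])
    show "smooth_on (snd (prod_chart c) ` fst (prod_chart c)) V" using V by (rule smooth_on_subset) auto
    show "UNIV \<times> K \<subseteq> fst (prod_chart c)" using Kc by auto
    fix D assume "D \<in> prod_atlas A"
    then obtain d where d: "d \<in> A" "D = prod_chart d" by (auto simp: prod_atlas_def)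
    have "fst D - UNIV \<times> K = UNIV \<times> (fst d - K)" unfolding d(2) by auto
    then have "snd D ` (fst D - UNIV \<times> K) = UNIV \<times> snd d ` (fst d - K)"
      unfolding d(2) snd_prod_chart using prod_chart_image by metis
    then show "open (snd D ` (fst D - UNIV \<times> K))"
      using compact_chart_complement[OF c Kc cK d(1)] open_Times[OF open_UNIV] by metis
  next
    fix p assume p: "p \<in> fst (prod_chart c) - UNIV \<times> K"
    have "snd c (snd p) \<notin> cball y0 r"
    proof
      assume "snd c (snd p) \<in> cball y0 r"
      then have "chart_inv c (snd c (snd p)) \<in> K" unfolding K_def by blast
      then show False using p c by (auto simp: base.chart_inv_left mem_Times_iff)
    qed
    then show "V (snd (prod_chart c) p) = 0"
      using \<phi>(3)[of "snd c (snd p)"] by (simp add: V_def case_prod_beta zero_prod_def)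
  qed
  moreover have "fst (X (prod_chart d) (x, y)) = 0" if d: "d \<in> A" "y \<in> snd d ` fst d" for d x y
  proof -
    have inv: "chart_inv (prod_chart d) (x, y) = (x, chart_inv d y)" by (rule chart_inv_prod_chart[OF d])
    show ?thesis
    proof (cases "chart_inv d y \<in> fst c")
      case True
      then have "snd c (chart_inv d y) \<in> snd c ` (fst c \<inter> fst d)" using chart_inv_in[OF d(2)] by blast
      from prod_trans_frechet[OF c d(1) this] True show ?thesis
        unfolding X_def prod.push_field_def inv by (simp add: V_def)
    qed (simp add: X_def prod.push_field_def inv)
  qed
  ultimately have "p_projectable A X"
    unfolding p_projectable_def by (intro conjI exI[of _ "\<lambda>x. 0"] smooth_on_const) auto
  moreover have "X (prod_chart c) (x, y) = (0, w (x, y))" if "y \<in> ball y0 (r / 2)" for x y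
  proof -
    have "y \<in> cball y0 r" using that r(1) by simp
    then have "(x, y) \<in> snd (prod_chart c) ` fst (prod_chart c)"
      using r(2) unfolding fst_prod_chart snd_prod_chart prod_chart_image by blast
    then have "X (prod_chart c) (x, y) = V (x, y)"
      unfolding X_def by (rule prod.push_field_same[OF C])
    then show ?thesis using that \<phi>(2)[of y] by (simp add: V_def)
  qed
  moreover have "ball y0 (r / 2) \<subseteq> snd c ` fst c" using r by force
  ultimately show ?thesis using r(1) by (intro that[of X "ball y0 (r / 2)"]) auto
qed

end

section \<open>Coordinate expressions of the prolonged fields\<close>

text \<open>The characteristic of a prolonged field and its total derivative are linear in the jet
  coordinates, so the infinite sum collapses to the finitely many indices \<open>j k\<close>. As
  \<open>j\<close> may repeat an index, the terms are regrouped over its image.\<close>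

lemma tot_deriv_linear:
  fixes f :: "'k \<Rightarrow> real ^ ('i::finite) \<Rightarrow> real" and j :: "'k \<Rightarrow> 'i multiset"
  assumes K: "finite K" and R: "open R" "t \<in> R"
    and P: "\<And>t w. t \<in> R \<Longrightarrow> P t w = (\<Sum>k\<in>K. f k t * w (j k))"
    and f: "\<And>k. k \<in> K \<Longrightarrow> f k differentiable (at t)"
  shows "tot_deriv a P t w = (\<Sum>k\<in>K. pd a (f k) t * w (j k) + f k t * w (add_mset a (j k)))"
proof -
  have "deriv (\<lambda>s. P (vec_upd t a s) w) (t $ a) = pd a (\<lambda>t. P t w) t"
    by (simp add: pd_def)
  also have "\<dots> = pd a (\<lambda>t. \<Sum>k\<in>K. f k t * w (j k)) t"
    by (rule pd_cong[OF R P])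
  also have "\<dots> = (\<Sum>k\<in>K. pd a (f k) t * w (j k))"
    using f by (simp add: pd_sum pd_mult)
  finally have 1: "deriv (\<lambda>s. P (vec_upd t a s) w) (t $ a) = (\<Sum>k\<in>K. pd a (f k) t * w (j k))" .
  have 2: "deriv (\<lambda>s. P t (w(J := s))) (w J) = (\<Sum>k\<in>K. f k t * (if j k = J then 1 else 0))" for J
  proof (rule DERIV_imp_deriv)
    have "((\<lambda>s. \<Sum>k\<in>K. f k t * (if j k = J then s else w (j k))) has_field_derivative
        (\<Sum>k\<in>K. f k t * (if j k = J then 1 else 0))) (at (w J))"
      by (intro DERIV_sum DERIV_cmult) auto
    moreover have "P t (w(J := s)) = (\<Sum>k\<in>K. f k t * (if j k = J then s else w (j k)))" for s
      unfolding P[OF R(2)] by (intro sum.cong) auto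
    ultimately show "((\<lambda>s. P t (w(J := s))) has_field_derivative
        (\<Sum>k\<in>K. f k t * (if j k = J then 1 else 0))) (at (w J))" by simp
  qed
  have "Sum_any (\<lambda>J. w (add_mset a J) * deriv (\<lambda>s. P t (w(J := s))) (w J))
      = (\<Sum>J\<in>j ` K. w (add_mset a J) * (\<Sum>k\<in>K. f k t * (if j k = J then 1 else 0)))"
    unfolding 2
  proof (rule Sum_any.expand_superset)
    have "(\<Sum>k\<in>K. f k t * (if j k = J then 1 else 0)) = 0" if "J \<notin> j ` K" for J
      using that by (intro sum.neutral) auto
    then show "{J. w (add_mset a J) * (\<Sum>k\<in>K. f k t * (if j k = J then 1 else 0)) \<noteq> 0} \<subseteq> j ` K" by fastforce
  qed (use K in simp)
  also have "\<dots> = (\<Sum>J\<in>j ` K. \<Sum>k\<in>K. if j k = J then f k t * w (add_mset a J) else 0)"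
    by (auto simp: sum_distrib_left intro!: sum.cong)
  also have "\<dots> = (\<Sum>k\<in>K. \<Sum>J\<in>j ` K. if j k = J then f k t * w (add_mset a J) else 0)"
    by (rule sum.swap)
  also have "\<dots> = (\<Sum>k\<in>K. f k t * w (add_mset a (j k)))"
    using K by (intro sum.cong) auto
  finally show ?thesis unfolding tot_deriv_def 1 by (simp add: sum.distrib)
qed

lemma sum_option: "(\<Sum>k\<in>UNIV. h k) = h None + (\<Sum>c\<in>UNIV. h (Some c))" for h :: "'i::finite option \<Rightarrow> real"
  by (simp add: UNIV_option_conv sum.reindex)

text \<open>The smooth \<open>\<xi>'\<close> replaces \<open>\<xi>\<close> near \<open>t\<close>,
  since the lifted components are given by raw \<open>deriv\<close> expressions. That
  \<open>\<eta>\<close> is linear in z is what makes the characteristic linear in the jet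
  coordinates.\<close>

lemma prolong2_formula:
  fixes \<xi> \<xi>' :: "real ^ 'i \<Rightarrow> real ^ ('i::finite)" and zz :: "real ^ 'i mindex"
  assumes R: "open R" "t \<in> R" and \<xi>: "smooth_on R \<xi>'" "\<And>t. t \<in> R \<Longrightarrow> \<xi> t = \<xi>' t"
    and g: "smooth_on R g" "\<And>t z. t \<in> R \<Longrightarrow> \<eta> t z = - g t * z"
  defines "e \<equiv> prolong2 \<xi> \<eta> (t, zz)"
  shows "fst e = \<xi>' t"
    and "snd e $ Mindex {#} = - g t * zz $ Mindex {#}"
    and "snd e $ Mindex {#a#} = - pd a g t * zz $ Mindex {#} - g t * zz $ Mindex {#a#}
      - (\<Sum>c\<in>UNIV. pd a (\<lambda>t. \<xi>' t $ c) t * zz $ Mindex {#c#})"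
    and "snd e $ Mindex {#a, b#} = - pd a (pd b g) t * zz $ Mindex {#} - pd b g t * zz $ Mindex {#a#}
      - pd a g t * zz $ Mindex {#b#} - g t * zz $ Mindex {#a, b#}
      - (\<Sum>c\<in>UNIV. pd a (pd b (\<lambda>t. \<xi>' t $ c)) t * zz $ Mindex {#c#}
          + pd b (\<lambda>t. \<xi>' t $ c) t * zz $ Mindex {#c, a#} + pd a (\<lambda>t. \<xi>' t $ c) t * zz $ Mindex {#c, b#})"
proof -
  define w where "w = (\<lambda>J. if size J \<le> 2 then zz $ Mindex J else 0)"
  define Q where "Q = (\<lambda>t w. \<eta> t (w {#}) - (\<Sum>a\<in>UNIV. \<xi> t $ a * w {#a#}))"
  have e: "e = (\<xi> t, \<chi> I. iter_mset tot_deriv (mset_of I) Q t w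
      + (\<Sum>a\<in>UNIV. \<xi> t $ a * w (add_mset a (mset_of I))))"
    unfolding e_def prolong2_def w_def Q_def by (simp add: Let_def)
  have w: "w {#} = zz $ Mindex {#}" "w {#a#} = zz $ Mindex {#a#}" "w {#a, b#} = zz $ Mindex {#a, b#}"
    "w {#a, b, c#} = 0" for a b c by (simp_all add: w_def)
  have w_swap: "w {#a, c#} = zz $ Mindex {#c, a#}" for a c
    by (simp add: w(3) add_mset_commute[of a c "{#}"])
  \<comment> \<open>The characteristic as a sum over \<open>'i option\<close>: \<open>None\<close>
    stands for z with coefficient -g, \<open>Some c\<close> for the first-order coordinate of index
    \<open>c\<close> with coefficient \<open>- \<xi>' t $ c\<close>.\<close>
  define f where "f = (\<lambda>k t. case k of None \<Rightarrow> - g t | Some c \<Rightarrow> - \<xi>' t $ c)"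
  define j where "j = (\<lambda>k :: 'i option. case k of None \<Rightarrow> {#} | Some c \<Rightarrow> {#c#})"
  have f_simps: "f None = (\<lambda>t. - g t)" "\<And>c. f (Some c) = (\<lambda>t. - \<xi>' t $ c)"
    and j_simps: "j None = {#}" "\<And>c. j (Some c) = {#c#}"
    by (simp_all add: f_def j_def fun_eq_iff)
  have \<xi>c: "smooth_on R (\<lambda>t. \<xi>' t $ c)" for c by (rule smooth_on_vec_nth[OF R(1) \<xi>(1)])
  have fs: "smooth_on R (f k)" for k
    by (cases k) (auto simp: f_simps intro!: smooth_on_minus R g \<xi>c)
  have Q: "Q t w = (\<Sum>k\<in>UNIV. f k t * w (j k))" if "t \<in> R" for t w
    using that by (simp add: Q_def sum_option f_simps j_simps g(2) \<xi>(2) sum_negf)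
  have D1: "tot_deriv b Q t w = (\<Sum>k\<in>UNIV. pd b (f k) t * w (j k) + f k t * w (add_mset b (j k)))"
    if "t \<in> R" for b t w
    by (rule tot_deriv_linear[OF _ R(1) that Q]) (auto intro: smooth_on_differentiable[OF fs that])
  \<comment> \<open>The Boolean records which factor the total derivative hit: \<open>True\<close>
    the jet coordinate, \<open>False\<close> the coefficient. In this form the result is linear
    again and \<open>tot_deriv_linear\<close> applies a second time.\<close>
  define f2 where "f2 = (\<lambda>b (k, i). if i then f k else pd b (f k))"
  define j2 where "j2 = (\<lambda>b (k, i). if i then add_mset b (j k) else j k)"
  have D1': "tot_deriv b Q t w = (\<Sum>k\<in>UNIV. f2 b k t * w (j2 b k))" if "t \<in> R" for b t w
  proof -
    have "(\<Sum>k\<in>UNIV. f2 b k t * w (j2 b k)) = (\<Sum>(k, i)\<in>UNIV. f2 b (k, i) t * w (j2 b (k, i)))"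
      by (simp add: case_prod_beta)
    also have "\<dots> = (\<Sum>k\<in>UNIV. \<Sum>i\<in>UNIV. f2 b (k, i) t * w (j2 b (k, i)))"
      by (simp only: UNIV_Times_UNIV[symmetric] sum.cartesian_product)
    finally show ?thesis using D1[OF that] by (simp add: f2_def j2_def UNIV_bool add.commute)
  qed
  have f2s: "smooth_on R (f2 b k)" for b k
    by (cases k) (auto simp: f2_def fs smooth_on_pd[OF R(1) fs])
  have D2: "tot_deriv a (tot_deriv b Q) t w =
      (\<Sum>k\<in>UNIV. pd a (f2 b k) t * w (j2 b k) + f2 b k t * w (add_mset a (j2 b k)))" for a b
    by (rule tot_deriv_linear[OF _ R(1,2) D1']) (auto intro: smooth_on_differentiable[OF f2s R(2)])
  have D2': "tot_deriv a (tot_deriv b Q) t w = (\<Sum>k\<in>UNIV. pd a (pd b (f k)) t * w (j k)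
      + pd b (f k) t * w (add_mset a (j k)) + pd a (f k) t * w (add_mset b (j k))
      + f k t * w (add_mset a (add_mset b (j k))))" for a b
  proof -
    let ?h = "\<lambda>k. pd a (f2 b k) t * w (j2 b k) + f2 b k t * w (add_mset a (j2 b k))"
    have "(\<Sum>k\<in>UNIV. ?h k) = (\<Sum>(k, i)\<in>UNIV. ?h (k, i))"
      by (simp add: case_prod_beta)
    also have "\<dots> = (\<Sum>k\<in>UNIV. \<Sum>i\<in>UNIV. ?h (k, i))"
      by (simp only: UNIV_Times_UNIV[symmetric] sum.cartesian_product)
    finally show ?thesis unfolding D2 by (simp add: f2_def j2_def UNIV_bool add_ac)
  qed
  show "fst e = \<xi>' t" by (simp add: e \<xi>(2)[OF R(2)])
  show "snd e $ Mindex {#} = - g t * zz $ Mindex {#}"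
    by (simp add: e iter_mset_empty Q_def w g(2)[OF R(2)])
  have pdf: "pd a (f None) t = - pd a g t" "pd a (f (Some c)) t = - pd a (\<lambda>t. \<xi>' t $ c) t" if "t \<in> R" for a c t
    by (simp_all add: f_simps pd_minus smooth_on_differentiable[OF g(1) that] smooth_on_differentiable[OF \<xi>c that])
  show "snd e $ Mindex {#a#} = - pd a g t * zz $ Mindex {#} - g t * zz $ Mindex {#a#}
      - (\<Sum>c\<in>UNIV. pd a (\<lambda>t. \<xi>' t $ c) t * zz $ Mindex {#c#})"
    by (simp add: e iter_mset_single D1[OF R(2)] sum_option f_simps(1,2)[THEN fun_cong] pdf[OF R(2)] j_simps w(1,2)
      \<xi>(2)[OF R(2)] sum.distrib sum_negf w_swap[of a] w(3)[of _ a])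
  have pdf2: "pd a (pd b (f None)) t = - pd a (pd b g) t"
    "pd a (pd b (f (Some c))) t = - pd a (pd b (\<lambda>t. \<xi>' t $ c)) t" for a b c
  proof -
    have "pd a (pd b (f None)) t = pd a (\<lambda>t. - pd b g t) t" by (rule pd_cong[OF R pdf(1)])
    then show "pd a (pd b (f None)) t = - pd a (pd b g) t"
      by (simp add: pd_minus smooth_on_differentiable[OF smooth_on_pd[OF R(1) g(1)] R(2)])
    have "pd a (pd b (f (Some c))) t = pd a (\<lambda>t. - pd b (\<lambda>t. \<xi>' t $ c) t) t" by (rule pd_cong[OF R pdf(2)])
    then show "pd a (pd b (f (Some c))) t = - pd a (pd b (\<lambda>t. \<xi>' t $ c)) t"
      by (simp add: pd_minus smooth_on_differentiable[OF smooth_on_pd[OF R(1) \<xi>c] R(2)])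
  qed
  let ?G = "\<lambda>a b. - pd a (pd b g) t * zz $ Mindex {#} - pd b g t * zz $ Mindex {#a#}
      - pd a g t * zz $ Mindex {#b#} - g t * zz $ Mindex {#a, b#}
      - (\<Sum>c\<in>UNIV. pd a (pd b (\<lambda>t. \<xi>' t $ c)) t * zz $ Mindex {#c#}
          + pd b (\<lambda>t. \<xi>' t $ c) t * zz $ Mindex {#c, a#} + pd a (\<lambda>t. \<xi>' t $ c) t * zz $ Mindex {#c, b#})"
  have G: "tot_deriv a (tot_deriv b Q) t w = ?G a b" for a b
    unfolding D2'
    by (simp add: sum_option f_simps(1,2)[THEN fun_cong] pdf[OF R(2)] pdf2 j_simps w(1,2,4) w_swap
      add_mset_commute[of b a "{#}"] sum.distrib sum_negf)
  \<comment> \<open>Symmetry disposes of the unknown order in which \<open>iter_mset\<close> applies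
    the two total derivatives.\<close>
  have G_sym: "?G b a = ?G a b"
    unfolding pd_commute[OF R(1) g(1) R(2), of b a] pd_commute[OF R(1) \<xi>c R(2), of b a]
    by (simp add: add_mset_commute[of b a "{#}"] add.commute add.left_commute)
  have "iter_mset tot_deriv {#a, b#} Q t w = ?G a b"
    using iter_mset_pair[of tot_deriv a b] G G_sym by (elim disjE) simp_all
  then show "snd e $ Mindex {#a, b#} = ?G a b"
    by (simp add: e w)
qed

lemma sum_tidx: "(\<Sum>i\<in>UNIV. h i) = h Ix + (\<Sum>\<alpha>\<in>UNIV. h (Iy \<alpha>)) + (\<Sum>\<alpha>\<in>UNIV. h (Idot \<alpha>))"
  for h :: "'m::finite tidx \<Rightarrow> real"
proof -
  have "i \<in> insert Ix (range Iy \<union> range Idot)" for i :: "'m tidx" by (cases i) auto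
  then have U: "(UNIV :: 'm tidx set) = insert Ix (range Iy \<union> range Idot)" by blast
  have "(\<Sum>i\<in>UNIV. h i) = h Ix + (\<Sum>i\<in>range Iy \<union> range Idot. h i)"
    unfolding U by (rule sum.insert) auto
  also have "(\<Sum>i\<in>range Iy \<union> range Idot. h i) = (\<Sum>i\<in>range Iy. h i) + (\<Sum>i\<in>range Idot. h i)"
    by (rule sum.union_disjoint) auto
  finally show ?thesis by (simp add: sum.reindex inj_on_def add.assoc)
qed

text \<open>The direction (1, \<open>tdot t\<close>) is the velocity of a section with this 1-jet;
  differentiating along it collects the x-derivative and the y-derivatives of the field at
  once.\<close>

lemma lift1_formula:
  fixes c :: "('a, real ^ ('m::finite)) chart"
  assumes "(X (prod_chart c) has_derivative D) (at (t $ Ix, tpos t))"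
  shows "lift1_xi X c t = tvec (fst (X (prod_chart c) (t $ Ix, tpos t))) (snd (X (prod_chart c) (t $ Ix, tpos t)))
      (snd (D (1, tdot t)) - fst (D (1, 0)) *\<^sub>R tdot t)"
    and "lift1_eta X c t z = - fst (D (1, 0)) * z"
proof -
  let ?F = "X (prod_chart c)" and ?x = "t $ Ix" and ?y = "tpos t"
  have lin: "linear D" by (rule has_derivative_linear[OF assms])
  have x: "((\<lambda>s. ?F (s, ?y)) has_derivative (\<lambda>h. D (h, 0))) (at ?x)"
  proof -
    have "((\<lambda>s. (s, ?y)) has_derivative (\<lambda>h. (h, 0))) (at ?x)"
      by (auto intro!: derivative_eq_intros)
    from has_derivative_compose[OF this assms] show ?thesis .
  qed
  have y: "((\<lambda>w. ?F (?x, w)) has_derivative (\<lambda>h. D (0, h))) (at ?y)"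
  proof -
    have "((\<lambda>w. (?x, w)) has_derivative (\<lambda>h. (0, h))) (at ?y)"
      by (auto intro!: derivative_eq_intros)
    from has_derivative_compose[OF this assms] show ?thesis .
  qed
  have Dh: "D (h, 0) = h *\<^sub>R D (1, 0)" for h using linear_scale[OF lin, of h "(1, 0)"] by simp
  have x': "((\<lambda>s. ?F (s, ?y)) has_derivative (\<lambda>h. h *\<^sub>R D (1, 0))) (at ?x)"
    by (rule has_derivative_eq_rhs[OF x]) (rule ext, rule Dh)
  have u: "deriv (\<lambda>s. fst (?F (s, ?y))) ?x = fst (D (1, 0))"
    by (rule DERIV_imp_deriv)
      (use has_derivative_fst[OF x'] in \<open>simp add: has_field_derivative_def mult_commute_abs\<close>)
  have vx: "deriv (\<lambda>s. snd (?F (s, ?y)) $ \<alpha>) ?x = snd (D (1, 0)) $ \<alpha>" for \<alpha>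
    by (rule DERIV_imp_deriv)
      (use bounded_linear.has_derivative[OF bounded_linear_vec_nth has_derivative_snd[OF x']]
        in \<open>simp add: has_field_derivative_def mult_commute_abs\<close>)
  have vy: "pd \<beta> (\<lambda>w. snd (?F (?x, w)) $ \<alpha>) ?y = snd (D (0, axis \<beta> 1)) $ \<alpha>" for \<alpha> \<beta>
    by (rule pd_eqI[OF bounded_linear.has_derivative[OF bounded_linear_vec_nth has_derivative_snd[OF y]]])
  have dot: "snd (D (1, tdot t)) $ \<alpha> = snd (D (1, 0)) $ \<alpha>
      + (\<Sum>\<beta>\<in>UNIV. snd (D (0, axis \<beta> 1)) $ \<alpha> * t $ Idot \<beta>)" for \<alpha>
  proof -
    have "(1, tdot t) = (1, 0) + (\<Sum>\<beta>\<in>UNIV. (t $ Idot \<beta>) *\<^sub>R (0, axis \<beta> 1))"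
      using basis_expansion[of "tdot t"]
      by (simp add: prod_eq_iff fst_sum snd_sum scalar_mult_eq_scaleR)
    then have "D (1, tdot t) = D ((1, 0) + (\<Sum>\<beta>\<in>UNIV. (t $ Idot \<beta>) *\<^sub>R (0, axis \<beta> 1)))"
      by (rule arg_cong)
    also have "\<dots> = D (1, 0) + (\<Sum>\<beta>\<in>UNIV. (t $ Idot \<beta>) *\<^sub>R D (0, axis \<beta> 1))"
      by (simp only: linear_add[OF lin] linear_sum[OF lin] linear_scale[OF lin])
    finally have "D (1, tdot t) = D (1, 0) + (\<Sum>\<beta>\<in>UNIV. (t $ Idot \<beta>) *\<^sub>R D (0, axis \<beta> 1))" .
    then show ?thesis by (simp add: snd_sum mult.commute)
  qed
  have tp: "(\<chi> \<alpha>. t $ Iy \<alpha>) = ?y" by (simp add: tpos_def)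
  have "lift1_xi X c t $ i = tvec (fst (?F (?x, ?y))) (snd (?F (?x, ?y)))
      (snd (D (1, tdot t)) - fst (D (1, 0)) *\<^sub>R tdot t) $ i" for i
    unfolding lift1_xi_def Let_def tp by (cases i) (simp_all add: u vx vy dot)
  then show "lift1_xi X c t = tvec (fst (?F (?x, ?y))) (snd (?F (?x, ?y)))
      (snd (D (1, tdot t)) - fst (D (1, 0)) *\<^sub>R tdot t)" by (simp add: vec_eq_iff)
  show "lift1_eta X c t z = - fst (D (1, 0)) * z"
    unfolding lift1_eta_def tp u ..
qed

lemma pd_indep: "(\<And>s. f (vec_upd t a s) = f t) \<Longrightarrow> pd a f t = 0"
  by (simp add: pd_def)

lemma vec_upd_Idot[simp]: "vec_upd t (Idot \<beta>) s $ Ix = t $ Ix" "tpos (vec_upd t (Idot \<beta>) s) = tpos t"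
  by (simp_all add: vec_upd_def vec_eq_iff)

context smfd
begin

text \<open>In the velocity variables the lift is affine with linear part N - u', and u' is
  constant. So only u' and N survive in vertical components; the weight -u' of z becomes 0 after one
  vertical derivative and +u' after two.\<close>

lemma prolong2_vertical:
  fixes zz :: "real ^ 'm tidx mindex"
  assumes X: "p_projectable A X" and c: "c \<in> A" and t: "tpos t \<in> snd c ` fst c"
  defines "e \<equiv> prolong2 (lift1_xi X c) (lift1_eta X c) (t, zz)"
  obtains u' N where "snd e $ Mindex {#} = - u' * zz $ Mindex {#}"
    "\<And>\<beta>. snd e $ Mindex {#Idot \<beta>#} = - (\<Sum>\<gamma>\<in>UNIV. N \<gamma> \<beta> * zz $ Mindex {#Idot \<gamma>#})"
    "\<And>\<alpha> \<beta>. snd e $ Mindex {#Idot \<alpha>, Idot \<beta>#} = u' * zz $ Mindex {#Idot \<alpha>, Idot \<beta>#}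
      - (\<Sum>\<gamma>\<in>UNIV. N \<gamma> \<beta> * zz $ Mindex {#Idot \<gamma>, Idot \<alpha>#}) - (\<Sum>\<gamma>\<in>UNIV. N \<gamma> \<alpha> * zz $ Mindex {#Idot \<gamma>, Idot \<beta>#})"
proof -
  let ?Y = "snd c ` fst c"
  let ?R = "{t :: real ^ 'm tidx. tpos t \<in> ?Y}"
  define F where "F = X (prod_chart c)"
  define D where "D = (\<lambda>t. frechet_derivative F (at (t $ Ix, tpos t)))"
  have Y: "open ?Y" by (rule base.chart_open[OF c])
  have R: "open ?R" "t \<in> ?R" using open_tpos_vimage[OF Y] t by auto
  have UY: "open ((UNIV :: real set) \<times> ?Y)" using Y by (intro open_Times) auto
  have "vector_field (prod_atlas A) X" using X by (simp add: p_projectable_def)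
  then have F: "smooth_on (UNIV \<times> ?Y) F"
    using c by (auto simp: vector_field_def prod_atlas_def F_def prod_chart_image)
  have Fd: "(F has_derivative D t) (at (t $ Ix, tpos t))" if "t \<in> ?R" for t
    unfolding D_def using that by (intro smooth_on_has_derivative[OF F]) auto
  define \<xi> where "\<xi> = (\<lambda>t. tvec (fst (F (t $ Ix, tpos t))) (snd (F (t $ Ix, tpos t)))
      (snd (D t (1, tdot t)) - fst (D t (1, 0)) *\<^sub>R tdot t))"
  define g where "g = (\<lambda>t. fst (D t (1, 0)))"
  have pos: "smooth_on ?R (\<lambda>t. (t $ Ix, tpos t))"
    by (intro smooth_on_Pair R smooth_on_vec_nth smooth_on_id smooth_on_tpos)
  have posi: "(\<lambda>t. (t $ Ix, tpos t)) ` ?R \<subseteq> UNIV \<times> ?Y" by auto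
  have Dh: "smooth_on ?R (\<lambda>t. D t (h t))" if "smooth_on ?R h" for h
    unfolding D_def by (rule smooth_on_frechet_compose[OF R(1) UY F pos posi that])
  have g: "smooth_on ?R g" unfolding g_def by (intro smooth_on_fst R Dh smooth_on_const)
  have \<xi>: "smooth_on ?R \<xi>"
    unfolding \<xi>_def
    by (intro smooth_on_tvec smooth_on_fst smooth_on_snd smooth_on_diff smooth_on_scaleR R Dh
      smooth_on_const smooth_on_Pair smooth_on_tdot smooth_on_compose[OF R(1) UY F pos posi])
  have \<xi>_eq: "lift1_xi X c t = \<xi> t" if "t \<in> ?R" for t
    using lift1_formula(1)[of X c "D t" t] Fd[OF that] by (simp add: F_def \<xi>_def)
  have g_eq: "lift1_eta X c t z = - g t * z" if "t \<in> ?R" for t z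
    using lift1_formula(2)[of X c "D t" t] Fd[OF that] by (simp add: F_def g_def)
  note PF = prolong2_formula[OF R \<xi> \<xi>_eq g g_eq, of zz, folded e_def]
  have gv: "pd (Idot \<beta>) g t = 0" for t \<beta>
    by (rule pd_indep) (simp add: g_def D_def)
  have gv2: "pd (Idot \<alpha>) (pd (Idot \<beta>) g) t = 0" for \<alpha> \<beta>
    using gv by (simp add: gv[abs_def])
  define N where "N = (\<lambda>t \<gamma> \<beta>. snd (D t (0, axis \<beta> 1)) $ \<gamma>)"
  have \<xi>1: "pd (Idot \<beta>) (\<lambda>t. \<xi> t $ Ix) t = 0" "pd (Idot \<beta>) (\<lambda>t. \<xi> t $ Iy \<gamma>) t = 0" for \<beta> \<gamma> t
    by (rule pd_indep, simp add: \<xi>_def)+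
  have \<xi>2: "pd (Idot \<beta>) (\<lambda>t. \<xi> t $ Idot \<gamma>) t = N t \<gamma> \<beta> - (if \<beta> = \<gamma> then g t else 0)" if "t \<in> ?R" for \<beta> \<gamma> t
  proof -
    have lin: "linear (D t)" by (rule has_derivative_linear[OF Fd[OF that]])
    let ?h = "\<lambda>s. snd (D t (1, tdot t)) $ \<gamma> + (s - t $ Idot \<beta>) * N t \<gamma> \<beta>
        - g t * (if \<beta> = \<gamma> then s else t $ Idot \<gamma>)"
    have "\<xi> (vec_upd t (Idot \<beta>) s) $ Idot \<gamma> = ?h s" for s
    proof -
      have "D (vec_upd t (Idot \<beta>) s) = D t" by (simp add: D_def)
      moreover have "(1, tdot (vec_upd t (Idot \<beta>) s)) = (1, tdot t) + (s - t $ Idot \<beta>) *\<^sub>R (0, axis \<beta> 1)"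
        by (auto simp: vec_upd_def vec_eq_iff axis_def)
      moreover have "D t \<dots> = D t (1, tdot t) + (s - t $ Idot \<beta>) *\<^sub>R D t (0, axis \<beta> 1)"
        by (simp only: linear_add[OF lin] linear_scale[OF lin])
      ultimately show ?thesis by (auto simp: \<xi>_def N_def g_def vec_upd_def axis_def)
    qed
    moreover have "(?h has_field_derivative N t \<gamma> \<beta> - (if \<beta> = \<gamma> then g t else 0)) (at (t $ Idot \<beta>))"
      by (cases "\<beta> = \<gamma>") (auto intro!: derivative_eq_intros)
    ultimately show ?thesis unfolding pd_def by (simp add: DERIV_imp_deriv)
  qed
  have \<xi>12: "pd (Idot \<alpha>) (pd (Idot \<beta>) (\<lambda>t. \<xi> t $ Ix)) t = 0" "pd (Idot \<alpha>) (pd (Idot \<beta>) (\<lambda>t. \<xi> t $ Iy \<gamma>)) t = 0"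
    for \<alpha> \<beta> \<gamma> by (simp_all add: \<xi>1[abs_def])
  have \<xi>22: "pd (Idot \<alpha>) (pd (Idot \<beta>) (\<lambda>t. \<xi> t $ Idot \<gamma>)) t = 0" for \<alpha> \<beta> \<gamma>
  proof -
    have "pd (Idot \<alpha>) (pd (Idot \<beta>) (\<lambda>t. \<xi> t $ Idot \<gamma>)) t = pd (Idot \<alpha>) (\<lambda>t. N t \<gamma> \<beta> - (if \<beta> = \<gamma> then g t else 0)) t"
      by (rule pd_cong[OF R \<xi>2])
    also have "\<dots> = 0" by (rule pd_indep) (simp add: N_def g_def D_def)
    finally show ?thesis .
  qed
  show ?thesis
  proof (rule that[of "g t" "N t"])
    show "snd e $ Mindex {#} = - g t * zz $ Mindex {#}" by (rule PF(2))
    show "snd e $ Mindex {#Idot \<beta>#} = - (\<Sum>\<gamma>\<in>UNIV. N t \<gamma> \<beta> * zz $ Mindex {#Idot \<gamma>#})" for \<beta>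
      using PF(3)[of "Idot \<beta>"] unfolding sum_tidx
      by (simp add: gv \<xi>1 \<xi>2[OF R(2)] left_diff_distrib sum_subtractf if_distrib[of "\<lambda>x. x * _"] cong: if_cong)
    show "snd e $ Mindex {#Idot \<alpha>, Idot \<beta>#} = g t * zz $ Mindex {#Idot \<alpha>, Idot \<beta>#}
      - (\<Sum>\<gamma>\<in>UNIV. N t \<gamma> \<beta> * zz $ Mindex {#Idot \<gamma>, Idot \<alpha>#}) - (\<Sum>\<gamma>\<in>UNIV. N t \<gamma> \<alpha> * zz $ Mindex {#Idot \<gamma>, Idot \<beta>#})"
      for \<alpha> \<beta>
      using PF(4)[of "Idot \<alpha>" "Idot \<beta>"] unfolding sum_tidx
      by (simp add: gv gv2 \<xi>1 \<xi>12 \<xi>2[OF R(2)] \<xi>22 left_diff_distrib sum_subtractf sum.distrib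
          if_distrib[of "\<lambda>x. x * _"] add_mset_commute[of "Idot \<beta>" "Idot \<alpha>"] cong: if_cong)
  qed
qed

end

section \<open>Test fields\<close>

definition jgrad :: "real ^ 'i mindex \<Rightarrow> real ^ ('i::finite)" where
  "jgrad zz = (\<chi> a. zz $ Mindex {#a#})"

definition jhess :: "real ^ 'i mindex \<Rightarrow> real ^ 'i ^ ('i::finite)" where
  "jhess zz = (\<chi> a b. zz $ Mindex {#a, b#})"

definition bil :: "real ^ 'i ^ 'i \<Rightarrow> real ^ 'i \<Rightarrow> real ^ ('i::finite) \<Rightarrow> real" where
  "bil F v w = (\<Sum>a\<in>UNIV. \<Sum>b\<in>UNIV. F $ a $ b * (v $ a * w $ b))"

definition contr :: "real ^ 'i ^ 'i \<Rightarrow> real ^ 'i ^ ('i::finite) \<Rightarrow> real" where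
  "contr F Z = (\<Sum>a\<in>UNIV. \<Sum>b\<in>UNIV. F $ a $ b * Z $ a $ b)"

lemma jgrad_nth[simp]: "jgrad zz $ a = zz $ Mindex {#a#}"
  and jhess_nth[simp]: "jhess zz $ a $ b = zz $ Mindex {#a, b#}"
  by (simp_all add: jgrad_def jhess_def)

lemma bil_add_left: "bil F (v + v') w = bil F v w + bil F v' w"
  and bil_add_right: "bil F v (w + w') = bil F v w + bil F v w'"
  and bil_scale_left: "bil F (r *\<^sub>R v) w = r * bil F v w"
  and bil_scale_right: "bil F v (r *\<^sub>R w) = r * bil F v w"
  and bil_0_left[simp]: "bil F 0 w = 0"
  and bil_0_right[simp]: "bil F v 0 = 0"
  by (simp_all add: bil_def algebra_simps sum.distrib sum_distrib_left)

lemma bil_axis: "bil F (axis a 1) (axis b 1) = F $ a $ b"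
  by (simp add: bil_def axis_def if_distrib[of "\<lambda>x. x * _"] if_distrib[of "\<lambda>x. _ * x"] cong: if_cong)

lemma bil_sym: "transpose F = F \<Longrightarrow> bil F v w = bil F w v"
proof -
  assume "transpose F = F"
  then have *: "F $ a $ b = F $ b $ a" for a b by (metis transpose_def vec_lambda_beta)
  have "bil F v w = (\<Sum>b\<in>UNIV. \<Sum>a\<in>UNIV. F $ a $ b * (v $ a * w $ b))"
    unfolding bil_def by (rule sum.swap)
  also have "\<dots> = bil F w v"
    unfolding bil_def by (intro sum.cong refl) (simp add: * mult_ac)
  finally show ?thesis .
qed

text \<open>The coefficients of a linear form on the second-order coordinates \<open>z_{ab}\<close>, spread symmetrically
  over ordered pairs.\<close>

definition jhess_coeff :: "real ^ 'i mindex \<Rightarrow> real ^ 'i ^ ('i::finite)" where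
  "jhess_coeff n = (\<chi> a b. if a = b then n $ Mindex {#a, b#} else n $ Mindex {#a, b#} / 2)"

lemma transpose_jhess_coeff: "transpose (jhess_coeff n) = jhess_coeff n"
  by (simp add: transpose_def jhess_coeff_def vec_eq_iff add_mset_commute)

text \<open>Identifies covectors with jet coordinate vectors and splits the pairing by order, so
  that the annihilator can be computed with vectors and matrices instead of multi-indices.\<close>

lemma inner_jcoords:
  fixes n e :: "('i::finite) jcoords"
  shows "n \<bullet> e = fst n \<bullet> fst e + snd n $ Mindex {#} * snd e $ Mindex {#} + jgrad (snd n) \<bullet> jgrad (snd e)
    + contr (jhess_coeff (snd n)) (jhess (snd e))"
proof -
  let ?h = "\<lambda>I. snd n $ I * snd e $ I"
  let ?P = "range (\<lambda>(a, b). Mindex {#a :: 'i, b#})" and ?G = "range (\<lambda>a :: 'i. Mindex {#a#})"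
  have "I \<in> insert (Mindex {#}) (?G \<union> ?P)" for I :: "'i mindex"
    by (cases I rule: mindex_cases) auto
  then have U: "(UNIV :: 'i mindex set) = insert (Mindex {#}) (?G \<union> ?P)" by blast
  have "snd n \<bullet> snd e = (\<Sum>I\<in>UNIV. ?h I)" by (simp add: inner_vec_def)
  also have "\<dots> = ?h (Mindex {#}) + (\<Sum>I\<in>?G \<union> ?P. ?h I)"
    unfolding U by (rule sum.insert) auto
  also have "(\<Sum>I\<in>?G \<union> ?P. ?h I) = (\<Sum>I\<in>?G. ?h I) + (\<Sum>I\<in>?P. ?h I)"
    by (rule sum.union_disjoint) auto
  also have "(\<Sum>I\<in>?G. ?h I) = jgrad (snd n) \<bullet> jgrad (snd e)"
    by (simp add: sum.reindex inj_on_def inner_vec_def)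
  also have "(\<Sum>I\<in>?P. ?h I) = contr (jhess_coeff (snd n)) (jhess (snd e))"
  proof -
    let ?k = "\<lambda>(a, b). jhess_coeff (snd n) $ a $ b * jhess (snd e) $ a $ b"
    have "contr (jhess_coeff (snd n)) (jhess (snd e)) = (\<Sum>x\<in>UNIV. ?k x)"
      unfolding contr_def by (simp only: UNIV_Times_UNIV[symmetric] sum.cartesian_product)
    also have "\<dots> = (\<Sum>I\<in>?P. \<Sum>x | x \<in> UNIV \<and> (\<lambda>(a, b). Mindex {#a, b#}) x = I. ?k x)"
      by (rule sum.group[symmetric]) auto
    also have "\<dots> = (\<Sum>I\<in>?P. ?h I)"
    proof (rule sum.cong[OF refl])
      fix I assume "I \<in> ?P"
      then obtain a b where I: "I = Mindex {#a, b#}" by auto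
      \<comment> \<open>The fibre over \<open>I\<close> has two ordered pairs, or one when
        \<open>a = b\<close>; the halved off-diagonal entries balance this.\<close>
      have "{x. x \<in> UNIV \<and> (\<lambda>(a, b). Mindex {#a, b#}) x = I} = {(a, b), (b, a)}"
        unfolding I by auto
      then show "(\<Sum>x | x \<in> UNIV \<and> (\<lambda>(a, b). Mindex {#a, b#}) x = I. ?k x) = ?h I"
        by (cases "a = b") (simp_all add: jhess_coeff_def I add_mset_commute)
    qed
    finally show ?thesis by simp
  qed
  finally show ?thesis by (simp add: inner_prod_def)
qed

definition aff :: "real ^ 'i \<Rightarrow> real \<times> (real ^ 'i) \<Rightarrow> real ^ ('i::finite) \<Rightarrow> real" where
  "aff t0 p t = fst p + snd p \<bullet> (t - t0)"

text \<open>Three affine factors reach every Taylor coefficient up to order three; lower orders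
  arise by letting some factors be the constant 1.\<close>

definition prod3 where
  "prod3 t0 p q r t = aff t0 p t * aff t0 q t * aff t0 r t"

text \<open>The 2-jet at \<open>t0\<close> of a product of three affine functions with values \<open>fst p\<close> and gradients
  \<open>snd p\<close> there; \<open>T2\<close> is the Hessian.\<close>

definition T0 :: "real \<times> (real ^ 'i) \<Rightarrow> real \<times> (real ^ 'i) \<Rightarrow> real \<times> (real ^ ('i::finite)) \<Rightarrow> real" where
  "T0 p q r = fst p * fst q * fst r"

definition T1 :: "real \<times> (real ^ 'i) \<Rightarrow> real \<times> (real ^ 'i) \<Rightarrow> real \<times> (real ^ 'i) \<Rightarrow> real ^ ('i::finite)" where
  "T1 p q r = (fst q * fst r) *\<^sub>R snd p + (fst p * fst r) *\<^sub>R snd q + (fst p * fst q) *\<^sub>R snd r"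

definition T2 :: "real \<times> (real ^ 'i) \<Rightarrow> real \<times> (real ^ 'i) \<Rightarrow> real \<times> (real ^ 'i) \<Rightarrow> real ^ 'i ^ ('i::finite)" where
  "T2 p q r = (\<chi> a b. fst r * (snd p $ a * snd q $ b + snd p $ b * snd q $ a)
    + fst q * (snd p $ a * snd r $ b + snd p $ b * snd r $ a)
    + fst p * (snd q $ a * snd r $ b + snd q $ b * snd r $ a))"

lemma smooth_on_aff: "open S \<Longrightarrow> smooth_on S (aff t0 p)"
  unfolding aff_def[abs_def] by (intro smooth_intros)

lemma smooth_on_prod3: "open S \<Longrightarrow> smooth_on S (prod3 t0 p q r)"
  unfolding prod3_def[abs_def] by (intro smooth_on_mult smooth_on_aff)

lemma aff_differentiable: "aff t0 p differentiable (at t)"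
  using smooth_on_differentiable[OF smooth_on_aff[OF open_UNIV]] by blast

lemma pd_aff[simp]: "pd a (aff t0 p) t = snd p $ a"
proof (subst pd_eqI)
  show "(aff t0 p has_derivative (\<lambda>v. snd p \<bullet> v)) (at t)"
    unfolding aff_def[abs_def] by (auto intro!: derivative_eq_intros)
qed (simp add: inner_axis)

lemma pd_prod3: "pd a (prod3 t0 p q r) t =
  snd p $ a * aff t0 q t * aff t0 r t + aff t0 p t * snd q $ a * aff t0 r t + aff t0 p t * aff t0 q t * snd r $ a"
  unfolding prod3_def[abs_def]
  by (simp add: pd_mult aff_differentiable differentiable_mult algebra_simps)

lemma aff_base[simp]: "aff t0 p t0 = fst p"
  by (simp add: aff_def)

lemma prod3_base[simp]: "prod3 t0 p q r t0 = T0 p q r"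
  by (simp add: prod3_def T0_def)

lemma pd_prod3_base: "pd a (prod3 t0 p q r) t0 = T1 p q r $ a"
  by (simp add: pd_prod3 T1_def algebra_simps)

lemma pd_pd_prod3_base: "pd a (pd b (prod3 t0 p q r)) t0 = T2 p q r $ a $ b"
  unfolding pd_prod3[abs_def]
  by (simp add: pd_add pd_mult aff_differentiable differentiable_mult differentiable_add T2_def algebra_simps)

text \<open>The total derivative d/dx + (velocity) d/dy of an affine function of x and y, encoded
  again by value and gradient at \<open>t\<close>. It is affine in the velocity, so the velocity
  components of the test fields are again sums of \<open>prod3\<close>.\<close>

definition pdot :: "real ^ ('m::finite) tidx \<Rightarrow> real \<times> (real ^ 'm tidx) \<Rightarrow> real \<times> (real ^ 'm tidx)" where
  "pdot t p = (snd p \<bullet> tvec 1 (tdot t) 0, tvec 0 0 (tpos (snd p)))"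

lemma inner_tidx: "v \<bullet> w = v $ Ix * w $ Ix + tpos v \<bullet> tpos w + tdot v \<bullet> tdot w"
  by (simp add: inner_vec_def sum_tidx)

lemma tpos_0[simp]: "tpos 0 = 0" and tdot_0[simp]: "tdot 0 = 0"
  and tpos_diff: "tpos (v - w) = tpos v - tpos w" and tdot_diff: "tdot (v - w) = tdot v - tdot w"
  by (simp_all add: vec_eq_iff)

lemma aff_pdot: "snd p \<bullet> tvec 1 (tdot t) 0 = aff t0 (pdot t0 p) t"
  by (simp add: aff_def pdot_def inner_tidx tpos_diff tdot_diff inner_diff_right)

lemma aff_no_dot: "tdot (snd p) = 0 \<Longrightarrow> aff t0 p (tvec (t $ Ix) (tpos t) w) = aff t0 p t"
  by (simp add: aff_def inner_tidx tpos_diff)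

lemma bounded_linear_tvec: "bounded_linear (\<lambda>e. tvec (fst e) (snd e) 0 :: real ^ ('m::finite) tidx)"
proof (rule linear_conv_bounded_linear[THEN iffD1], rule linearI)
  fix e e' :: "real \<times> (real ^ 'm)" and r :: real
  have "tvec (fst (e + e')) (snd (e + e')) 0 $ i = (tvec (fst e) (snd e) 0 + tvec (fst e') (snd e') 0) $ i" for i
    by (cases i) auto
  then show "tvec (fst (e + e')) (snd (e + e')) 0 = tvec (fst e) (snd e) 0 + tvec (fst e') (snd e') 0"
    by (simp only: vec_eq_iff) blast
  have "tvec (fst (r *\<^sub>R e)) (snd (r *\<^sub>R e)) 0 $ i = (r *\<^sub>R tvec (fst e) (snd e) 0) $ i" for i
    by (cases i) auto
  then show "tvec (fst (r *\<^sub>R e)) (snd (r *\<^sub>R e)) 0 = r *\<^sub>R tvec (fst e) (snd e) 0"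
    by (simp only: vec_eq_iff) blast
qed

context smfd
begin

text \<open>The field is a product of three affine functions of (x, y) times the constant vector
  \<open>k\<close>. By the product rule its velocity component has one factor replaced by its total
  derivative in turn, so the 2-jets \<open>T0\<close>, \<open>T1\<close>, \<open>T2\<close> of four
  products give all components.\<close>

lemma prolong2_test_field:
  fixes zz :: "real ^ 'm tidx mindex" and k :: "real ^ 'm"
  assumes c: "c \<in> A" and t: "tpos t \<in> snd c ` fst c"
    and pqr: "tdot (snd p) = 0" "tdot (snd q) = 0" "tdot (snd r) = 0"
  defines "p' \<equiv> pdot t p" and "q' \<equiv> pdot t q" and "r' \<equiv> pdot t r"
  defines "D0 \<equiv> T0 p' q r + T0 p q' r + T0 p q r'" and "D1 \<equiv> T1 p' q r + T1 p q' r + T1 p q r'"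
    and "D2 \<equiv> T2 p' q r + T2 p q' r + T2 p q r'"
  defines "\<kappa> \<equiv> jgrad zz \<bullet> tvec 0 k 0" and "\<pi> \<equiv> jgrad zz \<bullet> tvec 0 0 k"
    and "\<omega> \<equiv> jhess zz *v tvec 0 k 0" and "\<chi>' \<equiv> jhess zz *v tvec 0 0 k"
  obtains X where "p_projectable A X"
    "fst (prolong2 (lift1_xi X c) (lift1_eta X c) (t, zz)) = tvec 0 (T0 p q r *\<^sub>R k) (D0 *\<^sub>R k)"
    "snd (prolong2 (lift1_xi X c) (lift1_eta X c) (t, zz)) $ Mindex {#} = 0"
    "\<And>a. snd (prolong2 (lift1_xi X c) (lift1_eta X c) (t, zz)) $ Mindex {#a#} =
      - (T1 p q r $ a * \<kappa> + D1 $ a * \<pi>)"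
    "\<And>a b. snd (prolong2 (lift1_xi X c) (lift1_eta X c) (t, zz)) $ Mindex {#a, b#} =
      - (T2 p q r $ a $ b * \<kappa> + D2 $ a $ b * \<pi>)
      - (T1 p q r $ b * \<omega> $ a + D1 $ b * \<chi>' $ a) - (T1 p q r $ a * \<omega> $ b + D1 $ a * \<chi>' $ b)"
proof -
  define fd where "fd = (\<lambda>s. prod3 t p' q r s + prod3 t p q' r s + prod3 t p q r' s)"
  define F where "F = (\<lambda>e :: real \<times> (real ^ 'm). prod3 t p q r (tvec (fst e) (snd e) 0))"
  note tv = smooth_on_bounded_linear[OF bounded_linear_tvec open_UNIV smooth_on_id[OF open_UNIV]]
  have F: "smooth_on UNIV (\<lambda>e. F e *\<^sub>R k)"
    unfolding F_def by (intro smooth_on_scaleR smooth_on_const open_UNIV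
        smooth_on_compose[OF open_UNIV open_UNIV smooth_on_prod3[OF open_UNIV] tv]) auto
  obtain X S where X: "p_projectable A X" and S: "open S" "tpos t \<in> S"
    and XS: "\<And>x y. y \<in> S \<Longrightarrow> X (prod_chart c) (x, y) = (0, F (x, y) *\<^sub>R k)"
    by (rule local_field_extends[OF c t F]) (rule that; assumption)
  let ?R = "{s :: real ^ 'm tidx. tpos s \<in> S}"
  have R: "open ?R" "t \<in> ?R" using open_tpos_vimage[OF S(1)] S(2) by auto
  have Xd: "(X (prod_chart c) has_derivative (\<lambda>h. (0, frechet_derivative F (at (x, y)) h *\<^sub>R k))) (at (x, y))"
    if y: "y \<in> S" for x y
  proof (rule has_derivative_transform_within_open)
    have "smooth_on UNIV F"
      unfolding F_def by (rule smooth_on_compose[OF open_UNIV open_UNIV smooth_on_prod3[OF open_UNIV] tv]) auto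
    then have "(F has_derivative frechet_derivative F (at (x, y))) (at (x, y))"
      by (rule smooth_on_has_derivative) simp
    then show "((\<lambda>e. (0, F e *\<^sub>R k)) has_derivative (\<lambda>h. (0, frechet_derivative F (at (x, y)) h *\<^sub>R k))) (at (x, y))"
      by (auto intro!: derivative_eq_intros)
    show "open (UNIV \<times> S)" using S(1) by (intro open_Times) auto
    show "(x, y) \<in> UNIV \<times> S" using y by simp
    show "(0, F e *\<^sub>R k) = X (prod_chart c) e" if "e \<in> UNIV \<times> S" for e
      using that XS by (cases e) auto
  qed
  have affd: "((\<lambda>e. aff t l (tvec (fst e) (snd e) 0)) has_derivative (\<lambda>h. snd l \<bullet> tvec (fst h) (snd h) 0)) (at e)"
    for l :: "real \<times> (real ^ 'm tidx)" and e
    unfolding aff_def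
    by (auto intro!: derivative_eq_intros bounded_linear_imp_has_derivative[OF bounded_linear_tvec])
  have Fd: "frechet_derivative F (at (s $ Ix, tpos s)) (1, tdot s) = fd s" for s
  proof -
    have "(F has_derivative (\<lambda>h.
        aff t p (tvec (s $ Ix) (tpos s) 0) * aff t q (tvec (s $ Ix) (tpos s) 0) * (snd r \<bullet> tvec (fst h) (snd h) 0)
        + (aff t p (tvec (s $ Ix) (tpos s) 0) * (snd q \<bullet> tvec (fst h) (snd h) 0)
          + (snd p \<bullet> tvec (fst h) (snd h) 0) * aff t q (tvec (s $ Ix) (tpos s) 0)) * aff t r (tvec (s $ Ix) (tpos s) 0)))
        (at (s $ Ix, tpos s))"
      unfolding F_def prod3_def
      using has_derivative_mult[OF has_derivative_mult[OF affd[of p "(s $ Ix, tpos s)"] affd[of q]] affd[of r]] by simp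
    from fun_cong[OF frechet_derivative_at[OF this], of "(1, tdot s)"] show ?thesis
      by (simp add: aff_no_dot pqr aff_pdot[of _ s t] fd_def prod3_def p'_def q'_def r'_def algebra_simps)
  qed
  define \<xi> where "\<xi> = (\<lambda>s. tvec 0 (prod3 t p q r s *\<^sub>R k) (fd s *\<^sub>R k))"
  have fd: "smooth_on T fd" if "open T" for T
    unfolding fd_def using that by (intro smooth_on_add smooth_on_prod3)
  have \<xi>: "smooth_on ?R \<xi>"
    unfolding \<xi>_def by (intro smooth_on_tvec R smooth_on_const smooth_on_scaleR smooth_on_prod3 fd)
  have \<xi>_eq: "lift1_xi X c s = \<xi> s" if "s \<in> ?R" for s
  proof -
    have y: "tpos s \<in> S" using that by simp
    have "F (s $ Ix, tpos s) = prod3 t p q r s" by (simp add: F_def prod3_def aff_no_dot pqr)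
    then show ?thesis
      using lift1_formula(1)[of X c _ s, OF Xd[OF y]] by (simp add: \<xi>_def XS[OF y] Fd)
  qed
  have g_eq: "lift1_eta X c s z = - (\<lambda>_. 0) s * z" if "s \<in> ?R" for s z
    using lift1_formula(2)[of X c _ s, OF Xd[of "tpos s"]] that by simp
  note PF = prolong2_formula[where g = "\<lambda>_. 0" and zz = zz and \<eta> = "lift1_eta X c", OF R \<xi> \<xi>_eq smooth_on_const g_eq]
  have dp: "prod3 t a b d differentiable (at s)" for a b d s
    using smooth_on_differentiable[OF smooth_on_prod3[OF open_UNIV]] by blast
  have dfd: "fd differentiable (at s)" for s using smooth_on_differentiable[OF fd[OF open_UNIV]] by blast
  have dpd: "pd b (prod3 t a b' d) differentiable (at s)" for a b b' d s
    using smooth_on_differentiable[OF smooth_on_pd[OF open_UNIV smooth_on_prod3[OF open_UNIV]]] by blast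
  have fd1: "pd a fd s = pd a (prod3 t p' q r) s + pd a (prod3 t p q' r) s + pd a (prod3 t p q r') s" for a s
    unfolding fd_def by (simp add: pd_add dp differentiable_add)
  have fd2: "pd a (pd b fd) t = D2 $ a $ b" for a b
    unfolding fd1[abs_def] by (simp add: pd_add dpd differentiable_add pd_pd_prod3_base D2_def)
  have fd1': "pd a fd t = D1 $ a" for a
    by (simp add: fd1 pd_prod3_base D1_def)
  have \<xi>1: "pd a (\<lambda>s. \<xi> s $ Ix) s = 0" "pd a (\<lambda>s. \<xi> s $ Iy \<gamma>) s = pd a (prod3 t p q r) s * k $ \<gamma>"
    "pd a (\<lambda>s. \<xi> s $ Idot \<gamma>) s = pd a fd s * k $ \<gamma>" for a s \<gamma>
    by (simp_all add: \<xi>_def pd_mult dp dfd)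
  have dfd1: "pd b fd differentiable (at s)" for b s
    using smooth_on_differentiable[OF smooth_on_pd[OF open_UNIV fd[OF open_UNIV]]] by blast
  have \<xi>2: "pd a (pd b (\<lambda>s. \<xi> s $ Ix)) s = 0" "pd a (pd b (\<lambda>s. \<xi> s $ Iy \<gamma>)) s = pd a (pd b (prod3 t p q r)) s * k $ \<gamma>"
    "pd a (pd b (\<lambda>s. \<xi> s $ Idot \<gamma>)) s = pd a (pd b fd) s * k $ \<gamma>" for a b s \<gamma>
    unfolding \<xi>1[abs_def] by (simp_all add: pd_mult dpd dfd1)
  have \<kappa>: "\<kappa> = (\<Sum>\<gamma>\<in>UNIV. k $ \<gamma> * zz $ Mindex {#Iy \<gamma>#})" "\<pi> = (\<Sum>\<gamma>\<in>UNIV. k $ \<gamma> * zz $ Mindex {#Idot \<gamma>#})"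
    by (simp_all add: \<kappa>_def \<pi>_def inner_vec_def sum_tidx mult.commute)
  have \<omega>: "\<omega> $ a = (\<Sum>\<gamma>\<in>UNIV. k $ \<gamma> * zz $ Mindex {#Iy \<gamma>, a#})"
    "\<chi>' $ a = (\<Sum>\<gamma>\<in>UNIV. k $ \<gamma> * zz $ Mindex {#Idot \<gamma>, a#})" for a
    by (simp_all add: \<omega>_def \<chi>'_def matrix_vector_mult_def sum_tidx mult.commute add_mset_commute[of a])
  show ?thesis
  proof (rule that[OF X])
    show "fst (prolong2 (lift1_xi X c) (lift1_eta X c) (t, zz)) = tvec 0 (T0 p q r *\<^sub>R k) (D0 *\<^sub>R k)"
      using PF(1) by (simp add: \<xi>_def fd_def D0_def)
    show "snd (prolong2 (lift1_xi X c) (lift1_eta X c) (t, zz)) $ Mindex {#} = 0"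
      using PF(2) by simp
    show "snd (prolong2 (lift1_xi X c) (lift1_eta X c) (t, zz)) $ Mindex {#a#} =
      - (T1 p q r $ a * \<kappa> + D1 $ a * \<pi>)" for a
      using PF(3)[of a] unfolding sum_tidx
      by (simp add: \<xi>1 fd1' pd_prod3_base \<kappa> sum_distrib_left mult.assoc)
    show "snd (prolong2 (lift1_xi X c) (lift1_eta X c) (t, zz)) $ Mindex {#a, b#} =
      - (T2 p q r $ a $ b * \<kappa> + D2 $ a $ b * \<pi>)
      - (T1 p q r $ b * \<omega> $ a + D1 $ b * \<chi>' $ a) - (T1 p q r $ a * \<omega> $ b + D1 $ a * \<chi>' $ b)" for a b
      using PF(4)[of a b] unfolding sum_tidx
      by (simp add: pd_const[abs_def] \<xi>1 \<xi>2 fd1' fd2 pd_prod3_base pd_pd_prod3_base \<kappa> \<omega> sum_distrib_left mult.assoc sum.distrib)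
  qed
qed

text \<open>Here u is the quadratic polynomial whose value, first and second derivative at the given
  time are \<open>c0\<close>, \<open>c1\<close>, \<open>c2\<close>.\<close>

lemma prolong2_time_field:
  fixes zz :: "real ^ 'm tidx mindex" and c0 c1 c2 :: real
  assumes c: "c \<in> A" and t: "tpos t \<in> snd c ` fst c"
  defines "x \<equiv> axis Ix 1 :: real ^ 'm tidx" and "P \<equiv> \<lambda>\<gamma>. axis (Idot \<gamma>) 1 :: real ^ 'm tidx"
  obtains X where "p_projectable A X"
    "fst (prolong2 (lift1_xi X c) (lift1_eta X c) (t, zz)) = tvec c0 0 (- c1 *\<^sub>R tdot t)"
    "snd (prolong2 (lift1_xi X c) (lift1_eta X c) (t, zz)) $ Mindex {#} = - c1 * zz $ Mindex {#}"
    "\<And>a. snd (prolong2 (lift1_xi X c) (lift1_eta X c) (t, zz)) $ Mindex {#a#} =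
      - c2 * x $ a * zz $ Mindex {#} - c1 * zz $ Mindex {#a#} - c1 * x $ a * zz $ Mindex {#Ix#}
      + (\<Sum>\<gamma>\<in>UNIV. (c2 * t $ Idot \<gamma> * x $ a + c1 * P \<gamma> $ a) * zz $ Mindex {#Idot \<gamma>#})"
    "\<And>a b. snd (prolong2 (lift1_xi X c) (lift1_eta X c) (t, zz)) $ Mindex {#a, b#} =
      - c2 * x $ b * zz $ Mindex {#a#} - c2 * x $ a * zz $ Mindex {#b#} - c1 * zz $ Mindex {#a, b#}
      - (c2 * (x $ a * x $ b) * zz $ Mindex {#Ix#} + c1 * x $ b * zz $ Mindex {#Ix, a#} + c1 * x $ a * zz $ Mindex {#Ix, b#})
      + (\<Sum>\<gamma>\<in>UNIV. c2 * (x $ a * P \<gamma> $ b + x $ b * P \<gamma> $ a) * zz $ Mindex {#Idot \<gamma>#}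
          + (c2 * t $ Idot \<gamma> * x $ b + c1 * P \<gamma> $ b) * zz $ Mindex {#Idot \<gamma>, a#}
          + (c2 * t $ Idot \<gamma> * x $ a + c1 * P \<gamma> $ a) * zz $ Mindex {#Idot \<gamma>, b#})"
proof -
  define u where "u = (\<lambda>s. c0 + c1 * (s - t $ Ix) + c2 / 2 * ((s - t $ Ix) * (s - t $ Ix)))"
  define g where "g = aff t (c1, c2 *\<^sub>R x)"
  define one :: "real \<times> (real ^ 'm tidx)" where "one = (1, 0)"
  define X :: "(real \<times> 'a, real \<times> (real ^ 'm)) vfield" where "X = (\<lambda>d (x, y). (u x, 0))"
  have "smooth_on UNIV u" unfolding u_def by (intro smooth_intros open_UNIV)
  then have X: "p_projectable A X" unfolding X_def by (rule time_field_projectable)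
  have g: "g s = c1 + c2 * (s $ Ix - t $ Ix)" for s
    by (simp add: g_def aff_def x_def inner_axis')
  have Xd: "(X (prod_chart c) has_derivative (\<lambda>h. (fst h * g s, 0))) (at (s $ Ix, y))" for s y
  proof -
    have "(u has_real_derivative g s) (at (fst (s $ Ix, y)))"
      unfolding u_def g by (auto intro!: derivative_eq_intros simp: algebra_simps)
    then have "(u has_derivative (\<lambda>h. h * g s)) (at (fst (s $ Ix, y)))"
      by (simp add: has_field_derivative_def mult_commute_abs)
    from has_derivative_Pair[OF has_derivative_compose[OF has_derivative_fst[OF has_derivative_ident] this] has_derivative_const]
    show ?thesis unfolding X_def by (simp add: case_prod_unfold)
  qed
  define \<xi> where "\<xi> = (\<lambda>s. tvec (u (s $ Ix)) 0 (- g s *\<^sub>R tdot s))"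
  have R: "open (UNIV :: (real ^ 'm tidx) set)" "t \<in> UNIV" by auto
  have gs: "smooth_on UNIV g" unfolding g_def by (intro smooth_on_aff R)
  have \<xi>: "smooth_on UNIV \<xi>"
    unfolding \<xi>_def u_def by (intro smooth_on_tvec smooth_intros R gs smooth_on_tdot)
  have \<xi>_eq: "lift1_xi X c s = \<xi> s" for s
    using lift1_formula(1)[of X c _ s, OF Xd] by (simp add: \<xi>_def X_def)
  have g_eq: "lift1_eta X c s z = - g s * z" for s z
    using lift1_formula(2)[of X c _ s, OF Xd] by simp
  note PF = prolong2_formula[where zz = zz, OF R \<xi> \<xi>_eq gs g_eq]
  have g1: "pd a g s = c2 * x $ a" for a s by (simp add: g_def)
  have g2: "pd a (pd b g) s = 0" for a b s unfolding g1[abs_def] by simp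
  have dp: "prod3 t a b d differentiable (at s)" for a b d s
    using smooth_on_differentiable[OF smooth_on_prod3[OF open_UNIV]] by blast
  have dpd: "pd b (prod3 t a b' d) differentiable (at s)" for a b b' d s
    using smooth_on_differentiable[OF smooth_on_pd[OF open_UNIV smooth_on_prod3[OF open_UNIV]]] by blast
  have one: "aff t one s = 1" "fst one = 1" "snd one = 0" for s by (simp_all add: one_def aff_def)
  \<comment> \<open>Writing the quadratic term of u and the product of u' with the velocity as
    products of affine functions reuses the derivative formulas for \<open>prod3\<close>.\<close>
  let ?xx = "prod3 t (0, x) (0, x) one" and ?yy = "\<lambda>\<gamma>. prod3 t (c1, c2 *\<^sub>R x) (t $ Idot \<gamma>, P \<gamma>) one"
  define h where "h = c2 / 2"
  have c2: "c2 = 2 * h" by (simp add: h_def)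
  have \<xi>c: "(\<lambda>s. \<xi> s $ Ix) = (\<lambda>s. aff t (c0, c1 *\<^sub>R x) s + h * ?xx s)"
    "(\<lambda>s. \<xi> s $ Iy \<gamma>) = (\<lambda>s. 0)" "(\<lambda>s. \<xi> s $ Idot \<gamma>) = (\<lambda>s. - ?yy \<gamma> s)" for \<gamma>
    by (auto simp: h_def \<xi>_def u_def g_def prod3_def one aff_def x_def P_def inner_axis' fun_eq_iff algebra_simps)
  have \<xi>1: "pd a (\<lambda>s. \<xi> s $ Ix) s = c1 * x $ a + h * pd a ?xx s" "pd a (\<lambda>s. \<xi> s $ Iy \<gamma>) s = 0"
    "pd a (\<lambda>s. \<xi> s $ Idot \<gamma>) s = - pd a (?yy \<gamma>) s" for a s \<gamma>
    unfolding \<xi>c by (simp_all add: pd_add pd_mult pd_minus dp aff_differentiable differentiable_mult)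
  have \<xi>2: "pd a (pd b (\<lambda>s. \<xi> s $ Ix)) t = c2 * (x $ a * x $ b)" "pd a (pd b (\<lambda>s. \<xi> s $ Iy \<gamma>)) t = 0"
    "pd a (pd b (\<lambda>s. \<xi> s $ Idot \<gamma>)) t = - c2 * (x $ a * P \<gamma> $ b + x $ b * P \<gamma> $ a)" for a b \<gamma>
    unfolding \<xi>1[abs_def]
    by (simp_all add: pd_add pd_mult pd_minus dpd differentiable_mult pd_pd_prod3_base T2_def one algebra_simps c2)
  have \<xi>1': "pd a (\<lambda>s. \<xi> s $ Ix) t = c1 * x $ a" "pd a (\<lambda>s. \<xi> s $ Idot \<gamma>) t = - (c2 * t $ Idot \<gamma> * x $ a + c1 * P \<gamma> $ a)"
    for a \<gamma> unfolding \<xi>1 by (simp_all add: pd_prod3_base T1_def one)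
  have gt: "g t = c1" by (simp add: g)
  show ?thesis
  proof (rule that[OF X])
    show "fst (prolong2 (lift1_xi X c) (lift1_eta X c) (t, zz)) = tvec c0 0 (- c1 *\<^sub>R tdot t)"
      using PF(1) by (simp add: \<xi>_def gt u_def)
    show "snd (prolong2 (lift1_xi X c) (lift1_eta X c) (t, zz)) $ Mindex {#} = - c1 * zz $ Mindex {#}"
      using PF(2) by (simp add: gt)
    show "snd (prolong2 (lift1_xi X c) (lift1_eta X c) (t, zz)) $ Mindex {#a#} =
      - c2 * x $ a * zz $ Mindex {#} - c1 * zz $ Mindex {#a#} - c1 * x $ a * zz $ Mindex {#Ix#}
      + (\<Sum>\<gamma>\<in>UNIV. (c2 * t $ Idot \<gamma> * x $ a + c1 * P \<gamma> $ a) * zz $ Mindex {#Idot \<gamma>#})" for a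
      using PF(3)[of a] unfolding sum_tidx
      by (simp add: \<xi>1' \<xi>1(2) g1 gt sum.distrib sum_negf sum_subtractf algebra_simps)
    show "snd (prolong2 (lift1_xi X c) (lift1_eta X c) (t, zz)) $ Mindex {#a, b#} =
      - c2 * x $ b * zz $ Mindex {#a#} - c2 * x $ a * zz $ Mindex {#b#} - c1 * zz $ Mindex {#a, b#}
      - (c2 * (x $ a * x $ b) * zz $ Mindex {#Ix#} + c1 * x $ b * zz $ Mindex {#Ix, a#} + c1 * x $ a * zz $ Mindex {#Ix, b#})
      + (\<Sum>\<gamma>\<in>UNIV. c2 * (x $ a * P \<gamma> $ b + x $ b * P \<gamma> $ a) * zz $ Mindex {#Idot \<gamma>#}
          + (c2 * t $ Idot \<gamma> * x $ b + c1 * P \<gamma> $ b) * zz $ Mindex {#Idot \<gamma>, a#}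
          + (c2 * t $ Idot \<gamma> * x $ a + c1 * P \<gamma> $ a) * zz $ Mindex {#Idot \<gamma>, b#})" for a b
      using PF(4)[of a b] unfolding sum_tidx
      by (simp add: \<xi>1' \<xi>1(2) \<xi>2 g1 g2 gt sum.distrib sum_negf sum_subtractf algebra_simps)
  qed
qed

end

section \<open>The annihilator of the distribution\<close>

definition vhess :: "real ^ 'm tidx mindex \<Rightarrow> real ^ 'm ^ ('m::finite)" where
  "vhess zz = (\<chi> \<alpha> \<beta>. zz $ Mindex {#Idot \<alpha>, Idot \<beta>#})"

definition vgrad :: "real ^ 'm tidx mindex \<Rightarrow> real ^ ('m::finite)" where
  "vgrad zz = tdot (jgrad zz)"

text \<open>A multiple of the differential of \<open>V / z\<close>, where \<open>q\<close> is the vertical Hessian's solution of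
  \<open>H q = p\<close> and \<open>r = V / z\<close>.\<close>

definition dI_form :: "real ^ 'm \<Rightarrow> real \<Rightarrow> real ^ 'm tidx mindex \<Rightarrow> real" where
  "dI_form q r ww = 2 * (q \<bullet> vgrad ww) - q \<bullet> (vhess ww *v q) - r * ww $ Mindex {#}"
  for q :: "real ^ ('m::finite)"

lemma vhess_nth[simp]: "vhess zz $ \<alpha> $ \<beta> = zz $ Mindex {#Idot \<alpha>, Idot \<beta>#}"
  and vgrad_nth[simp]: "vgrad zz $ \<alpha> = zz $ Mindex {#Idot \<alpha>#}"
  by (simp_all add: vhess_def vgrad_def)

lemma transpose_vhess: "transpose (vhess zz) = vhess zz"
  by (simp add: transpose_def vec_eq_iff add_mset_commute)

lemma vhess_inner: "v \<bullet> (vhess zz *v w) = (vhess zz *v v) \<bullet> w"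
  by (metis dot_lmul_matrix transpose_matrix_vector transpose_vhess)

lemma bil_expand_right: "bil F v w = (\<Sum>b\<in>UNIV. w $ b * bil F v (axis b 1))"
proof -
  have "w = (\<Sum>b\<in>UNIV. w $ b *\<^sub>R axis b 1)"
    using basis_expansion[of w] by (simp add: scalar_mult_eq_scaleR)
  moreover have "bil F v (\<Sum>b\<in>B. f b) = (\<Sum>b\<in>B. bil F v (f b))" if "finite B" for B and f :: "'b \<Rightarrow> _"
    using that by (induction B rule: finite_induct) (simp_all add: bil_add_right)
  ultimately have "bil F v w = (\<Sum>b\<in>UNIV. bil F v (w $ b *\<^sub>R axis b 1))" by (metis finite)
  then show ?thesis by (simp add: bil_scale_right)
qed

lemma contr_T2:
  assumes "transpose F = F"
  shows "contr F (T2 p q r) = 2 * (fst r * bil F (snd p) (snd q) + fst q * bil F (snd p) (snd r) + fst p * bil F (snd q) (snd r))"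
proof -
  have "contr F (T2 p q r) = fst r * (bil F (snd p) (snd q) + bil F (snd q) (snd p))
      + fst q * (bil F (snd p) (snd r) + bil F (snd r) (snd p)) + fst p * (bil F (snd q) (snd r) + bil F (snd r) (snd q))"
    by (simp add: contr_def T2_def bil_def algebra_simps sum.distrib sum_distrib_left)
  then show ?thesis using bil_sym[OF assms, of "snd q" "snd p"] bil_sym[OF assms, of "snd r" "snd p"]
      bil_sym[OF assms, of "snd r" "snd q"] by (simp add: algebra_simps)
qed

lemma contr_add: "contr F (Z + Z') = contr F Z + contr F Z'"
  by (simp add: contr_def algebra_simps sum.distrib)

text \<open>At an index where \<open>q\<close> is nonzero the diagonal entry kills that component of
  \<open>v\<close>, and its row then kills the others.\<close>

lemma rank_one_antisymmetric:
  fixes v q :: "real ^ 'm"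
  assumes "q \<noteq> 0" "\<And>\<alpha> \<beta>. v $ \<alpha> * q $ \<beta> + v $ \<beta> * q $ \<alpha> = 0"
  shows "v = 0"
proof -
  obtain \<delta> where d: "q $ \<delta> \<noteq> 0" using assms(1) by (auto simp: vec_eq_iff)
  then have "v $ \<delta> = 0" using assms(2)[of \<delta> \<delta>] by simp
  then have "v $ \<alpha> = 0" for \<alpha> using assms(2)[of \<alpha> \<delta>] d by simp
  then show ?thesis by (simp add: vec_eq_iff)
qed

section \<open>Covectors annihilating the lifts of the test fields\<close>

context smfd
begin

text \<open>The pairing of \<open>n\<close> with the lift of a test field, sorted by the components
  of \<open>n\<close>. The numbers \<open>\<kappa>\<close> and \<open>\<pi>\<close> are the
  derivatives of the Lagrangian along \<open>k\<close> in position and in velocity.\<close>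

lemma annihilator_test:
  fixes n :: "'m tidx jcoords" and zz :: "real ^ 'm tidx mindex" and k :: "real ^ 'm"
  assumes c: "c \<in> A" and t: "tpos t \<in> snd c ` fst c"
    and ann: "\<And>X. p_projectable A X \<Longrightarrow> n \<bullet> prolong2 (lift1_xi X c) (lift1_eta X c) (t, zz) = 0"
    and pqr: "tdot (snd p) = 0" "tdot (snd q) = 0" "tdot (snd r) = 0"
  defines "p' \<equiv> pdot t p" and "q' \<equiv> pdot t q" and "r' \<equiv> pdot t r"
  defines "D1 \<equiv> T1 p' q r + T1 p q' r + T1 p q r'" and "K \<equiv> \<lambda>p q r. contr (jhess_coeff (snd n)) (T2 p q r)"
  defines "\<kappa> \<equiv> jgrad zz \<bullet> tvec 0 k 0" and "\<pi> \<equiv> vgrad zz \<bullet> k"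
  shows "T0 p q r * (tpos (fst n) \<bullet> k) + (T0 p' q r + T0 p q' r + T0 p q r') * (tdot (fst n) \<bullet> k)
    - \<kappa> * (jgrad (snd n) \<bullet> T1 p q r) - \<pi> * (jgrad (snd n) \<bullet> D1)
    - \<kappa> * K p q r - \<pi> * (K p' q r + K p q' r + K p q r')
    - 2 * bil (jhess_coeff (snd n)) (T1 p q r) (jhess zz *v tvec 0 k 0)
    - 2 * bil (jhess_coeff (snd n)) D1 (jhess zz *v tvec 0 0 k) = 0"
proof -
  let ?F = "jhess_coeff (snd n)"
  let ?\<omega> = "jhess zz *v tvec 0 k 0" and ?\<chi> = "jhess zz *v tvec 0 0 k"
  have \<pi>: "jgrad zz \<bullet> tvec 0 0 k = \<pi>" by (simp add: inner_tidx \<pi>_def vgrad_def)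
  obtain X where X: "p_projectable A X"
    and e0: "fst (prolong2 (lift1_xi X c) (lift1_eta X c) (t, zz))
      = tvec 0 (T0 p q r *\<^sub>R k) ((T0 p' q r + T0 p q' r + T0 p q r') *\<^sub>R k)"
    and e1: "snd (prolong2 (lift1_xi X c) (lift1_eta X c) (t, zz)) $ Mindex {#} = 0"
    and e2: "\<And>a. snd (prolong2 (lift1_xi X c) (lift1_eta X c) (t, zz)) $ Mindex {#a#} =
      - (T1 p q r $ a * \<kappa> + D1 $ a * \<pi>)"
    and e3: "\<And>a b. snd (prolong2 (lift1_xi X c) (lift1_eta X c) (t, zz)) $ Mindex {#a, b#} =
      - (T2 p q r $ a $ b * \<kappa> + (T2 p' q r + T2 p q' r + T2 p q r') $ a $ b * \<pi>)
      - (T1 p q r $ b * ?\<omega> $ a + D1 $ b * ?\<chi> $ a) - (T1 p q r $ a * ?\<omega> $ b + D1 $ a * ?\<chi> $ b)"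
    by (rule prolong2_test_field[OF c t pqr, of zz k, folded p'_def q'_def r'_def, folded D1_def \<kappa>_def, unfolded \<pi>])
      (rule that; assumption)
  let ?e = "prolong2 (lift1_xi X c) (lift1_eta X c) (t, zz)"
  have g: "jgrad (snd ?e) = - (\<kappa> *\<^sub>R T1 p q r + \<pi> *\<^sub>R D1)"
    by (simp add: vec_eq_iff e2 mult.commute)
  have h: "contr ?F (jhess (snd ?e)) = - \<kappa> * K p q r - \<pi> * (K p' q r + K p q' r + K p q r')
      - 2 * bil ?F (T1 p q r) ?\<omega> - 2 * bil ?F D1 ?\<chi>"
  proof -
    have "contr ?F (jhess (snd ?e)) = - \<kappa> * contr ?F (T2 p q r) - \<pi> * contr ?F (T2 p' q r + T2 p q' r + T2 p q r')
      - bil ?F ?\<omega> (T1 p q r) - bil ?F ?\<chi> D1 - bil ?F (T1 p q r) ?\<omega> - bil ?F D1 ?\<chi>"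
      unfolding contr_def bil_def jhess_nth e3
      by (simp add: algebra_simps sum.distrib sum_subtractf sum_negf sum_distrib_left)
    then show ?thesis
      unfolding K_def contr_add bil_sym[OF transpose_jhess_coeff, of _ ?\<omega>] bil_sym[OF transpose_jhess_coeff, of _ ?\<chi>]
      by simp
  qed
  have "n \<bullet> ?e = 0" by (rule ann[OF X])
  then show ?thesis
    unfolding inner_jcoords[of n ?e] e0 e1 g h
    by (simp add: inner_tidx[of "fst n"] inner_diff_right inner_add_right algebra_simps)
qed

text \<open>Keeping \<open>c0\<close>, \<open>c1\<close>, \<open>c2\<close> free lets one identity
  serve three purposes: it gives the x-component, the z-component and the obstruction from
  u''.\<close>

lemma annihilator_time:
  fixes n :: "'m tidx jcoords" and zz :: "real ^ 'm tidx mindex" and c0 c1 c2 :: real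
  assumes c: "c \<in> A" and t: "tpos t \<in> snd c ` fst c"
    and ann: "\<And>X. p_projectable A X \<Longrightarrow> n \<bullet> prolong2 (lift1_xi X c) (lift1_eta X c) (t, zz) = 0"
  defines "x \<equiv> axis Ix 1 :: real ^ 'm tidx" and "F \<equiv> jhess_coeff (snd n)" and "E \<equiv> jgrad (snd n)"
  shows "c0 * fst n $ Ix - c1 * (tdot (fst n) \<bullet> tdot t) - c1 * zz $ Mindex {#} * snd n $ Mindex {#}
    - c2 * zz $ Mindex {#} * (E \<bullet> x) - c1 * (E \<bullet> jgrad zz) - c1 * zz $ Mindex {#Ix#} * (E \<bullet> x)
    + c2 * (tdot t \<bullet> vgrad zz) * (E \<bullet> x) + c1 * (E \<bullet> tvec 0 0 (vgrad zz))
    - 2 * c2 * bil F x (jgrad zz) - c1 * contr F (jhess zz) - c2 * zz $ Mindex {#Ix#} * bil F x x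
    - 2 * c1 * bil F x (jhess zz *v x) + 2 * c2 * bil F x (tvec 0 0 (vgrad zz))
    + 2 * c2 * bil F x (jhess zz *v tvec 0 0 (tdot t))
    + 2 * c1 * (\<Sum>\<gamma>\<in>UNIV. bil F (axis (Idot \<gamma>) 1) (jhess zz *v axis (Idot \<gamma>) 1)) = 0"
proof -
  let ?P = "\<lambda>\<gamma>. axis (Idot \<gamma>) 1 :: real ^ 'm tidx"
  obtain X where X: "p_projectable A X"
    and e0: "fst (prolong2 (lift1_xi X c) (lift1_eta X c) (t, zz)) = tvec c0 0 (- c1 *\<^sub>R tdot t)"
    and e1: "snd (prolong2 (lift1_xi X c) (lift1_eta X c) (t, zz)) $ Mindex {#} = - c1 * zz $ Mindex {#}"
    and e2: "\<And>a. snd (prolong2 (lift1_xi X c) (lift1_eta X c) (t, zz)) $ Mindex {#a#} =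
      - c2 * x $ a * zz $ Mindex {#} - c1 * zz $ Mindex {#a#} - c1 * x $ a * zz $ Mindex {#Ix#}
      + (\<Sum>\<gamma>\<in>UNIV. (c2 * t $ Idot \<gamma> * x $ a + c1 * ?P \<gamma> $ a) * zz $ Mindex {#Idot \<gamma>#})"
    and e3: "\<And>a b. snd (prolong2 (lift1_xi X c) (lift1_eta X c) (t, zz)) $ Mindex {#a, b#} =
      - c2 * x $ b * zz $ Mindex {#a#} - c2 * x $ a * zz $ Mindex {#b#} - c1 * zz $ Mindex {#a, b#}
      - (c2 * (x $ a * x $ b) * zz $ Mindex {#Ix#} + c1 * x $ b * zz $ Mindex {#Ix, a#} + c1 * x $ a * zz $ Mindex {#Ix, b#})
      + (\<Sum>\<gamma>\<in>UNIV. c2 * (x $ a * ?P \<gamma> $ b + x $ b * ?P \<gamma> $ a) * zz $ Mindex {#Idot \<gamma>#}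
          + (c2 * t $ Idot \<gamma> * x $ b + c1 * ?P \<gamma> $ b) * zz $ Mindex {#Idot \<gamma>, a#}
          + (c2 * t $ Idot \<gamma> * x $ a + c1 * ?P \<gamma> $ a) * zz $ Mindex {#Idot \<gamma>, b#})"
    by (rule prolong2_time_field[OF c t, of zz c0 c1 c2, folded x_def]) (rule that; assumption)
  let ?e = "prolong2 (lift1_xi X c) (lift1_eta X c) (t, zz)"
  let ?v = "tvec 0 0 (vgrad zz)"
  let ?w = "jhess zz *v tvec 0 0 (tdot t)"
  have P: "(\<Sum>\<gamma>\<in>UNIV. ?P \<gamma> $ a * zz $ Mindex {#Idot \<gamma>#}) = ?v $ a" for a
    by (cases a) (simp_all add: axis_def if_distrib[of "\<lambda>x. x * _"] cong: if_cong)
  have W: "(\<Sum>\<gamma>\<in>UNIV. t $ Idot \<gamma> * zz $ Mindex {#Idot \<gamma>, a#}) = ?w $ a" for a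
    by (simp add: matrix_vector_mult_def sum_tidx mult.commute add_mset_commute[of a])
  have cx: "(jhess zz *v axis i 1) $ a = zz $ Mindex {#i, a#}" for i a
    by (simp add: matrix_vector_mult_basis column_def add_mset_commute)
  have g: "jgrad (snd ?e) = (- c2 * zz $ Mindex {#} - c1 * zz $ Mindex {#Ix#} + c2 * (tdot t \<bullet> vgrad zz)) *\<^sub>R x
      - c1 *\<^sub>R jgrad zz + c1 *\<^sub>R ?v"
    unfolding vec_eq_iff jgrad_nth e2
    by (simp add: P[symmetric] inner_vec_def algebra_simps sum.distrib sum_distrib_left)
  have hess: "jhess (snd ?e) $ a $ b = - c2 * (x $ b * jgrad zz $ a) - c2 * (x $ a * jgrad zz $ b) - c1 * jhess zz $ a $ b
      - c2 * zz $ Mindex {#Ix#} * (x $ a * x $ b) - c1 * (x $ b * (jhess zz *v x) $ a) - c1 * (x $ a * (jhess zz *v x) $ b)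
      + c2 * (x $ a * ?v $ b) + c2 * (x $ b * ?v $ a) + c2 * (x $ b * ?w $ a) + c2 * (x $ a * ?w $ b)
      + c1 * (\<Sum>\<gamma>\<in>UNIV. ?P \<gamma> $ b * (jhess zz *v ?P \<gamma>) $ a) + c1 * (\<Sum>\<gamma>\<in>UNIV. ?P \<gamma> $ a * (jhess zz *v ?P \<gamma>) $ b)" for a b
    unfolding jhess_nth e3
    by (simp add: P[symmetric] W[symmetric] x_def cx algebra_simps sum.distrib sum_distrib_left)
  have swap: "(\<Sum>a\<in>UNIV. \<Sum>b\<in>UNIV. F $ a $ b * (\<Sum>\<gamma>\<in>UNIV. f \<gamma> a b)) = (\<Sum>\<gamma>\<in>UNIV. \<Sum>a\<in>UNIV. \<Sum>b\<in>UNIV. F $ a $ b * f \<gamma> a b)"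
    for f :: "'m \<Rightarrow> 'm tidx \<Rightarrow> 'm tidx \<Rightarrow> real"
  proof -
    have "(\<Sum>a\<in>UNIV. \<Sum>b\<in>UNIV. F $ a $ b * (\<Sum>\<gamma>\<in>UNIV. f \<gamma> a b)) = (\<Sum>a\<in>UNIV. \<Sum>\<gamma>\<in>UNIV. \<Sum>b\<in>UNIV. F $ a $ b * f \<gamma> a b)"
      unfolding sum_distrib_left by (intro sum.cong refl) (rule sum.swap)
    also have "\<dots> = (\<Sum>\<gamma>\<in>UNIV. \<Sum>a\<in>UNIV. \<Sum>b\<in>UNIV. F $ a $ b * f \<gamma> a b)"
      by (rule sum.swap)
    finally show ?thesis .
  qed
  have Fsym: "bil F v w = bil F w v" for v w
    unfolding F_def by (rule bil_sym[OF transpose_jhess_coeff])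
  let ?S1 = "\<lambda>a b. \<Sum>\<gamma>\<in>UNIV. ?P \<gamma> $ b * (jhess zz *v ?P \<gamma>) $ a"
  let ?S2 = "\<lambda>a b. \<Sum>\<gamma>\<in>UNIV. ?P \<gamma> $ a * (jhess zz *v ?P \<gamma>) $ b"
  have S1: "(\<Sum>a\<in>UNIV. \<Sum>b\<in>UNIV. F $ a $ b * ?S1 a b) = (\<Sum>\<gamma>\<in>UNIV. bil F (jhess zz *v ?P \<gamma>) (?P \<gamma>))"
    unfolding swap bil_def by (intro sum.cong refl) (simp add: mult.commute)
  have S2: "(\<Sum>a\<in>UNIV. \<Sum>b\<in>UNIV. F $ a $ b * ?S2 a b) = (\<Sum>\<gamma>\<in>UNIV. bil F (?P \<gamma>) (jhess zz *v ?P \<gamma>))"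
    unfolding swap bil_def ..
  have lin: "(\<Sum>a\<in>UNIV. \<Sum>b\<in>UNIV. F $ a $ b * (r * f a b)) = r * (\<Sum>a\<in>UNIV. \<Sum>b\<in>UNIV. F $ a $ b * f a b)"
    for r and f :: "'m tidx \<Rightarrow> 'm tidx \<Rightarrow> real"
    by (simp add: sum_distrib_left mult.left_commute)
  have flip: "(\<Sum>a\<in>UNIV. \<Sum>b\<in>UNIV. F $ a $ b * (v $ b * w $ a)) = bil F w v" for v w
    unfolding bil_def by (simp add: mult.commute)
  have h: "contr F (jhess (snd ?e)) = - c2 * bil F (jgrad zz) x - c2 * bil F x (jgrad zz) - c1 * contr F (jhess zz)
      - c2 * zz $ Mindex {#Ix#} * bil F x x - c1 * bil F (jhess zz *v x) x - c1 * bil F x (jhess zz *v x)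
      + c2 * bil F x ?v + c2 * bil F ?v x + c2 * bil F ?w x + c2 * bil F x ?w
      + c1 * (\<Sum>\<gamma>\<in>UNIV. bil F (jhess zz *v ?P \<gamma>) (?P \<gamma>)) + c1 * (\<Sum>\<gamma>\<in>UNIV. bil F (?P \<gamma>) (jhess zz *v ?P \<gamma>))"
    unfolding contr_def hess
    by (simp only: ring_distribs sum.distrib sum_subtractf lin S1 S2 flip bil_def[symmetric] minus_mult_left[symmetric] sum_negf)
      (simp only: bil_def[symmetric] lin S1 S2 flip mult_minus_right sum_negf)
  have "n \<bullet> ?e = 0" by (rule ann[OF X])
  then show ?thesis
    unfolding inner_jcoords[of n ?e] e0 e1 g F_def[symmetric] h E_def[symmetric]
      Fsym[of "jgrad zz" x] Fsym[of "jhess zz *v x" x] Fsym[of ?v x] Fsym[of ?w x] Fsym[of "jhess zz *v ?P _" "?P _"]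
    by (simp add: inner_tidx[of "fst n"] inner_diff_right inner_add_right algebra_simps)
qed

text \<open>The coefficients of a covector annihilating the distribution are determined from the third-order
  Taylor coefficients of the fields downwards.\<close>

lemma annihilator:
  fixes n :: "'m tidx jcoords" and zz :: "real ^ 'm tidx mindex"
  assumes c: "c \<in> A" and t: "tpos t \<in> snd c ` fst c"
    and ann: "\<And>X. p_projectable A X \<Longrightarrow> n \<bullet> prolong2 (lift1_xi X c) (lift1_eta X c) (t, zz) = 0"
    and z: "zz $ Mindex {#} \<noteq> 0" and p: "vgrad zz \<noteq> 0"
    and inj: "\<And>v. vhess zz *v v = 0 \<Longrightarrow> v = 0" and q: "vhess zz *v q = vgrad zz"
  shows "\<exists>\<kappa>. \<forall>e. n \<bullet> e = \<kappa> * dI_form q (vgrad zz \<bullet> q / zz $ Mindex {#}) (snd e)"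
proof -
  define F where "F = jhess_coeff (snd n)"
  define E where "E = jgrad (snd n)"
  define H where "H = vhess zz"
  define v where "v = vgrad zz"
  define y' where "y' = tdot t"
  define x :: "real ^ 'm tidx" where "x = axis Ix 1"
  define Y :: "'m \<Rightarrow> real ^ 'm tidx" where "Y = (\<lambda>\<beta>. axis (Iy \<beta>) 1)"
  define P :: "'m \<Rightarrow> real ^ 'm tidx" where "P = (\<lambda>\<delta>. axis (Idot \<delta>) 1)"
  \<comment> \<open>The gradient of the function s: its total derivative vanishes at
    \<open>t\<close>, so \<open>pdot\<close> turns (0, \<open>S \<beta>\<close>) into (0,
    \<open>P \<beta>\<close>), whereas (0, \<open>x\<close>) becomes (1, 0).\<close>
  define S where "S = (\<lambda>\<beta>. Y \<beta> - (y' $ \<beta>) *\<^sub>R x)"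
  define one :: "real \<times> (real ^ 'm tidx)" where "one = (1, 0)"
  define \<chi>' where "\<chi>' = (\<lambda>k. jhess zz *v tvec 0 0 k)"
  have \<chi>'_eq: "jhess zz *v tvec 0 0 k = \<chi>' k" for k by (simp add: \<chi>'_def)
  have Ftr: "transpose F = F" unfolding F_def by (rule transpose_jhess_coeff)
  have Fsym: "bil F a b = bil F b a" for a b
    unfolding F_def by (rule bil_sym[OF transpose_jhess_coeff])
  have Hsym: "a \<bullet> (H *v b) = (H *v a) \<bullet> b" for a b
    unfolding H_def by (rule vhess_inner)
  have Hinj: "a = 0" if "H *v a = 0" for a using inj that by (simp add: H_def)
  have Hq: "H *v q = v" using q by (simp add: H_def v_def)
  have v: "v \<noteq> 0" using p by (simp add: v_def)
  have q0: "q \<noteq> 0" using v Hq by auto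
  have solve: "a = - r *\<^sub>R q" if "\<And>k. (v \<bullet> k) * r + a \<bullet> (H *v k) = 0" for a r
  proof -
    have "(r *\<^sub>R v + H *v a) \<bullet> k = 0" for k
      using that[of k] by (simp add: inner_add_left Hsym mult.commute)
    from this[of "r *\<^sub>R v + H *v a"] have "r *\<^sub>R v + H *v a = 0" by simp
    then have "H *v (a + r *\<^sub>R q) = 0"
      by (simp add: matrix_vector_right_distrib scaleR_matrix_vector_assoc[symmetric] matrix_vector_mult_scaleR Hq add.commute)
    then have "a + r *\<^sub>R q = 0" by (rule Hinj)
    then show ?thesis by (simp add: add_eq_0_iff2)
  qed
  have td[simp]: "tdot x = 0" "tdot (S \<beta>) = 0" for \<beta>
    by (simp_all add: x_def S_def Y_def vec_eq_iff axis_def)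
  have dot_one: "pdot t one = (0, 0)"
  proof -
    have "tvec 0 0 (tpos (0 :: real ^ 'm tidx)) $ i = 0" for i by (cases i) auto
    then show ?thesis by (simp add: pdot_def one_def vec_eq_iff)
  qed
  have dot_x: "pdot t (0, x) = (1, 0)"
  proof -
    have "tvec 0 0 (tpos x) $ i = 0" for i by (cases i) (auto simp: x_def axis_def)
    then show ?thesis by (simp add: pdot_def x_def vec_eq_iff inner_axis')
  qed
  have dot_S: "pdot t (0, S \<beta>) = (0, P \<beta>)" for \<beta>
  proof -
    have "tvec 0 0 (tpos (S \<beta>)) $ i = P \<beta> $ i" for i by (cases i) (auto simp: S_def P_def Y_def x_def axis_def)
    moreover have "S \<beta> \<bullet> tvec 1 (tdot t) 0 = 0"
      by (simp add: S_def Y_def x_def inner_diff_left inner_axis' y'_def)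
    ultimately show ?thesis by (simp add: pdot_def vec_eq_iff)
  qed
  have one: "tdot (snd one) = 0" "fst one = 1" "snd one = 0" by (simp_all add: one_def)
  have two: "2 * a = 2 *\<^sub>R a" for a :: "real ^ 'm tidx" by (simp add: vec_eq_iff)
  note simps = two one dot_one dot_x dot_S T0_def T1_def F_def[symmetric] contr_T2[OF Ftr] E_def[symmetric] v_def[symmetric] \<chi>'_eq
  note test = annihilator_test[OF c t ann]
  \<comment> \<open>Once \<open>F\<close> pairs \<open>a\<close> to zero with the directions of x
    and y, only velocity directions contribute, and there the vector \<open>\<chi>' k\<close> has
    components \<open>H *v k\<close>.\<close>
  have expand: "bil F a b = (\<Sum>\<delta>\<in>UNIV. b $ Idot \<delta> * bil F a (P \<delta>))"
    if "bil F a x = 0" "\<And>\<beta>. bil F a (Y \<beta>) = 0" for a b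
    unfolding bil_expand_right[of F a b] sum_tidx using that by (simp add: x_def Y_def P_def)
  have \<chi>_dot: "\<chi>' k $ Idot \<delta> = (H *v k) $ \<delta>" for k \<delta>
    by (simp add: \<chi>'_def H_def matrix_vector_mult_def sum_tidx)
  have expand_\<chi>: "2 * bil F a (\<chi>' k) = (\<chi> \<delta>. 2 * bil F a (P \<delta>)) \<bullet> (H *v k)"
    if "bil F a x = 0" "\<And>\<beta>. bil F a (Y \<beta>) = 0" for a k
    unfolding expand[OF that, of "\<chi>' k"] \<chi>_dot inner_vec_def sum_distrib_left
    by (intro sum.cong refl) simp
  have vv: "v \<bullet> v \<noteq> 0" using v by simp

  \<comment> \<open>Cubic tests. A product of three functions vanishing at the point contributes
    only where the total derivative turns a factor x' into 1; \<open>F\<close> is then evaluated on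
    the other two gradients. Taking \<open>k = v\<close> makes the coefficient v . v
    nonzero.\<close>
  have "bil F x x = 0" using test[of "(0, x)" "(0, x)" "(0, x)" v] vv by (simp add: simps)
  moreover have "bil F x (S \<beta>) = 0" for \<beta> using test[of "(0, x)" "(0, x)" "(0, S \<beta>)" v] vv by (simp add: simps)
  moreover have "bil F (S \<alpha>) (S \<beta>) = 0" for \<alpha> \<beta>
    using test[of "(0, x)" "(0, S \<alpha>)" "(0, S \<beta>)" v] vv by (simp add: simps)
  moreover have YS: "Y \<beta> = S \<beta> + (y' $ \<beta>) *\<^sub>R x" for \<beta> by (simp add: S_def)
  ultimately have Fxx: "bil F x x = 0" and FxS: "bil F x (S \<beta>) = 0" and FSx: "bil F (S \<beta>) x = 0"
    and FxY: "bil F x (Y \<beta>) = 0" and FSY: "bil F (S \<alpha>) (Y \<beta>) = 0"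
    and FSS: "bil F (S \<alpha>) (S \<beta>) = 0" for \<alpha> \<beta>
    by (simp_all add: bil_add_left bil_add_right bil_scale_left bil_scale_right Fsym[of "S \<gamma>" x for \<gamma>])

  define \<epsilon> where "\<epsilon> = E \<bullet> x"
  define g where "g = (\<chi> \<delta>. 2 * bil F x (P \<delta>))"
  \<comment> \<open>The test x' x' relates the coefficient of the x-derivative of the Lagrangian to
    those of the mixed derivatives in x and velocity.\<close>
  have "(v \<bullet> k) * \<epsilon> + g \<bullet> (H *v k) = 0" for k
    using test[of "(0, x)" "(0, x)" one k] expand_\<chi>[OF Fxx FxY, of k]
    by (simp add: simps Fxx \<epsilon>_def g_def bil_scale_left)
  then have g: "g = - \<epsilon> *\<^sub>R q" by (rule solve)
  \<comment> \<open>The test x' s leaves the same kind of relation for each \<open>\<beta>\<close>;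
    the scalar in it is named \<open>w\<close> and contains \<open>g\<close> because the total
    derivative of s is a velocity.\<close>
  define G where "G = (\<lambda>\<beta>. \<chi> \<delta>. 2 * bil F (S \<beta>) (P \<delta>))"
  define w where "w = (\<chi> \<beta>. E \<bullet> S \<beta> + g $ \<beta>)"
  have G: "G \<beta> = - (w $ \<beta>) *\<^sub>R q" for \<beta>
  proof (rule solve)
    fix k show "(v \<bullet> k) * w $ \<beta> + G \<beta> \<bullet> (H *v k) = 0"
      using test[of "(0, x)" "(0, S \<beta>)" one k] expand_\<chi>[OF FSx FSY, of \<beta> k]
      by (simp add: simps FxS w_def G_def g_def algebra_simps)
  qed
  \<comment> \<open>The test s s says that the matrix with rows \<open>G \<beta>\<close> is
    antisymmetric, and by the previous step it is a rank-one matrix built from \<open>w\<close> and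
    \<open>q\<close>.\<close>
  have "w = 0"
  proof (rule rank_one_antisymmetric[OF q0])
    fix \<alpha> \<beta>
    have "2 * bil F (P \<alpha>) (S \<beta>) + 2 * bil F (S \<alpha>) (P \<beta>) = 0"
      using test[of "(0, S \<alpha>)" "(0, S \<beta>)" one v] vv by (simp add: simps FSS)
    then have "G \<alpha> $ \<beta> + G \<beta> $ \<alpha> = 0"
      by (simp add: G_def Fsym[of "P \<alpha>" "S \<beta>"])
    then show "w $ \<alpha> * q $ \<beta> + w $ \<beta> * q $ \<alpha> = 0" unfolding G by simp
  qed
  \<comment> \<open>The field with u'' = 1 at the point. Its gradient terms cancel, and its velocity
    terms cancel because g is a multiple of q and H q = v. Only -z times \<open>\<epsilon>\<close>
    survives, which is where a nonzero Lagrangian is used.\<close>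
  have "\<epsilon> * zz $ Mindex {#} = 0"
  proof -
    have 1: "2 * bil F x a = g \<bullet> tdot a" for a
      unfolding expand[OF Fxx FxY, of a] g_def inner_vec_def sum_distrib_left
      by (intro sum.cong refl) simp
    have "- zz $ Mindex {#} * \<epsilon> + (y' \<bullet> v) * \<epsilon> - g \<bullet> v + g \<bullet> v + g \<bullet> (H *v y') = 0"
    proof -
      have "tdot (jgrad zz) = v" "tdot (\<chi>' y') = H *v y'"
        by (simp_all add: v_def vgrad_def vec_eq_iff \<chi>_dot)
      then show ?thesis
        using annihilator_time[OF c t ann, of 0 0 1, folded x_def F_def E_def v_def \<epsilon>_def y'_def, unfolded \<chi>'_eq]
          1[of "jgrad zz"] 1[of "tvec 0 0 v"] 1[of "\<chi>' y'"] Fxx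
        by simp
    qed
    then show ?thesis unfolding g by (auto simp: Hsym Hq inner_commute)
  qed
  then have \<epsilon>: "\<epsilon> = 0" using z by simp
  have g0: "g = 0" unfolding g \<epsilon> by simp
  have ES: "E \<bullet> S \<beta> = 0" for \<beta> using \<open>w = 0\<close> g0 by (simp add: w_def vec_eq_iff)
  have Ex: "E \<bullet> x = 0" using \<epsilon> by (simp add: \<epsilon>_def)
  have EY: "E \<bullet> Y \<beta> = 0" for \<beta> unfolding YS using ES Ex by (simp add: inner_add_right)
  have Fx: "bil F x a = 0" for a
  proof -
    have "bil F x (P \<delta>) = 0" for \<delta> using g0 by (simp add: g_def vec_eq_iff)
    then show ?thesis by (simp add: expand[OF Fxx FxY, of a])
  qed
  have FS: "bil F (S \<beta>) a = 0" for \<beta> a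
  proof -
    have "G \<beta> = 0" using G \<open>w = 0\<close> by simp
    then have "bil F (S \<beta>) (P \<delta>) = 0" for \<delta> by (simp add: G_def vec_eq_iff)
    then show ?thesis by (simp add: expand[OF FSx FSY, of \<beta> a])
  qed
  have FY: "bil F (Y \<beta>) a = 0" for \<beta> a unfolding YS by (simp add: bil_add_left bil_scale_left FS Fx)

  \<comment> \<open>With the gradient and Hessian coefficients of x and y gone, the tests x', 1 and
    u = 1 read off the base components directly.\<close>
  have "tdot (fst n) \<bullet> k = 0" for k
    using test[of "(0, x)" one one k] by (simp add: simps Ex Fx)
  then have Adot: "tdot (fst n) = 0" using inner_eq_zero_iff by blast
  have "tpos (fst n) \<bullet> k = 0" for k
    using test[of one one one k] by (simp add: simps)
  then have Apos: "tpos (fst n) = 0" using inner_eq_zero_iff by blast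
  have Ax: "fst n $ Ix = 0"
    using annihilator_time[OF c t ann, of 1 0 0] by simp
  have A: "fst n = 0"
    using Adot Apos Ax by (metis tvec_tpos_tdot tpos_0 tdot_0 zero_index)

  define \<Phi> where "\<Phi> = (\<lambda>\<beta>. \<chi> \<delta>. 2 * bil F (P \<beta>) (P \<delta>))"
  define E' where "E' = tdot E"
  have EP: "E \<bullet> P \<beta> = E' $ \<beta>" for \<beta> by (simp add: P_def E'_def inner_axis)
  have FPx: "bil F (P \<beta>) x = 0" "bil F (P \<beta>) (Y \<alpha>) = 0" for \<alpha> \<beta>
    using Fx FY Fsym by metis+
  \<comment> \<open>The linear test s ties the vertical Hessian coefficients to the vertical
    gradient coefficients. Symmetry of the former then forces \<open>E'\<close> to be parallel to
    \<open>q\<close>, which leaves a single factor \<open>\<kappa>'\<close>.\<close>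
  have \<Phi>: "\<Phi> \<beta> = - (E' $ \<beta>) *\<^sub>R q" for \<beta>
  proof (rule solve)
    fix k show "(v \<bullet> k) * E' $ \<beta> + \<Phi> \<beta> \<bullet> (H *v k) = 0"
      using test[of "(0, S \<beta>)" one one k] expand_\<chi>[OF FPx, of \<beta> k]
      by (simp add: simps ES FS EP \<Phi>_def algebra_simps)
  qed
  obtain \<delta> where \<delta>: "q $ \<delta> \<noteq> 0" using q0 by (auto simp: vec_eq_iff)
  define \<kappa>' where "\<kappa>' = E' $ \<delta> / q $ \<delta>"
  have E': "E' = \<kappa>' *\<^sub>R q"
  proof -
    have "\<Phi> \<beta> $ \<delta> = \<Phi> \<delta> $ \<beta>" for \<beta> by (simp add: \<Phi>_def Fsym[of "P \<beta>" "P \<delta>"])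
    then have "E' $ \<beta> * q $ \<delta> = E' $ \<delta> * q $ \<beta>" for \<beta> unfolding \<Phi> by simp
    then show ?thesis using \<delta> by (simp add: vec_eq_iff \<kappa>'_def field_simps)
  qed
  have FPP: "bil F (P \<alpha>) (P \<beta>) = - \<kappa>' / 2 * (q $ \<alpha> * q $ \<beta>)" for \<alpha> \<beta>
    using \<Phi>[of \<alpha>] by (simp add: \<Phi>_def vec_eq_iff E' field_simps)
  have bilPP: "bil F a b = - \<kappa>' / 2 * ((q \<bullet> tdot a) * (q \<bullet> tdot b))" for a b
  proof -
    have 1: "bil F (P \<alpha>) b = - \<kappa>' / 2 * (q $ \<alpha> * (q \<bullet> tdot b))" for \<alpha> b
      unfolding expand[OF FPx, of \<alpha> b] FPP inner_vec_def sum_distrib_left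
      by (intro sum.cong refl) simp
    have "bil F a b = (\<Sum>i\<in>UNIV. a $ i * bil F (axis i 1) b)"
      unfolding Fsym[of a b] bil_expand_right[of F b a] by (intro sum.cong refl) (simp only: Fsym[of b])
    also have "\<dots> = (\<Sum>\<alpha>\<in>UNIV. a $ Idot \<alpha> * bil F (P \<alpha>) b)"
      unfolding sum_tidx using Fx FY by (simp add: x_def Y_def P_def)
    also have "\<dots> = - \<kappa>' / 2 * ((\<Sum>\<alpha>\<in>UNIV. q $ \<alpha> * a $ Idot \<alpha>) * (q \<bullet> tdot b))"
      unfolding 1 sum_distrib_right sum_distrib_left by (intro sum.cong refl) simp
    finally show ?thesis by (simp add: inner_vec_def[of q "tdot a"])
  qed
  have Fij: "F $ i $ j = - \<kappa>' / 2 * ((q \<bullet> tdot (axis i 1)) * (q \<bullet> tdot (axis j 1)))" for i j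
    using bilPP[of "axis i 1" "axis j 1"] by (simp add: bil_axis)
  have td_axis: "tdot (axis Ix 1 :: real ^ 'm tidx) = 0" "tdot (axis (Iy \<alpha>) 1 :: real ^ 'm tidx) = 0"
    "tdot (axis (Idot \<alpha>) 1 :: real ^ 'm tidx) = axis \<alpha> 1" for \<alpha>
    by (simp_all add: vec_eq_iff axis_def)
  have contrF: "contr F (jhess ww) = - \<kappa>' / 2 * (q \<bullet> (vhess ww *v q))" for ww
    unfolding contr_def Fij sum_tidx td_axis inner_axis
    by (simp add: inner_vec_def matrix_vector_mult_def sum_distrib_left mult_ac)
  have E_inner: "E \<bullet> a = \<kappa>' * (q \<bullet> tdot a)" for a
  proof -
    have "E $ Ix = 0" "tpos E = 0" using Ex EY by (simp_all add: x_def Y_def inner_axis vec_eq_iff)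
    then show ?thesis unfolding inner_tidx[of E a] E'_def[symmetric] E' by simp
  qed
  \<comment> \<open>The remaining coefficient, that of z, is fixed by the scaling field with u' = 1
    at the point; it reproduces the ratio V / z.\<close>
  have "snd n $ Mindex {#} = - \<kappa>' * (v \<bullet> q / zz $ Mindex {#}) / 2"
  proof -
    have 1: "(\<Sum>\<gamma>\<in>UNIV. bil F (P \<gamma>) (jhess zz *v P \<gamma>)) = - \<kappa>' / 2 * (q \<bullet> (H *v q))"
    proof -
      have "tdot (jhess zz *v P \<gamma>) = (\<chi> \<alpha>. H $ \<alpha> $ \<gamma>)" for \<gamma>
        by (simp add: vec_eq_iff P_def matrix_vector_mult_basis column_def H_def)
      then show ?thesis
        unfolding bilPP by (simp add: P_def td_axis inner_axis)
          (simp add: inner_vec_def matrix_vector_mult_def sum_distrib_left sum_divide_distrib sum_negf mult_ac H_def add_mset_commute)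
    qed
    have "tdot (jgrad zz) = v" by (simp add: v_def vgrad_def)
    then have "- zz $ Mindex {#} * snd n $ Mindex {#} + \<kappa>' / 2 * (q \<bullet> (H *v q)) + 2 * (- \<kappa>' / 2 * (q \<bullet> (H *v q))) = 0"
      using annihilator_time[OF c t ann, of 0 1 0, folded x_def F_def E_def v_def] 1[unfolded P_def]
      by (simp add: A Fx Ex E_inner contrF H_def[symmetric])
    then show ?thesis using z by (simp add: Hq field_simps inner_commute)
  qed
  then have "n \<bullet> e = \<kappa>' / 2 * dI_form q (v \<bullet> q / zz $ Mindex {#}) (snd e)" for e
    unfolding inner_jcoords[of n e] F_def[symmetric] E_def[symmetric] contrF E_inner A dI_form_def
    by (simp add: vgrad_def algebra_simps)
  then show ?thesis unfolding v_def by blast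
qed

end

section \<open>The invariant in coordinates\<close>

definition regular :: "'m::finite tidx jcoords \<Rightarrow> bool" where
  "regular e \<longleftrightarrow> snd e $ Mindex {#} \<noteq> 0 \<and> vgrad (snd e) \<noteq> 0 \<and> det (vhess (snd e)) \<noteq> 0"

text \<open>Cramer's rule for H q = p: as a rational function of the coordinates it is visibly
  smooth where the determinant does not vanish.\<close>

definition qvec :: "'m::finite tidx jcoords \<Rightarrow> real ^ 'm" where
  "qvec e = (\<chi> k. det (\<chi> i j. if j = k then vgrad (snd e) $ i else vhess (snd e) $ i $ j) / det (vhess (snd e)))"

definition Icoord :: "'m::finite tidx jcoords \<Rightarrow> real" where
  "Icoord e = (vgrad (snd e) \<bullet> qvec e) / snd e $ Mindex {#}"

lemma det_vhess_inj:
  assumes "det (vhess ww) \<noteq> 0" "vhess ww *v v = 0"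
  shows "v = 0"
  using assms by (metis invertible_det_nz invertible_left_inverse matrix_left_invertible_ker)

lemma qvec_iff: "det (vhess (snd e)) \<noteq> 0 \<Longrightarrow> vhess (snd e) *v q = vgrad (snd e) \<longleftrightarrow> q = qvec e"
  unfolding qvec_def by (rule cramer)

lemma vhess_qvec: "det (vhess (snd e)) \<noteq> 0 \<Longrightarrow> vhess (snd e) *v qvec e = vgrad (snd e)"
  by (simp add: qvec_iff)

lemma qvec_nonzero: "regular e \<Longrightarrow> qvec e \<noteq> 0"
  using vhess_qvec[of e] by (auto simp: regular_def)

lemma smooth_on_jet_coord: "open S \<Longrightarrow> smooth_on S (\<lambda>e. snd e $ I)"
  by (intro smooth_on_vec_nth smooth_on_snd smooth_on_id)

lemma smooth_on_det_vhess: "open S \<Longrightarrow> smooth_on S (\<lambda>e. det (vhess (snd e)))"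
  unfolding vhess_def by (intro smooth_on_det smooth_on_jet_coord)

lemma open_regular: "open {e :: 'm::finite tidx jcoords. regular e}"
proof -
  have c: "continuous_on UNIV (\<lambda>e :: 'm tidx jcoords. snd e $ I)" for I
    by (rule smooth_on_imp_continuous_on[OF smooth_on_jet_coord[OF open_UNIV]])
  have d: "continuous_on UNIV (\<lambda>e :: 'm tidx jcoords. det (vhess (snd e)))"
    by (rule smooth_on_imp_continuous_on[OF smooth_on_det_vhess[OF open_UNIV]])
  have "{e :: 'm tidx jcoords. regular e} = {e. snd e $ Mindex {#} \<noteq> 0} \<inter> (\<Union>\<alpha>. {e. snd e $ Mindex {#Idot \<alpha>#} \<noteq> 0})
      \<inter> {e. det (vhess (snd e)) \<noteq> 0}"
    by (auto simp: regular_def vec_eq_iff)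
  then show ?thesis
    using c d by (auto intro!: open_Int open_UN open_Collect_neq continuous_on_const)
qed

lemma smooth_on_qvec:
  assumes "open S" "\<And>e. e \<in> S \<Longrightarrow> regular e"
  shows "smooth_on S qvec"
proof (rule smooth_on_vec[OF assms(1)])
  fix k
  have 1: "smooth_on S (\<lambda>e. if j = k then vgrad (snd e) $ i else vhess (snd e) $ i $ j)" for i j
    using smooth_on_jet_coord[OF assms(1)] by (cases "j = k") simp_all
  show "smooth_on S (\<lambda>e. qvec e $ k)"
    unfolding qvec_def vec_lambda_beta
    by (intro smooth_on_divide smooth_on_det smooth_on_det_vhess 1 assms(1)) (use assms(2) in \<open>auto simp: regular_def\<close>)
qed

lemma smooth_on_Icoord:
  assumes "open S" "\<And>e. e \<in> S \<Longrightarrow> regular e"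
  shows "smooth_on S Icoord"
  unfolding Icoord_def[abs_def] inner_vec_def inner_real_def vgrad_nth
  by (intro smooth_on_divide smooth_on_sum smooth_on_mult smooth_on_jet_coord assms
      smooth_on_vec_nth[OF assms(1) smooth_on_qvec[OF assms]]) (use assms(2) in \<open>auto simp: regular_def\<close>)

text \<open>No derivative of an inverse matrix is computed. Differentiating H q = p gives H dq = dp
  - dH q, and pairing with q, by symmetry of H, gives p . dq = q . dp - q . (dH q).\<close>

lemma Icoord_has_derivative:
  assumes e: "regular e"
  shows "(Icoord has_derivative (\<lambda>w. dI_form (qvec e) (vgrad (snd e) \<bullet> qvec e / snd e $ Mindex {#}) (snd w) / snd e $ Mindex {#})) (at e)"
proof -
  let ?q = "qvec e" and ?z = "snd e $ Mindex {#}" and ?H = "vhess (snd e)" and ?p = "vgrad (snd e)"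
  define Q where "Q = frechet_derivative qvec (at e)"
  have Q: "(qvec has_derivative Q) (at e)"
    unfolding Q_def by (rule smooth_on_has_derivative[OF smooth_on_qvec[OF open_regular]]) (use e in auto)
  have Qi: "((\<lambda>e. qvec e $ i) has_derivative (\<lambda>w. Q w $ i)) (at e)" for i
    by (rule bounded_linear.has_derivative[OF bounded_linear_vec_nth Q])
  have J: "((\<lambda>e. snd e $ I) has_derivative (\<lambda>w. snd w $ I)) (at e)" for I :: "'a tidx mindex"
    by (intro bounded_linear.has_derivative[OF bounded_linear_vec_nth] has_derivative_snd has_derivative_ident)
  have eq: "vgrad (snd w) = vhess (snd w) *v ?q + ?H *v Q w" for w
  proof -
    have "vgrad (snd w) $ \<alpha> = (vhess (snd w) *v ?q + ?H *v Q w) $ \<alpha>" for \<alpha>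
    proof -
      have 1: "((\<lambda>e. \<Sum>\<beta>\<in>UNIV. snd e $ Mindex {#Idot \<alpha>, Idot \<beta>#} * qvec e $ \<beta>) has_derivative
          (\<lambda>w. \<Sum>\<beta>\<in>UNIV. ?H $ \<alpha> $ \<beta> * Q w $ \<beta> + vhess (snd w) $ \<alpha> $ \<beta> * ?q $ \<beta>)) (at e)"
        using has_derivative_sum[OF has_derivative_mult[OF J Qi]] by simp
      have 2: "(\<Sum>\<beta>\<in>UNIV. snd e $ Mindex {#Idot \<alpha>, Idot \<beta>#} * qvec e $ \<beta>) = snd e $ Mindex {#Idot \<alpha>#}"
        if "e \<in> {e. regular e}" for e
      proof -
        have "(vhess (snd e) *v qvec e) $ \<alpha> = vgrad (snd e) $ \<alpha>"
          using that vhess_qvec[of e] by (simp add: regular_def)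
        then show ?thesis by (simp add: matrix_vector_mult_def)
      qed
      have "((\<lambda>e. snd e $ Mindex {#Idot \<alpha>#}) has_derivative
          (\<lambda>w. \<Sum>\<beta>\<in>UNIV. ?H $ \<alpha> $ \<beta> * Q w $ \<beta> + vhess (snd w) $ \<alpha> $ \<beta> * ?q $ \<beta>)) (at e)"
        by (rule has_derivative_transform_within_open[OF 1 open_regular _ 2]) (use e in auto)
      from fun_cong[OF has_derivative_unique[OF J this], of w] show ?thesis
        by (simp add: matrix_vector_mult_def sum.distrib)
    qed
    then show ?thesis by (simp only: vec_eq_iff) blast
  qed
  have "((\<lambda>e. \<Sum>\<beta>\<in>UNIV. snd e $ Mindex {#Idot \<beta>#} * qvec e $ \<beta>) has_derivative
      (\<lambda>w. \<Sum>\<beta>\<in>UNIV. ?p $ \<beta> * Q w $ \<beta> + vgrad (snd w) $ \<beta> * ?q $ \<beta>)) (at e)"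
    using has_derivative_sum[OF has_derivative_mult[OF J Qi]] by simp
  moreover have "(\<Sum>\<beta>\<in>UNIV. ?p $ \<beta> * Q w $ \<beta> + vgrad (snd w) $ \<beta> * ?q $ \<beta>)
      = 2 * (?q \<bullet> vgrad (snd w)) - ?q \<bullet> (vhess (snd w) *v ?q)" for w
  proof -
    have "?p \<bullet> Q w = ?q \<bullet> (?H *v Q w)"
      using vhess_qvec[of e] e by (simp add: vhess_inner regular_def)
    also have "\<dots> = ?q \<bullet> vgrad (snd w) - ?q \<bullet> (vhess (snd w) *v ?q)"
      unfolding eq[of w] by (simp add: inner_add_right)
    finally have "?p \<bullet> Q w = ?q \<bullet> vgrad (snd w) - ?q \<bullet> (vhess (snd w) *v ?q)" .
    moreover have "(\<Sum>\<beta>\<in>UNIV. ?p $ \<beta> * Q w $ \<beta> + vgrad (snd w) $ \<beta> * ?q $ \<beta>) = ?p \<bullet> Q w + ?q \<bullet> vgrad (snd w)"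
      by (simp add: inner_vec_def sum.distrib mult.commute)
    ultimately show ?thesis by simp
  qed
  ultimately have V: "((\<lambda>e. vgrad (snd e) \<bullet> qvec e) has_derivative
      (\<lambda>w. 2 * (?q \<bullet> vgrad (snd w)) - ?q \<bullet> (vhess (snd w) *v ?q))) (at e)"
    by (simp add: inner_vec_def[of "vgrad _" "qvec _"])
  have z: "?z \<noteq> 0" using e by (simp add: regular_def)
  show ?thesis
    unfolding Icoord_def[abs_def]
    by (rule has_derivative_eq_rhs[OF has_derivative_divide'[OF V J z]])
      (use z in \<open>auto simp: dI_form_def fun_eq_iff field_simps power2_eq_square\<close>)
qed

text \<open>On the direction that moves p by \<open>q\<close> and leaves z and H fixed, the form
  takes the value 2 (q . q).\<close>

lemma dI_form_nonzero:
  fixes q :: "real ^ ('m::finite)"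
  assumes "q \<noteq> 0"
  shows "\<exists>ww. dI_form q r ww \<noteq> 0"
proof -
  define ww where "ww = (\<Sum>\<beta>\<in>UNIV. q $ \<beta> *\<^sub>R axis (Mindex {#Idot \<beta>#}) 1 :: real ^ 'm tidx mindex)"
  have "vgrad ww = q" by (simp add: ww_def vec_eq_iff axis_def if_distrib cong: if_cong)
  moreover have "vhess ww = 0" "ww $ Mindex {#} = 0" by (simp_all add: ww_def vec_eq_iff axis_def)
  ultimately have "dI_form q r ww = 2 * (q \<bullet> q)" by (simp add: dI_form_def)
  with assms show ?thesis by (intro exI[of _ ww]) simp
qed

lemma linear_dI_form: "linear (\<lambda>e. dI_form q r (snd e))"
  by (rule linearI)
    (simp_all add: dI_form_def inner_vec_def matrix_vector_mult_def sum.distrib sum_distrib_left algebra_simps)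

lemma linear_functional_inner:
  fixes f :: "'a::euclidean_space \<Rightarrow> real"
  assumes "linear f"
  obtains g where "\<And>x. f x = g \<bullet> x"
proof
  fix x
  have "f x = (\<Sum>b\<in>Basis. (x \<bullet> b) *\<^sub>R f b)" by (simp only: linear_euclidean_expand[OF assms])
  then show "f x = (\<Sum>b\<in>Basis. f b *\<^sub>R b) \<bullet> x"
    by (simp add: inner_sum_left mult.commute inner_commute[of x])
qed

section \<open>Density of the regular jets\<close>

text \<open>The determinant is a polynomial in \<open>s\<close>. It is not the zero polynomial,
  because for \<open>s\<close> above a bound of the operator norm of \<open>B\<close> the shifted
  matrix is injective.\<close>

lemma finite_det_shift: "finite {s :: real. det (B + s *\<^sub>R mat 1) = 0}" for B :: "real ^ 'n ^ 'n"
proof -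
  define P where "P = (\<Sum>\<pi>\<in>{\<pi>. \<pi> permutes (UNIV :: 'n set)}.
      smult (of_int (sign \<pi>)) (\<Prod>i\<in>UNIV. [:B $ i $ \<pi> i, if i = \<pi> i then 1 else 0:]))"
  have P: "poly P s = det (B + s *\<^sub>R mat 1)" for s
    unfolding P_def det_def by (simp add: poly_sum poly_prod mat_def)
  obtain K where K: "K > 0" "\<And>x. norm (B *v x) \<le> norm x * K"
    using bounded_linear.pos_bounded[OF matrix_vector_mul_bounded_linear] by blast
  have "x = 0" if "(B + (K + 1) *\<^sub>R mat 1) *v x = 0" for x
  proof -
    have "(B + (K + 1) *\<^sub>R mat 1) *v x = B *v x + (K + 1) *\<^sub>R x"
      by (simp add: matrix_vector_mult_add_rdistrib scaleR_matrix_vector_assoc[symmetric])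
    with that have "B *v x = - ((K + 1) *\<^sub>R x)" by (simp add: add_eq_0_iff2)
    then have "(K + 1) * norm x \<le> norm x * K" using K(2)[of x] K(1) by simp
    then show ?thesis by (simp add: algebra_simps)
  qed
  then have "det (B + (K + 1) *\<^sub>R mat 1) \<noteq> 0"
    by (metis invertible_det_nz invertible_left_inverse matrix_left_invertible_ker)
  then have "P \<noteq> 0" using P[of "K + 1"] by auto
  from poly_roots_finite[OF this] show ?thesis by (simp add: P)
qed

text \<open>The direction \<open>ww\<close> moves z and every component of p at unit speed and adds
  multiples of the identity to H. Along this line each condition fails for finitely many parameters
  only, while a neighbourhood contains infinitely many.\<close>

lemma regular_dense:
  fixes e :: "'m::finite tidx jcoords"
  assumes "open S" "e \<in> S"
  shows "\<exists>e'\<in>S. regular e'"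
proof -
  define ww :: "real ^ 'm tidx mindex" where "ww = (\<chi> I. if I = Mindex {#} \<or> I \<in> range (\<lambda>\<beta>. Mindex {#Idot \<beta>#})
      \<or> I \<in> range (\<lambda>\<beta>. Mindex {#Idot \<beta>, Idot \<beta>#}) then 1 else 0)"
  have ww: "ww $ Mindex {#} = 1" "ww $ Mindex {#Idot \<beta>#} = 1"
    "ww $ Mindex {#Idot \<alpha>, Idot \<beta>#} = (if \<alpha> = \<beta> then 1 else 0)" for \<alpha> \<beta>
    by (auto simp: ww_def)
  define \<gamma> where "\<gamma> s = e + s *\<^sub>R (0, ww)" for s
  have vh: "vhess (snd (\<gamma> s)) = vhess (snd e) + s *\<^sub>R mat 1" for s
    by (simp add: \<gamma>_def vec_eq_iff ww mat_def)
  obtain \<alpha> :: 'm where True by simp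
  have "{s. \<not> regular (\<gamma> s)} \<subseteq> {s. snd e $ Mindex {#} + s = 0} \<union> {s. snd e $ Mindex {#Idot \<alpha>#} + s = 0}
      \<union> {s. det (vhess (snd e) + s *\<^sub>R mat 1) = 0}"
    unfolding regular_def vh by (auto simp: \<gamma>_def ww vec_eq_iff)
  moreover have "{s. a + s = 0} = {- a}" for a :: real by auto
  ultimately have fin: "finite {s. \<not> regular (\<gamma> s)}"
    using finite_det_shift[of "vhess (snd e)"] by (auto elim: finite_subset)
  have "continuous_on UNIV \<gamma>" unfolding \<gamma>_def[abs_def] by (intro continuous_intros)
  then have "open (\<gamma> -` S)" using assms(1) by (simp add: open_vimage)
  moreover have "0 \<in> \<gamma> -` S" using assms(2) by (simp add: \<gamma>_def zero_prod_def[symmetric])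
  ultimately have "infinite (\<gamma> -` S)" using infinite_openin finite_imp_not_open by fastforce
  with fin have "\<not> \<gamma> -` S \<subseteq> {s. \<not> regular (\<gamma> s)}" using finite_subset by blast
  then show ?thesis by blast
qed

section \<open>Straightening the level sets of the invariant\<close>

text \<open>With \<open>q\<close> in place of \<open>p\<close> and \<open>I\<close> in place of the entry \<open>(\<alpha>, \<alpha>)\<close> of the vertical Hessian,
  which \<open>I z = q\<^sup>T H q\<close> determines where \<open>q\<^sub>\<alpha> \<noteq> 0\<close>, the level sets of \<open>I\<close> become affine.\<close>

definition straighten :: "'m \<Rightarrow> 'm::finite tidx jcoords \<Rightarrow> 'm tidx jcoords" where
  "straighten \<alpha> e = e + (\<Sum>\<beta>\<in>UNIV. (qvec e $ \<beta> - snd e $ Mindex {#Idot \<beta>#}) *\<^sub>R (0, axis (Mindex {#Idot \<beta>#}) 1))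
    + (Icoord e - snd e $ Mindex {#Idot \<alpha>, Idot \<alpha>#}) *\<^sub>R (0, axis (Mindex {#Idot \<alpha>, Idot \<alpha>#}) 1)"

text \<open>In straightened coordinates the diagonal entry at \<open>\<alpha>\<close> stores I. The
  defect d, to be added there to recover the Hessian, solves q . ((H + d E) q) = I z, with E the
  matrix unit at that entry and H the stored matrix; this needs only a nonzero component of q at
  \<open>\<alpha>\<close>.\<close>

definition hess_defect :: "'m \<Rightarrow> 'm::finite tidx jcoords \<Rightarrow> real" where
  "hess_defect \<alpha> v = (snd v $ Mindex {#Idot \<alpha>, Idot \<alpha>#} * snd v $ Mindex {#} - vgrad (snd v) \<bullet> (vhess (snd v) *v vgrad (snd v)))
    / (snd v $ Mindex {#Idot \<alpha>#} * snd v $ Mindex {#Idot \<alpha>#})"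

text \<open>This is p = H q, with H the recovered vertical Hessian.\<close>

definition pvec :: "'m \<Rightarrow> 'm::finite tidx jcoords \<Rightarrow> real ^ 'm" where
  "pvec \<alpha> v = vhess (snd v) *v vgrad (snd v) + (hess_defect \<alpha> v * snd v $ Mindex {#Idot \<alpha>#}) *\<^sub>R axis \<alpha> 1"

definition unstraighten :: "'m \<Rightarrow> 'm::finite tidx jcoords \<Rightarrow> 'm tidx jcoords" where
  "unstraighten \<alpha> v = v + (\<Sum>\<beta>\<in>UNIV. (pvec \<alpha> v $ \<beta> - snd v $ Mindex {#Idot \<beta>#}) *\<^sub>R (0, axis (Mindex {#Idot \<beta>#}) 1))
    + hess_defect \<alpha> v *\<^sub>R (0, axis (Mindex {#Idot \<alpha>, Idot \<alpha>#}) 1)"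

definition unit_mat :: "'m \<Rightarrow> real ^ 'm ^ ('m::finite)" where
  "unit_mat \<alpha> = (\<chi> i j. if i = \<alpha> \<and> j = \<alpha> then 1 else 0)"

lemma unit_mat_mult: "unit_mat \<alpha> *v v = (v $ \<alpha>) *\<^sub>R axis \<alpha> 1"
proof -
  have "(\<Sum>j\<in>UNIV. (if i = \<alpha> \<and> j = \<alpha> then 1 else 0) * v $ j) = (if i = \<alpha> then v $ \<alpha> else 0)" for i
    by (cases "i = \<alpha>") (simp_all add: if_distrib[of "\<lambda>x. x * _"] cong: if_cong)
  then show ?thesis by (simp add: vec_eq_iff matrix_vector_mult_def unit_mat_def axis_def)
qed

lemma add_axes_simps:
  fixes e :: "'m::finite tidx jcoords" and a :: "real ^ 'm" and b :: real and \<alpha> :: 'm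
  defines "f \<equiv> e + (\<Sum>\<beta>\<in>UNIV. (a $ \<beta> - snd e $ Mindex {#Idot \<beta>#}) *\<^sub>R (0, axis (Mindex {#Idot \<beta>#}) 1))
    + b *\<^sub>R (0, axis (Mindex {#Idot \<alpha>, Idot \<alpha>#}) 1)"
  shows "fst f = fst e" "snd f $ Mindex {#} = snd e $ Mindex {#}" "vgrad (snd f) = a"
    "vhess (snd f) = vhess (snd e) + b *\<^sub>R unit_mat \<alpha>"
    "snd f $ Mindex {#Idot \<alpha>, Idot \<alpha>#} = snd e $ Mindex {#Idot \<alpha>, Idot \<alpha>#} + b"
    "I \<notin> range (\<lambda>\<beta>. Mindex {#Idot \<beta>#}) \<Longrightarrow> I \<noteq> Mindex {#Idot \<alpha>, Idot \<alpha>#} \<Longrightarrow> snd f $ I = snd e $ I"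
proof -
  have snd: "snd f $ I = snd e $ I + (\<Sum>\<beta>\<in>UNIV. (a $ \<beta> - snd e $ Mindex {#Idot \<beta>#}) * axis (Mindex {#Idot \<beta>#}) 1 $ I)
      + b * axis (Mindex {#Idot \<alpha>, Idot \<alpha>#}) 1 $ I" for I
    by (simp add: f_def snd_sum)
  show "fst f = fst e" by (simp add: f_def fst_sum)
  show "snd f $ Mindex {#} = snd e $ Mindex {#}" by (simp add: snd axis_def)
  show "vgrad (snd f) = a"
    by (simp add: vec_eq_iff snd axis_def if_distrib[of "\<lambda>x. _ * x"] cong: if_cong)
  show "vhess (snd f) = vhess (snd e) + b *\<^sub>R unit_mat \<alpha>"
    by (auto simp: vec_eq_iff snd axis_def unit_mat_def)
  show "snd f $ Mindex {#Idot \<alpha>, Idot \<alpha>#} = snd e $ Mindex {#Idot \<alpha>, Idot \<alpha>#} + b"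
    by (simp add: snd axis_def)
  show "snd f $ I = snd e $ I" if "I \<notin> range (\<lambda>\<beta>. Mindex {#Idot \<beta>#})" "I \<noteq> Mindex {#Idot \<alpha>, Idot \<alpha>#}"
    using that by (auto simp: snd axis_def intro!: sum.neutral)
qed

lemma straighten_simps:
  "fst (straighten \<alpha> e) = fst e" "snd (straighten \<alpha> e) $ Mindex {#} = snd e $ Mindex {#}"
  "vgrad (snd (straighten \<alpha> e)) = qvec e"
  "vhess (snd (straighten \<alpha> e)) = vhess (snd e) + (Icoord e - snd e $ Mindex {#Idot \<alpha>, Idot \<alpha>#}) *\<^sub>R unit_mat \<alpha>"
  "snd (straighten \<alpha> e) $ Mindex {#Idot \<alpha>, Idot \<alpha>#} = Icoord e"
  unfolding straighten_def by (simp_all only: add_axes_simps(1-5))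

lemma straighten_nth_other:
  "I \<notin> range (\<lambda>\<beta>. Mindex {#Idot \<beta>#}) \<Longrightarrow> I \<noteq> Mindex {#Idot \<alpha>, Idot \<alpha>#} \<Longrightarrow> snd (straighten \<alpha> e) $ I = snd e $ I"
  unfolding straighten_def by (rule add_axes_simps(6))

lemma unstraighten_simps:
  "fst (unstraighten \<alpha> v) = fst v" "snd (unstraighten \<alpha> v) $ Mindex {#} = snd v $ Mindex {#}"
  "vgrad (snd (unstraighten \<alpha> v)) = pvec \<alpha> v"
  "vhess (snd (unstraighten \<alpha> v)) = vhess (snd v) + hess_defect \<alpha> v *\<^sub>R unit_mat \<alpha>"
  "snd (unstraighten \<alpha> v) $ Mindex {#Idot \<alpha>, Idot \<alpha>#} = snd v $ Mindex {#Idot \<alpha>, Idot \<alpha>#} + hess_defect \<alpha> v"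
  unfolding unstraighten_def by (simp_all only: add_axes_simps(1-5))

lemma unstraighten_nth_other:
  "I \<notin> range (\<lambda>\<beta>. Mindex {#Idot \<beta>#}) \<Longrightarrow> I \<noteq> Mindex {#Idot \<alpha>, Idot \<alpha>#} \<Longrightarrow> snd (unstraighten \<alpha> v) $ I = snd v $ I"
  unfolding unstraighten_def by (rule add_axes_simps(6))

lemma jcoords_eq_axes:
  fixes e f :: "'m::finite tidx jcoords"
  assumes "fst e = fst f" "vgrad (snd e) = vgrad (snd f)" "snd e $ Mindex {#Idot \<alpha>, Idot \<alpha>#} = snd f $ Mindex {#Idot \<alpha>, Idot \<alpha>#}"
    "\<And>I. I \<notin> range (\<lambda>\<beta>. Mindex {#Idot \<beta>#}) \<Longrightarrow> I \<noteq> Mindex {#Idot \<alpha>, Idot \<alpha>#} \<Longrightarrow> snd e $ I = snd f $ I"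
  shows "e = f"
proof (rule prod_eqI[OF assms(1)])
  have "snd e $ I = snd f $ I" for I
  proof (cases "I \<in> range (\<lambda>\<beta>. Mindex {#Idot \<beta>#})")
    case True
    then obtain \<beta> where "I = Mindex {#Idot \<beta>#}" by auto
    then show ?thesis using assms(2) by (metis vgrad_nth)
  qed (use assms(3,4) in metis)
  then show "snd e = snd f" by (simp add: vec_eq_iff)
qed

lemma pvec_eq: "vhess (snd (unstraighten \<alpha> v)) *v vgrad (snd v) = pvec \<alpha> v"
  by (simp add: unstraighten_simps pvec_def matrix_vector_mult_add_rdistrib scaleR_matrix_vector_assoc[symmetric] unit_mat_mult)

lemma unstraighten_straighten:
  assumes e: "regular e" and \<alpha>: "qvec e $ \<alpha> \<noteq> 0"
  shows "unstraighten \<alpha> (straighten \<alpha> e) = e"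
proof -
  let ?v = "straighten \<alpha> e" and ?q = "qvec e" and ?z = "snd e $ Mindex {#}"
    and ?d = "Icoord e - snd e $ Mindex {#Idot \<alpha>, Idot \<alpha>#}"
  have Hq: "vhess (snd e) *v ?q = vgrad (snd e)" using e by (simp add: vhess_qvec regular_def)
  have vq: "snd ?v $ Mindex {#Idot \<alpha>#} = ?q $ \<alpha>" using straighten_simps(3)[of \<alpha> e] by (metis vgrad_nth)
  have "vhess (snd ?v) *v ?q = vgrad (snd e) + (?d * ?q $ \<alpha>) *\<^sub>R axis \<alpha> 1"
    by (simp add: straighten_simps Hq matrix_vector_mult_add_rdistrib scaleR_matrix_vector_assoc[symmetric] unit_mat_mult)
  then have "?q \<bullet> (vhess (snd ?v) *v ?q) = vgrad (snd e) \<bullet> ?q + ?d * ?q $ \<alpha> * ?q $ \<alpha>"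
    by (simp add: inner_add_right inner_axis inner_commute)
  moreover have "Icoord e * ?z = vgrad (snd e) \<bullet> ?q" using e by (simp add: Icoord_def regular_def)
  ultimately have d: "hess_defect \<alpha> ?v = - ?d"
    using \<alpha> by (simp add: hess_defect_def straighten_simps vq field_simps)
  have H: "vhess (snd (unstraighten \<alpha> ?v)) = vhess (snd e)"
    unfolding unstraighten_simps d straighten_simps by (simp add: algebra_simps)
  then have p: "pvec \<alpha> ?v = vgrad (snd e)"
    using pvec_eq[of \<alpha> ?v] by (simp add: straighten_simps Hq)
  show ?thesis
  proof (rule jcoords_eq_axes[of _ _ \<alpha>])
    show "vgrad (snd (unstraighten \<alpha> ?v)) = vgrad (snd e)" by (simp only: unstraighten_simps p)
    show "snd (unstraighten \<alpha> ?v) $ Mindex {#Idot \<alpha>, Idot \<alpha>#} = snd e $ Mindex {#Idot \<alpha>, Idot \<alpha>#}"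
      by (simp add: unstraighten_simps straighten_simps d)
  qed (simp_all add: unstraighten_simps(1) straighten_simps(1) unstraighten_nth_other straighten_nth_other)
qed

lemma Icoord_unstraighten:
  assumes v: "regular (unstraighten \<alpha> v)" and \<alpha>: "snd v $ Mindex {#Idot \<alpha>#} \<noteq> 0"
  shows "qvec (unstraighten \<alpha> v) = vgrad (snd v)" "Icoord (unstraighten \<alpha> v) = snd v $ Mindex {#Idot \<alpha>, Idot \<alpha>#}"
proof -
  let ?e = "unstraighten \<alpha> v" and ?q = "vgrad (snd v)"
  have "?q = qvec ?e"
    using v pvec_eq[of \<alpha> v] by (subst qvec_iff[symmetric]) (simp_all add: regular_def unstraighten_simps)
  then show q: "qvec ?e = ?q" by simp
  have "pvec \<alpha> v \<bullet> ?q = ?q \<bullet> (vhess (snd v) *v ?q) + hess_defect \<alpha> v * snd v $ Mindex {#Idot \<alpha>#} * snd v $ Mindex {#Idot \<alpha>#}"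
    by (simp add: pvec_def inner_add_left inner_axis' inner_commute[of "vhess (snd v) *v vgrad (snd v)"])
  also have "\<dots> = snd v $ Mindex {#Idot \<alpha>, Idot \<alpha>#} * snd v $ Mindex {#}"
    using \<alpha> by (simp add: hess_defect_def)
  finally show "Icoord ?e = snd v $ Mindex {#Idot \<alpha>, Idot \<alpha>#}"
    using v by (simp add: Icoord_def q unstraighten_simps regular_def)
qed

lemma straighten_unstraighten:
  assumes v: "regular (unstraighten \<alpha> v)" and \<alpha>: "snd v $ Mindex {#Idot \<alpha>#} \<noteq> 0"
  shows "straighten \<alpha> (unstraighten \<alpha> v) = v"
  by (rule jcoords_eq_axes[of _ _ \<alpha>]) (simp_all add: straighten_simps unstraighten_simps
    straighten_nth_other unstraighten_nth_other Icoord_unstraighten[OF v \<alpha>])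

lemma smooth_on_unstraighten:
  fixes S :: "'m::finite tidx jcoords set"
  assumes S: "open S" "\<And>v. v \<in> S \<Longrightarrow> snd v $ Mindex {#Idot \<alpha>#} \<noteq> 0"
  shows "smooth_on S (unstraighten \<alpha>)"
proof -
  have d: "smooth_on S (hess_defect \<alpha>)"
    unfolding hess_defect_def[abs_def] inner_vec_def inner_real_def matrix_vector_mult_def vec_lambda_beta vgrad_nth vhess_nth
    by (intro smooth_on_divide smooth_on_diff smooth_on_mult smooth_on_sum smooth_on_jet_coord S(1)) (use S(2) in auto)
  have p: "smooth_on S (\<lambda>v. pvec \<alpha> v $ \<beta>)" for \<beta>
    unfolding pvec_def matrix_vector_mult_def vec_lambda_beta vgrad_nth vhess_nth vector_add_component vector_scaleR_component real_scaleR_def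
    by (intro smooth_on_add smooth_on_sum smooth_on_mult smooth_on_const smooth_on_jet_coord d S(1))
  show ?thesis
    unfolding unstraighten_def[abs_def]
    by (intro smooth_on_add smooth_on_sum smooth_on_scaleR smooth_on_diff smooth_on_const smooth_on_id p d smooth_on_jet_coord S(1))
qed

lemma continuous_on_straighten:
  assumes "open S" "\<And>e. e \<in> S \<Longrightarrow> regular e"
  shows "continuous_on S (straighten \<alpha>)"
  unfolding straighten_def[abs_def]
  by (rule smooth_on_imp_continuous_on)
    (intro smooth_on_add smooth_on_sum smooth_on_scaleR smooth_on_diff smooth_on_const smooth_on_id smooth_on_jet_coord
      smooth_on_Icoord smooth_on_vec_nth smooth_on_qvec assms)

text \<open>In the straightened coordinates, \<open>F\<close> is constant on the slices of a ball, which are convex.\<close>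

lemma function_of_Icoord:
  fixes e0 :: "'m::finite tidx jcoords"
  assumes G: "open G" "\<And>e. e \<in> G \<Longrightarrow> regular e" and e0: "e0 \<in> G"
  obtains U where "open U" "e0 \<in> U" "U \<subseteq> G"
    "\<forall>F. smooth_on U F \<longrightarrow>
       (\<forall>e\<in>U. \<forall>w. frechet_derivative Icoord (at e) w = 0 \<longrightarrow> frechet_derivative F (at e) w = 0) \<longrightarrow>
       (\<exists>S f. open S \<and> Icoord ` U \<subseteq> S \<and> smooth_on S (f :: real \<Rightarrow> real) \<and> (\<forall>e\<in>U. F e = f (Icoord e)))"
proof -
  obtain \<alpha> where \<alpha>: "qvec e0 $ \<alpha> \<noteq> 0" using qvec_nonzero[OF G(2)[OF e0]] by (auto simp: vec_eq_iff)
  let ?\<Phi> = "straighten \<alpha>" and ?\<Psi> = "unstraighten \<alpha>" and ?M = "Mindex {#Idot \<alpha>, Idot \<alpha>#}"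
  define v0 where "v0 = ?\<Phi> e0"
  define N where "N = {v :: 'm tidx jcoords. snd v $ Mindex {#Idot \<alpha>#} \<noteq> 0}"
  have N: "open N" unfolding N_def
    by (intro open_Collect_neq continuous_on_const smooth_on_imp_continuous_on[OF smooth_on_jet_coord[OF open_UNIV]])
  have \<Psi>: "smooth_on N ?\<Psi>" by (rule smooth_on_unstraighten[OF N]) (simp add: N_def)
  have "open (?\<Psi> -` G \<inter> N)"
    using smooth_on_imp_continuous_on[OF \<Psi>] N G(1) by (metis continuous_on_open_vimage)
  moreover have "v0 \<in> ?\<Psi> -` G \<inter> N"
    using unstraighten_straighten[OF G(2)[OF e0] \<alpha>] e0 \<alpha> straighten_simps(3)[of \<alpha> e0]
    by (simp add: v0_def N_def flip: vgrad_nth)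
  ultimately obtain \<epsilon> where \<epsilon>: "\<epsilon> > 0" "ball v0 \<epsilon> \<subseteq> ?\<Psi> -` G \<inter> N"
    using open_contains_ball by blast
  have ballN: "?\<Psi> v \<in> G" "snd v $ Mindex {#Idot \<alpha>#} \<noteq> 0" if "v \<in> ball v0 \<epsilon>" for v
    using that \<epsilon>(2) by (auto simp: N_def)
  have \<Phi>\<Psi>: "?\<Phi> (?\<Psi> v) = v" "Icoord (?\<Psi> v) = snd v $ ?M" "qvec (?\<Psi> v) $ \<alpha> \<noteq> 0" if "v \<in> ball v0 \<epsilon>" for v
    using straighten_unstraighten[OF G(2)] Icoord_unstraighten[OF G(2)] ballN[OF that] by auto
  \<comment> \<open>The condition on \<open>qvec\<close> keeps \<open>straighten\<close> injective,
    so that \<open>U\<close> corresponds exactly to the ball.\<close>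
  define U where "U = {e \<in> G. qvec e $ \<alpha> \<noteq> 0 \<and> ?\<Phi> e \<in> ball v0 \<epsilon>}"
  have U: "open U"
  proof -
    have "continuous_on G (\<lambda>e. (qvec e $ \<alpha>, ?\<Phi> e))"
      by (intro continuous_on_Pair continuous_on_straighten G
        smooth_on_imp_continuous_on[OF smooth_on_vec_nth[OF G(1) smooth_on_qvec[OF G]]])
    then have "open ((\<lambda>e. (qvec e $ \<alpha>, ?\<Phi> e)) -` ((- {0}) \<times> ball v0 \<epsilon>) \<inter> G)"
      using continuous_on_open_vimage[OF G(1)] open_Times[OF open_Compl[OF closed_singleton] open_ball] by blast
    moreover have "(\<lambda>e. (qvec e $ \<alpha>, ?\<Phi> e)) -` ((- {0}) \<times> ball v0 \<epsilon>) \<inter> G = U"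
      by (auto simp: U_def)
    ultimately show ?thesis by simp
  qed
  have \<Psi>U: "?\<Psi> v \<in> U" if "v \<in> ball v0 \<epsilon>" for v
    using ballN[OF that] \<Phi>\<Psi>[OF that] that by (simp add: U_def)
  show ?thesis
  proof (rule that[OF U])
    show "e0 \<in> U" using e0 \<alpha> \<epsilon>(1) by (simp add: U_def v0_def)
    show "U \<subseteq> G" by (auto simp: U_def)
    show "\<forall>F. smooth_on U F \<longrightarrow>
       (\<forall>e\<in>U. \<forall>w. frechet_derivative Icoord (at e) w = 0 \<longrightarrow> frechet_derivative F (at e) w = 0) \<longrightarrow>
       (\<exists>S f. open S \<and> Icoord ` U \<subseteq> S \<and> smooth_on S (f :: real \<Rightarrow> real) \<and> (\<forall>e\<in>U. F e = f (Icoord e)))"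
    proof (intro allI impI)
      fix F :: "'m tidx jcoords \<Rightarrow> real"
      assume F: "smooth_on U F"
        and "\<forall>e\<in>U. \<forall>w. frechet_derivative Icoord (at e) w = 0 \<longrightarrow> frechet_derivative F (at e) w = 0"
      then have inv: "frechet_derivative F (at e) w = 0"
        if "e \<in> U" "frechet_derivative Icoord (at e) w = 0" for e w using that by blast
      define r0 where "r0 = snd v0 $ ?M"
      \<comment> \<open>The line through the centre of the ball along the coordinate I. The sought
        function \<open>f\<close> is \<open>F\<close> read along this line.\<close>
      define shift where "shift = (\<lambda>r. v0 + (r - r0) *\<^sub>R (0 :: real ^ 'm tidx, axis ?M 1 :: real ^ 'm tidx mindex))"
      have l_ball: "shift r \<in> ball v0 \<epsilon>" if "r \<in> ball r0 \<epsilon>" for r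
      proof -
        have "dist v0 (shift r) = \<bar>r - r0\<bar>" by (simp add: shift_def dist_norm norm_Pair norm_axis_1)
        then show ?thesis using that by (simp add: dist_real_def abs_minus_commute)
      qed
      have l_M: "snd (shift r) $ ?M = r" for r by (simp add: shift_def r0_def)
      define f where "f = (\<lambda>r. F (?\<Psi> (shift r)))"
      have "smooth_on (ball r0 \<epsilon>) shift"
        unfolding shift_def by (intro smooth_intros) auto
      then have "smooth_on (ball r0 \<epsilon>) (\<lambda>r. ?\<Psi> (shift r))"
        by (rule smooth_on_compose[OF open_ball N \<Psi>]) (use l_ball \<epsilon>(2) in blast)
      then have f: "smooth_on (ball r0 \<epsilon>) f"
        unfolding f_def by (rule smooth_on_compose[OF open_ball U F]) (use l_ball \<Psi>U in blast)
      have r_ball: "Icoord e \<in> ball r0 \<epsilon>" if "e \<in> U" for e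
      proof -
        have "dist (snd v0 $ ?M) (snd (?\<Phi> e) $ ?M) \<le> dist v0 (?\<Phi> e)"
          by (rule order_trans[OF dist_vec_nth_le dist_snd_le])
        then show ?thesis using that by (simp add: U_def r0_def straighten_simps)
      qed
      have "F e = f (Icoord e)" if e: "e \<in> U" for e
      proof -
        define v1 where "v1 = ?\<Phi> e"
        define v2 where "v2 = shift (Icoord e)"
        have v1: "v1 \<in> ball v0 \<epsilon>" using e by (simp add: U_def v1_def)
        have v2: "v2 \<in> ball v0 \<epsilon>" unfolding v2_def by (rule l_ball[OF r_ball[OF e]])
        \<comment> \<open>The segment from the image of \<open>e\<close> to the point of that line
          with the same I-value. It stays in the ball by convexity and I is constant on it, so dI
          kills its velocity and hence so does dF.\<close>
        define \<gamma> where "\<gamma> = (\<lambda>s::real. v1 + s *\<^sub>R (v2 - v1))"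
        have M: "snd (\<gamma> s) $ ?M = Icoord e" for s
          by (simp add: \<gamma>_def v1_def v2_def l_M straighten_simps)
        define T where "T = {0..1::real}"
        have \<gamma>T: "\<gamma> s \<in> ball v0 \<epsilon>" if "s \<in> T" for s
        proof -
          have "\<gamma> s = (1 - s) *\<^sub>R v1 + s *\<^sub>R v2" by (simp add: \<gamma>_def algebra_simps)
          then show ?thesis using that convexD_alt[OF convex_ball v1 v2, of s] by (simp add: T_def)
        qed
        have "\<exists>c. \<forall>s\<in>T. F (?\<Psi> (\<gamma> s)) = c"
        proof (rule has_derivative_zero_constant)
          show "convex T" by (simp add: T_def)
          fix s assume s: "s \<in> T"
          let ?e = "?\<Psi> (\<gamma> s)"
          have eU: "?e \<in> U" using \<Psi>U \<gamma>T s by blast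
          have "\<gamma> s \<in> N" using ballN(2)[OF \<gamma>T[OF s]] by (simp add: N_def)
          then have "(?\<Psi> has_derivative frechet_derivative ?\<Psi> (at (\<gamma> s))) (at (\<gamma> s))"
            by (rule smooth_on_has_derivative[OF \<Psi>])
          moreover have "(\<gamma> has_derivative (\<lambda>h. h *\<^sub>R (v2 - v1))) (at s)"
            unfolding \<gamma>_def by (auto intro!: derivative_eq_intros)
          ultimately have "((\<lambda>s. ?\<Psi> (\<gamma> s)) has_derivative (\<lambda>h. frechet_derivative ?\<Psi> (at (\<gamma> s)) (h *\<^sub>R (v2 - v1)))) (at s)"
            by (rule has_derivative_compose[rotated])
          then obtain D where D: "((\<lambda>s. ?\<Psi> (\<gamma> s)) has_derivative D) (at s)" by blast
          have reg: "regular ?e" using eU G(2) by (auto simp: U_def)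
          have "(Icoord has_derivative frechet_derivative Icoord (at ?e)) (at ?e)"
            using Icoord_has_derivative[OF reg] frechet_derivative_at by metis
          from has_derivative_compose[OF D this]
          have "((\<lambda>s. Icoord (?\<Psi> (\<gamma> s))) has_derivative (\<lambda>h. frechet_derivative Icoord (at ?e) (D h))) (at s)" .
          moreover have "((\<lambda>s. Icoord (?\<Psi> (\<gamma> s))) has_derivative (\<lambda>h. 0)) (at s)"
          proof (rule has_derivative_transform_within_open[OF has_derivative_const])
            have "continuous_on UNIV \<gamma>" unfolding \<gamma>_def by (intro continuous_intros)
            then show "open (\<gamma> -` ball v0 \<epsilon>)" by (simp add: open_vimage)
            show "s \<in> \<gamma> -` ball v0 \<epsilon>" using \<gamma>T[OF s] by simp
            show "Icoord e = Icoord (?\<Psi> (\<gamma> s))" if "s \<in> \<gamma> -` ball v0 \<epsilon>" for s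
              using \<Phi>\<Psi>(2)[of "\<gamma> s"] that M by simp
          qed
          ultimately have "frechet_derivative Icoord (at ?e) (D h) = 0" for h
            using has_derivative_unique by metis
          then have "frechet_derivative F (at ?e) (D h) = 0" for h by (rule inv[OF eU])
          moreover have "((\<lambda>s. F (?\<Psi> (\<gamma> s))) has_derivative (\<lambda>h. frechet_derivative F (at ?e) (D h))) (at s)"
            by (rule has_derivative_compose[OF D smooth_on_has_derivative[OF F eU]])
          ultimately have "((\<lambda>s. F (?\<Psi> (\<gamma> s))) has_derivative (\<lambda>h. 0)) (at s)" by simp
          then show "((\<lambda>s. F (?\<Psi> (\<gamma> s))) has_derivative (\<lambda>h. 0)) (at s within T)"
            by (rule has_derivative_at_withinI)
        qed
        then have "F (?\<Psi> (\<gamma> 0)) = F (?\<Psi> (\<gamma> 1))" by (auto simp: T_def)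
        moreover have "?\<Psi> (\<gamma> 0) = e"
          using unstraighten_straighten[of e \<alpha>] e G(2) by (simp add: \<gamma>_def v1_def U_def)
        ultimately show ?thesis by (simp add: \<gamma>_def v2_def f_def)
      qed
      with f r_ball show "\<exists>S f. open S \<and> Icoord ` U \<subseteq> S \<and> smooth_on S (f :: real \<Rightarrow> real) \<and> (\<forall>e\<in>U. F e = f (Icoord e))"
        by (intro exI[of _ "ball r0 \<epsilon>"] exI[of _ f]) auto
    qed
  qed
qed

section \<open>Change of charts\<close>

lemma matrix_inv_right: "invertible B \<Longrightarrow> B ** matrix_inv B = mat 1"
  unfolding invertible_def matrix_inv_def by (drule someI_ex) blast

lemma bilinear_form_matrix:
  fixes N :: "real ^ 'm ^ 'm"
  assumes "p' = transpose N *v p" "H' = transpose N ** H ** N"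
  shows "p' \<bullet> v = p \<bullet> (N *v v)" "v \<bullet> (H' *v w) = (N *v v) \<bullet> (H *v (N *v w))"
proof -
  show "p' \<bullet> v = p \<bullet> (N *v v)"
    unfolding assms(1) transpose_matrix_vector by (rule dot_lmul_matrix)
  have "v \<bullet> (transpose N *v a) = (N *v v) \<bullet> a" for a
    unfolding transpose_matrix_vector inner_commute[of v] dot_lmul_matrix by (rule inner_commute)
  then show "v \<bullet> (H' *v w) = (N *v v) \<bullet> (H *v (N *v w))"
    unfolding assms(2) by (simp add: matrix_vector_mul_assoc[symmetric])
qed

context smfd
begin

abbreviation J2dom :: "('a, real ^ 'm) chart \<Rightarrow> 'a jet1 jet2 set" where
  "J2dom c \<equiv> fst (J2_chart A c)"

abbreviation J2co :: "('a, real ^ 'm) chart \<Rightarrow> 'a jet1 jet2 \<Rightarrow> 'm tidx jcoords" where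
  "J2co c \<equiv> snd (J2_chart A c)"

lemma J1_chart_in_atlas: "c \<in> A \<Longrightarrow> J1_chart A c \<in> J1_atlas A"
  by (simp add: J1_atlas_def)

lemma J2_atlas_eq: "J2_atlas A = jet2_chart (J1_atlas A) ` J1_atlas A"
  by (simp add: J2_atlas_def J2_chart_def J1_atlas_def image_image)

sublocale J2: cont_atlas "J2_atlas A"
  unfolding J2_atlas_eq by (rule J1.jet2_cont_atlas)

lemma J2_chart_in_atlas: "c \<in> A \<Longrightarrow> J2_chart A c \<in> J2_atlas A"
  by (simp add: J2_atlas_def)

lemma J2_chart_image: "c \<in> A \<Longrightarrow> J2co c ` J2dom c = {t. tpos t \<in> snd c ` fst c} \<times> UNIV"
  unfolding J2_chart_def using J1.jet2_chart_image[OF J1_chart_in_atlas] J1_chart_image by simp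

lemma J2co_tpos: "c \<in> A \<Longrightarrow> \<zeta> \<in> J2dom c \<Longrightarrow> tpos (fst (J2co c \<zeta>)) \<in> snd c ` fst c"
  using J2_chart_image[of c] by (metis (no_types, lifting) imageI mem_Collect_eq mem_Sigma_iff prod.collapse)

lemma J2_in_some_chart: "\<zeta> \<in> carrier_of (J2_atlas A) \<Longrightarrow> \<exists>c\<in>A. \<zeta> \<in> J2dom c"
  by (auto simp: carrier_of_def J2_atlas_def)

lemma J2_carrier: "J2 A = carrier_of (J2_atlas A)"
proof
  show "carrier_of (J2_atlas A) \<subseteq> J2 A"
    by (auto simp: J2_def carrier_of_def J2_atlas_def J2_chart_def jet2_chart_def)
  show "J2 A \<subseteq> carrier_of (J2_atlas A)"
  proof
    fix \<zeta> assume "\<zeta> \<in> J2 A"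
    then obtain a L C where "\<zeta> = jet2 (J1_atlas A) a L" "smooth_near (J1_atlas A) a L" "C \<in> J1_atlas A" "a \<in> fst C"
      unfolding J2_def jets2_def carrier_of_def by blast
    then have "\<zeta> \<in> fst (jet2_chart (J1_atlas A) C)" using J1.jet2_in_chart_iff by blast
    with \<open>C \<in> J1_atlas A\<close> show "\<zeta> \<in> carrier_of (J2_atlas A)"
      unfolding J2_atlas_eq carrier_of_def by blast
  qed
qed

lemma J2_value: "c \<in> A \<Longrightarrow> \<zeta> \<in> J2dom c \<Longrightarrow> jet2_value \<zeta> = snd (J2co c \<zeta>) $ Mindex {#}"
  unfolding J2_chart_def by (rule J1.jet2_value_coords[OF J1_chart_in_atlas])

lemma Hess_matrix_eq: "Hess_matrix A c \<zeta> = vhess (snd (J2co c \<zeta>))"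
  by (simp add: Hess_matrix_def zcoord_def vhess_def)

text \<open>Here \<open>N\<close> is the tangent map of the transition from \<open>d\<close> to
  \<open>c\<close>. It depends on the position only and acts linearly on velocities, so the
  second-derivative terms of the chain rule vanish in vertical directions.\<close>

lemma J2_change:
  assumes c: "c \<in> A" and d: "d \<in> A" and \<zeta>: "\<zeta> \<in> J2dom c" "\<zeta> \<in> J2dom d"
  obtains N where "\<And>w. \<exists>v. N *v v = w" "\<And>v. N *v v = 0 \<Longrightarrow> v = 0"
    "snd (J2co d \<zeta>) $ Mindex {#} = snd (J2co c \<zeta>) $ Mindex {#}"
    "vgrad (snd (J2co d \<zeta>)) = transpose N *v vgrad (snd (J2co c \<zeta>))"
    "vhess (snd (J2co d \<zeta>)) = transpose N ** vhess (snd (J2co c \<zeta>)) ** N"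
proof -
  let ?C = "J1_chart A c" and ?D = "J1_chart A d"
  note CB = J1_chart_in_atlas[OF c] and DB = J1_chart_in_atlas[OF d]
  obtain a L where L: "\<zeta> = jet2 (J1_atlas A) a L" "smooth_near (J1_atlas A) a L" "a \<in> fst ?C"
    and co_c: "J2co c \<zeta> = J1.jcoord ?C L a"
    using J1.jet2_chartE[OF \<zeta>(1)[unfolded J2_chart_def] CB] unfolding J2_chart_def by metis
  have aD: "a \<in> fst ?D"
    using \<zeta>(2) J1.jet2_in_chart_iff[OF L(2) DB] unfolding L(1) J2_chart_def by simp
  have co_d: "J2co d \<zeta> = J1.jcoord ?D L a"
    unfolding L(1) J2_chart_def by (rule J1.jet2_coords[OF L(2) DB aD])
  define \<tau> where "\<tau> = snd ?C \<circ> chart_inv ?D"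
  define s where "s = snd ?D a"
  note ch = J1.jcoord_change[OF L(2) CB DB L(3) aD, folded \<tau>_def s_def co_c co_d]
  let ?Y = "snd d ` (fst d \<inter> fst c)"
  let ?S = "{t :: real ^ 'm tidx. tpos t \<in> ?Y}"
  have S: "open ?S" by (rule open_tpos_vimage[OF base.overlap_open[OF d c]])
  have sS: "s \<in> ?S"
    using J1_overlap_image[OF d c] L(3) aD unfolding s_def by blast
  have \<tau>_eq: "\<tau> t = J1_trans d c t" if "t \<in> ?S" for t
    unfolding \<tau>_def using J1_trans_eq[OF d c] that by simp
  define D where "D = (\<lambda>t. frechet_derivative (snd c \<circ> chart_inv d) (at (tpos t)) :: real ^ 'm \<Rightarrow> real ^ 'm)"
  have D: "linear (D t)" if "t \<in> ?S" for t
    unfolding D_def using that by (intro has_derivative_linear[OF base.trans_has_derivative[OF d c]]) simp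
  define K where "K = (\<lambda>t. matrix (D t))"
  have K: "K t $ \<gamma> $ \<beta> = D t (axis \<beta> 1) $ \<gamma>" for t \<gamma> \<beta> by (simp add: K_def matrix_def)
  have pd1: "pd (Idot \<beta>) (\<lambda>x. \<tau> x $ Ix) t = 0" "pd (Idot \<beta>) (\<lambda>x. \<tau> x $ Iy \<gamma>) t = 0" if "t \<in> ?S" for t \<beta> \<gamma>
  proof -
    have 1: "pd (Idot \<beta>) (\<lambda>x. \<tau> x $ i) t = pd (Idot \<beta>) (\<lambda>x. J1_trans d c x $ i) t" for i
      by (rule pd_cong[OF S that]) (simp add: \<tau>_eq)
    show "pd (Idot \<beta>) (\<lambda>x. \<tau> x $ Ix) t = 0" "pd (Idot \<beta>) (\<lambda>x. \<tau> x $ Iy \<gamma>) t = 0"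
      unfolding 1 by (rule pd_indep, simp add: J1_trans_def)+
  qed
  have pd2: "pd (Idot \<beta>) (\<lambda>x. \<tau> x $ Idot \<gamma>) t = K t $ \<gamma> $ \<beta>" if t: "t \<in> ?S" for t \<beta> \<gamma>
  proof -
    have "pd (Idot \<beta>) (\<lambda>x. \<tau> x $ Idot \<gamma>) t = pd (Idot \<beta>) (\<lambda>x. J1_trans d c x $ Idot \<gamma>) t"
      by (rule pd_cong[OF S t]) (simp add: \<tau>_eq)
    also have "\<dots> = K t $ \<gamma> $ \<beta>"
    proof -
      have "J1_trans d c (vec_upd t (Idot \<beta>) r) $ Idot \<gamma> = D t (tdot t) $ \<gamma> + (r - t $ Idot \<beta>) * K t $ \<gamma> $ \<beta>" for r
      proof -
        have "tdot (vec_upd t (Idot \<beta>) r) = tdot t + (r - t $ Idot \<beta>) *\<^sub>R axis \<beta> 1"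
          by (auto simp: vec_upd_def vec_eq_iff axis_def)
        moreover have "D t (tdot t + (r - t $ Idot \<beta>) *\<^sub>R axis \<beta> 1) = D t (tdot t) + (r - t $ Idot \<beta>) *\<^sub>R D t (axis \<beta> 1)"
          by (simp only: linear_add[OF D[OF t]] linear_scale[OF D[OF t]])
        ultimately show ?thesis by (simp add: J1_trans_def D_def[symmetric] K) (simp add: D_def)
      qed
      moreover have "((\<lambda>r. D t (tdot t) $ \<gamma> + (r - t $ Idot \<beta>) * K t $ \<gamma> $ \<beta>) has_field_derivative K t $ \<gamma> $ \<beta>) (at (t $ Idot \<beta>))"
        by (auto intro!: derivative_eq_intros)
      ultimately show ?thesis unfolding pd_def by (simp add: DERIV_imp_deriv)
    qed
    finally show ?thesis .
  qed
  have pd11: "pd (Idot \<alpha>) (pd (Idot \<beta>) (\<lambda>x. \<tau> x $ k)) s = 0" for \<alpha> \<beta> k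
  proof (cases k)
    case Ix
    have "pd (Idot \<alpha>) (pd (Idot \<beta>) (\<lambda>x. \<tau> x $ Ix)) s = pd (Idot \<alpha>) (\<lambda>x. 0) s"
      by (rule pd_cong[OF S sS pd1(1)])
    then show ?thesis by (simp add: Ix)
  next
    case (Iy \<gamma>)
    have "pd (Idot \<alpha>) (pd (Idot \<beta>) (\<lambda>x. \<tau> x $ Iy \<gamma>)) s = pd (Idot \<alpha>) (\<lambda>x. 0) s"
      by (rule pd_cong[OF S sS pd1(2)])
    then show ?thesis by (simp add: Iy)
  next
    case (Idot \<gamma>)
    have "pd (Idot \<alpha>) (pd (Idot \<beta>) (\<lambda>x. \<tau> x $ Idot \<gamma>)) s = pd (Idot \<alpha>) (\<lambda>x. K x $ \<gamma> $ \<beta>) s"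
      by (rule pd_cong[OF S sS pd2])
    also have "\<dots> = 0" by (rule pd_indep) (simp add: K D_def)
    finally show ?thesis by (simp add: Idot)
  qed
  have KD: "K s *v v = D s v" for v
    unfolding K_def by (rule fun_cong[OF matrix_vector_mul(2)[OF D[OF sS]]])
  obtain y where y: "y \<in> fst d" "y \<in> fst c" "tpos s = snd d y" using sS by auto
  have "D s (frechet_derivative (snd d \<circ> chart_inv c) (at (snd c y)) w) = w" for w
    using base.trans_frechet_compose[OF c d c y(2,1,2), of w] base.trans_frechet_same[OF c y(2), of w]
    by (simp add: D_def y(3))
  then have surj: "\<exists>v. K s *v v = w" for w unfolding KD by blast
  have inj: "v = 0" if "K s *v v = 0" for v
  proof -
    have "frechet_derivative (snd d \<circ> chart_inv c) (at (snd c y)) (D s v) = v"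
      using base.trans_frechet_compose[OF d c d y(1,2,1), of v] base.trans_frechet_same[OF d y(1), of v]
      by (simp add: D_def y(3))
    moreover have "frechet_derivative (snd d \<circ> chart_inv c) (at (snd c y)) 0 = 0"
      by (rule linear_0[OF has_derivative_linear[OF base.trans_has_derivative[OF c d]]]) (use y in auto)
    ultimately show ?thesis using that unfolding KD by simp
  qed
  show ?thesis
  proof (rule that[OF surj inj])
    show "snd (J2co d \<zeta>) $ Mindex {#} = snd (J2co c \<zeta>) $ Mindex {#}" by (rule ch(1))
    have "vgrad (snd (J2co d \<zeta>)) $ \<beta> = (transpose (K s) *v vgrad (snd (J2co c \<zeta>))) $ \<beta>" for \<beta>
      by (simp add: ch(2) sum_tidx pd1[OF sS] pd2[OF sS] matrix_vector_mult_def transpose_def mult.commute)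
    then show "vgrad (snd (J2co d \<zeta>)) = transpose (K s) *v vgrad (snd (J2co c \<zeta>))"
      by (simp only: vec_eq_iff) blast
    have "vhess (snd (J2co d \<zeta>)) $ \<alpha> $ \<beta> = (transpose (K s) ** vhess (snd (J2co c \<zeta>)) ** K s) $ \<alpha> $ \<beta>" for \<alpha> \<beta>
      by (simp add: ch(3) sum_tidx pd1[OF sS] pd2[OF sS] pd11 matrix_matrix_mult_def transpose_def mult.commute)
    then show "vhess (snd (J2co d \<zeta>)) = transpose (K s) ** vhess (snd (J2co c \<zeta>)) ** K s"
      by (simp only: vec_eq_iff) blast
  qed
qed

text \<open>As \<open>N\<close> is onto, a vector is determined by its pairings with all
  \<open>N *v v\<close>. This identifies \<open>N *v qvec (J2co d \<zeta>)\<close> as the solution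
  of H q = p in \<open>c\<close>, and p . q is unchanged.\<close>

lemma regular_change:
  assumes "c \<in> A" "d \<in> A" "\<zeta> \<in> J2dom c" "\<zeta> \<in> J2dom d" and reg: "regular (J2co c \<zeta>)"
  shows "regular (J2co d \<zeta>)" "Icoord (J2co d \<zeta>) = Icoord (J2co c \<zeta>)"
proof -
  obtain N where N: "\<And>w. \<exists>v. N *v v = w" "\<And>v. N *v v = 0 \<Longrightarrow> v = 0"
    and z: "snd (J2co d \<zeta>) $ Mindex {#} = snd (J2co c \<zeta>) $ Mindex {#}"
    and p: "vgrad (snd (J2co d \<zeta>)) = transpose N *v vgrad (snd (J2co c \<zeta>))"
    and H: "vhess (snd (J2co d \<zeta>)) = transpose N ** vhess (snd (J2co c \<zeta>)) ** N"
    by (rule J2_change[OF assms(1-4)]) (rule that; assumption)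
  let ?pc = "vgrad (snd (J2co c \<zeta>))" and ?pd = "vgrad (snd (J2co d \<zeta>))"
  let ?Hc = "vhess (snd (J2co c \<zeta>))" and ?Hd = "vhess (snd (J2co d \<zeta>))"
  note bp = bilinear_form_matrix(1)[OF p H] and bH = bilinear_form_matrix(2)[OF p H]
  have detc: "det ?Hc \<noteq> 0" using reg by (simp add: regular_def)
  have eqI: "a = b" if "\<And>v. (N *v v) \<bullet> a = (N *v v) \<bullet> b" for a b :: "real ^ 'm"
  proof -
    obtain v where "N *v v = a - b" using N(1) by blast
    with that[of v] have "(a - b) \<bullet> (a - b) = 0" by (simp add: inner_diff_right)
    then show ?thesis by simp
  qed
  have "v = 0" if "?Hd *v v = 0" for v
  proof -
    have "?Hc *v (N *v v) = 0" by (rule eqI) (simp add: bH[symmetric] that)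
    then show ?thesis using det_vhess_inj[OF detc] N(2) by blast
  qed
  then have detd: "det ?Hd \<noteq> 0"
    by (metis invertible_det_nz invertible_left_inverse matrix_left_invertible_ker)
  have "?pd \<noteq> 0"
  proof
    assume "?pd = 0"
    then have "(N *v v) \<bullet> ?pc = 0" for v using bp[of v] by (simp add: inner_commute)
    then have "?pc = 0" by (intro eqI) simp
    then show False using reg by (simp add: regular_def)
  qed
  then show "regular (J2co d \<zeta>)" using reg detd z by (simp add: regular_def)
  have "?Hc *v (N *v qvec (J2co d \<zeta>)) = ?pc"
    by (rule eqI) (simp add: bH[symmetric] vhess_qvec[OF detd] inner_commute[of _ ?pc] inner_commute[of _ ?pd] bp)
  then have "N *v qvec (J2co d \<zeta>) = qvec (J2co c \<zeta>)" using qvec_iff[OF detc] by blast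
  then show "Icoord (J2co d \<zeta>) = Icoord (J2co c \<zeta>)" by (simp add: Icoord_def z bp)
qed

section \<open>Regular jets and the invariant on them\<close>

definition regular_jets :: "'a jet1 jet2 set" where
  "regular_jets = {\<zeta> \<in> J2 A. \<forall>c\<in>A. \<zeta> \<in> J2dom c \<longrightarrow> regular (J2co c \<zeta>)}"

lemma regular_jets_iff:
  assumes "c \<in> A" "\<zeta> \<in> J2dom c"
  shows "\<zeta> \<in> regular_jets \<longleftrightarrow> regular (J2co c \<zeta>)"
proof
  show "regular (J2co c \<zeta>)" if "\<zeta> \<in> regular_jets"
    using that assms by (simp add: regular_jets_def)
  assume reg: "regular (J2co c \<zeta>)"
  have "\<zeta> \<in> J2 A" using assms(2) by (simp add: J2_def J2_chart_def jet2_chart_def)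
  moreover have "regular (J2co d \<zeta>)" if "d \<in> A" "\<zeta> \<in> J2dom d" for d
    by (rule regular_change(1)[OF assms(1) that(1) assms(2) that(2) reg])
  ultimately show "\<zeta> \<in> regular_jets" by (simp add: regular_jets_def)
qed

lemma regular_jets_image:
  assumes "c \<in> A"
  shows "J2co c ` (regular_jets \<inter> J2dom c) = {t. tpos t \<in> snd c ` fst c} \<times> UNIV \<inter> {e. regular e}"
proof -
  have "J2co c ` (regular_jets \<inter> J2dom c) = J2co c ` {\<zeta> \<in> J2dom c. regular (J2co c \<zeta>)}"
    using regular_jets_iff[OF assms] by (intro arg_cong[of _ _ "image (J2co c)"]) auto
  then show ?thesis unfolding J2_chart_image[OF assms, symmetric] by auto
qed

lemma open_regular_image:
  assumes "c \<in> A"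
  shows "open ({t. tpos t \<in> snd c ` fst c} \<times> UNIV \<inter> {e :: 'm tidx jcoords. regular e})"
  by (intro open_Int open_Times open_tpos_vimage base.chart_open[OF assms] open_UNIV open_regular)

text \<open>\<open>Vfun\<close> evaluates in an arbitrarily chosen chart; there it is p . (inverse
  of H applied to p), and \<open>regular_change\<close> transfers the value to
  \<open>c\<close>.\<close>

lemma Ifun_eq_Icoord:
  assumes c: "c \<in> A" and \<zeta>: "\<zeta> \<in> J2dom c" and reg: "\<zeta> \<in> regular_jets"
  shows "Ifun A \<zeta> = Icoord (J2co c \<zeta>)"
proof -
  define d where "d = (SOME d. d \<in> A \<and> \<zeta> \<in> J2dom d)"
  have d: "d \<in> A" "\<zeta> \<in> J2dom d"
    using someI[of "\<lambda>d. d \<in> A \<and> \<zeta> \<in> J2dom d" c] c \<zeta> by (auto simp: d_def)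
  let ?H = "vhess (snd (J2co d \<zeta>))" and ?p = "vgrad (snd (J2co d \<zeta>))"
  have regd: "regular (J2co d \<zeta>)" using regular_jets_iff[OF d] reg by blast
  then have det: "det ?H \<noteq> 0" by (simp add: regular_def)
  then have "?H *v (matrix_inv ?H *v ?p) = ?p"
    by (simp add: matrix_vector_mul_assoc matrix_inv_right invertible_det_nz)
  then have q: "matrix_inv ?H *v ?p = qvec (J2co d \<zeta>)" using qvec_iff[OF det] by blast
  have "Vfun A \<zeta> = ?p \<bullet> (matrix_inv ?H *v ?p)"
    unfolding Vfun_def d_def[symmetric] Let_def Hess_matrix_eq zcoord_def
    by (simp add: inner_vec_def matrix_vector_mult_def sum_distrib_left mult_ac)
  then have "Ifun A \<zeta> = Icoord (J2co d \<zeta>)"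
    by (simp add: Ifun_def Icoord_def q J2_value[OF d])
  then show ?thesis using regular_change(2)[OF d(1) c d(2) \<zeta> regd] by simp
qed

lemma Ifun_chart:
  assumes c: "c \<in> A" and e: "e \<in> {t. tpos t \<in> snd c ` fst c} \<times> UNIV \<inter> {e. regular e}"
  shows "(Ifun A \<circ> chart_inv (J2_chart A c)) e = Icoord e"
proof -
  obtain \<zeta> where "\<zeta> \<in> regular_jets" "\<zeta> \<in> J2dom c" "e = J2co c \<zeta>"
    using e unfolding regular_jets_image[OF c, symmetric] by blast
  then show ?thesis using Ifun_eq_Icoord[OF c] J2.chart_inv_left[OF J2_chart_in_atlas[OF c]] by simp
qed

lemma chart_diff_Ifun:
  assumes c: "c \<in> A" and \<zeta>: "\<zeta> \<in> J2dom c" "\<zeta> \<in> regular_jets"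
  shows "chart_diff (J2_chart A c) (Ifun A) \<zeta> w = frechet_derivative Icoord (at (J2co c \<zeta>)) w"
proof -
  have reg: "regular (J2co c \<zeta>)" using regular_jets_iff[OF c \<zeta>(1)] \<zeta>(2) by blast
  have "Icoord differentiable (at (J2co c \<zeta>))"
    using Icoord_has_derivative[OF reg] by (auto simp: differentiable_def)
  moreover have "J2co c \<zeta> \<in> {t. tpos t \<in> snd c ` fst c} \<times> UNIV \<inter> {e. regular e}"
    using regular_jets_image[OF c] \<zeta> by blast
  ultimately show ?thesis
    unfolding chart_diff_def
    using frechet_derivative_transform_within_open[OF _ open_regular_image[OF c], of Icoord "J2co c \<zeta>"] Ifun_chart[OF c]
    by metis
qed

lemma lift2_eq: "lift2 A X c \<zeta> = prolong2 (lift1_xi X c) (lift1_eta X c) (fst (J2co c \<zeta>), snd (J2co c \<zeta>))"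
  by (simp add: lift2_def)

text \<open>On the vertical components from \<open>prolong2_vertical\<close>, the gradient terms in
  K cancel against those of the Hessian. The rest is -u' (q . p) from the Hessian and +u' (p . q)
  from z.\<close>

lemma dI_form_lift2:
  assumes X: "p_projectable A X" and c: "c \<in> A" and \<zeta>: "\<zeta> \<in> J2dom c" and reg: "regular (J2co c \<zeta>)"
  defines "e \<equiv> J2co c \<zeta>"
  shows "dI_form (qvec e) (vgrad (snd e) \<bullet> qvec e / snd e $ Mindex {#}) (snd (lift2 A X c \<zeta>)) = 0"
proof -
  let ?q = "qvec e" and ?p = "vgrad (snd e)" and ?H = "vhess (snd e)" and ?l = "snd (lift2 A X c \<zeta>)"
  obtain u' N where z: "?l $ Mindex {#} = - u' * snd e $ Mindex {#}"
    and p: "\<And>\<beta>. ?l $ Mindex {#Idot \<beta>#} = - (\<Sum>\<gamma>\<in>UNIV. N \<gamma> \<beta> * snd e $ Mindex {#Idot \<gamma>#})"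
    and H: "\<And>\<alpha> \<beta>. ?l $ Mindex {#Idot \<alpha>, Idot \<beta>#} = u' * snd e $ Mindex {#Idot \<alpha>, Idot \<beta>#}
      - (\<Sum>\<gamma>\<in>UNIV. N \<gamma> \<beta> * snd e $ Mindex {#Idot \<gamma>, Idot \<alpha>#}) - (\<Sum>\<gamma>\<in>UNIV. N \<gamma> \<alpha> * snd e $ Mindex {#Idot \<gamma>, Idot \<beta>#})"
    by (rule prolong2_vertical[OF X c J2co_tpos[OF c \<zeta>], where zz = "snd (J2co c \<zeta>)",
          folded lift2_eq, folded e_def]) (rule that; assumption)
  define K where "K = (\<chi> \<gamma> \<beta>. N \<gamma> \<beta>)"
  have Hq: "?H *v ?q = ?p" using reg vhess_qvec[of e] by (simp add: regular_def e_def)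
  have zn: "snd e $ Mindex {#} \<noteq> 0" using reg by (simp add: regular_def e_def)
  have p': "vgrad ?l = - (transpose K *v ?p)"
    by (simp add: vec_eq_iff p K_def matrix_vector_mult_def transpose_def sum_negf)
  have H': "vhess ?l = u' *\<^sub>R ?H - ?H ** K - transpose K ** ?H"
  proof -
    have "vhess ?l $ \<alpha> $ \<beta> = (u' *\<^sub>R ?H - ?H ** K - transpose K ** ?H) $ \<alpha> $ \<beta>" for \<alpha> \<beta>
      by (simp add: H K_def matrix_matrix_mult_def transpose_def mult.commute add_mset_commute[of "Idot \<alpha>"])
    then show ?thesis by (simp only: vec_eq_iff) blast
  qed
  have tK: "?q \<bullet> (transpose K *v a) = (K *v ?q) \<bullet> a" for a
    by (simp add: inner_commute[of ?q] transpose_matrix_vector dot_lmul_matrix inner_commute[of "K *v ?q"])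
  have "?q \<bullet> vgrad ?l = - ((K *v ?q) \<bullet> ?p)" by (simp add: p' tK[simplified])
  moreover have "?q \<bullet> (vhess ?l *v ?q) = u' * (?q \<bullet> ?p) - 2 * ((K *v ?q) \<bullet> ?p)"
  proof -
    have "vhess ?l *v ?q = u' *\<^sub>R ?p - ?H *v (K *v ?q) - transpose K *v ?p"
      by (simp add: H' matrix_vector_mult_diff_rdistrib scaleR_matrix_vector_assoc[symmetric] matrix_vector_mul_assoc[symmetric] Hq)
    then show ?thesis
      using vhess_inner[of ?q "snd e" "K *v ?q"] by (simp add: inner_diff_right tK[simplified] Hq inner_commute)
  qed
  ultimately show ?thesis
    using zn by (simp add: dI_form_def z inner_commute)
qed

text \<open>Invariance gives one inclusion. For the other, a vector w in the kernel is split as y +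
  n with y in the span and n orthogonal to it. Then n annihilates all lifts, so n . w is a multiple
  of g . w = 0, whence n . n = n . w = 0.\<close>

lemma distribution2_eq:
  assumes c: "c \<in> A" and \<zeta>: "\<zeta> \<in> J2dom c" and reg: "regular (J2co c \<zeta>)"
  defines "e \<equiv> J2co c \<zeta>"
  obtains g where "g \<noteq> 0" "\<And>w. dI_form (qvec e) (vgrad (snd e) \<bullet> qvec e / snd e $ Mindex {#}) (snd w) = g \<bullet> w"
    "distribution2 A c \<zeta> = {w. g \<bullet> w = 0}"
proof -
  let ?f = "\<lambda>w :: 'm tidx jcoords. dI_form (qvec e) (vgrad (snd e) \<bullet> qvec e / snd e $ Mindex {#}) (snd w)"
  have reg': "regular e" using reg by (simp add: e_def)
  obtain g :: "'m tidx jcoords" where g: "\<And>w. ?f w = g \<bullet> w"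
    by (rule linear_functional_inner[OF linear_dI_form]) (rule that; assumption)
  obtain ww where "?f (0, ww) \<noteq> 0" using dI_form_nonzero[OF qvec_nonzero[OF reg']] by force
  then have g0: "g \<noteq> 0" unfolding g by auto
  let ?L = "{lift2 A X c \<zeta> | X. p_projectable A X}"
  have "span ?L = {w. g \<bullet> w = 0}"
  proof (intro equalityI)
    have "?L \<subseteq> {w. g \<bullet> w = 0}"
      using dI_form_lift2[OF _ c \<zeta> reg] g unfolding e_def by auto
    then show "span ?L \<subseteq> {w. g \<bullet> w = 0}" by (rule span_minimal[OF _ subspace_hyperplane])
  next
    show "{w. g \<bullet> w = 0} \<subseteq> span ?L"
    proof
      fix w assume w: "w \<in> {w. g \<bullet> w = 0}"
      obtain y n where y: "y \<in> span ?L" "\<And>v. v \<in> span ?L \<Longrightarrow> orthogonal n v" "w = y + n"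
        by (rule orthogonal_subspace_decomp_exists[of ?L w]) (rule that; assumption)
      have ann: "n \<bullet> prolong2 (lift1_xi X c) (lift1_eta X c) (fst e, snd e) = 0" if "p_projectable A X" for X
      proof -
        have "lift2 A X c \<zeta> \<in> span ?L" using that by (intro span_base) auto
        from y(2)[OF this] show ?thesis unfolding lift2_eq e_def orthogonal_def .
      qed
      have "\<exists>\<kappa>. \<forall>v. n \<bullet> v = \<kappa> * ?f v"
      proof (rule annihilator[OF c _ ann])
        show "tpos (fst e) \<in> snd c ` fst c" unfolding e_def by (rule J2co_tpos[OF c \<zeta>])
        have det: "det (vhess (snd e)) \<noteq> 0" using reg' by (simp add: regular_def)
        show "vhess (snd e) *v qvec e = vgrad (snd e)" by (rule vhess_qvec[OF det])
        show "v = 0" if "vhess (snd e) *v v = 0" for v by (rule det_vhess_inj[OF det that])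
      qed (use reg' in \<open>simp_all add: regular_def\<close>)
      then obtain \<kappa> where \<kappa>: "\<And>v. n \<bullet> v = \<kappa> * ?f v" by blast
      have "n \<bullet> n = n \<bullet> w"
        using y(1) y(2)[OF y(1)] unfolding y(3) by (simp add: inner_add_right orthogonal_def)
      also have "\<dots> = 0" using w by (simp add: \<kappa> g)
      finally show "w \<in> span ?L" using y by simp
    qed
  qed
  then show ?thesis using that g0 g by (simp add: distribution2_def)
qed

lemma regular_jets_open: "atlas_open (J2_atlas A) regular_jets"
  unfolding atlas_open_def
proof (intro conjI ballI)
  show "regular_jets \<subseteq> carrier_of (J2_atlas A)" by (auto simp: regular_jets_def J2_carrier)
  fix C assume "C \<in> J2_atlas A"
  then obtain c where c: "c \<in> A" "C = J2_chart A c" by (auto simp: J2_atlas_def)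
  show "open (snd C ` (regular_jets \<inter> fst C))"
    unfolding c(2) regular_jets_image[OF c(1)] by (rule open_regular_image[OF c(1)])
qed

lemma regular_jets_dense:
  assumes W: "atlas_open (J2_atlas A) W" "W \<noteq> {}"
  shows "W \<inter> regular_jets \<noteq> {}"
proof -
  obtain \<zeta> where \<zeta>: "\<zeta> \<in> W" using W by blast
  then obtain c where c: "c \<in> A" "\<zeta> \<in> J2dom c"
    using J2_in_some_chart[of \<zeta>] W(1) unfolding atlas_open_def by blast
  have "open (J2co c ` (W \<inter> J2dom c))"
    by (rule J2.atlas_open_Int_chart[OF W(1) J2_chart_in_atlas[OF c(1)]])
  then obtain \<zeta>' where "\<zeta>' \<in> W" "\<zeta>' \<in> J2dom c" "regular (J2co c \<zeta>')"
    using regular_dense[of "J2co c ` (W \<inter> J2dom c)" "J2co c \<zeta>"] \<zeta> c(2) by blast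
  moreover from this have "\<zeta>' \<in> regular_jets" using regular_jets_iff[OF c(1)] by simp
  ultimately show ?thesis by blast
qed

lemma Ifun_smooth: "smooth_fun_on (J2_atlas A) regular_jets (Ifun A)"
  unfolding smooth_fun_on_def
proof
  fix C assume "C \<in> J2_atlas A"
  then obtain c where c: "c \<in> A" "C = J2_chart A c" by (auto simp: J2_atlas_def)
  show "smooth_on (snd C ` (regular_jets \<inter> fst C)) (Ifun A \<circ> chart_inv C)"
    unfolding c(2) regular_jets_image[OF c(1)]
    by (subst smooth_on_cong[OF open_regular_image[OF c(1)] Ifun_chart[OF c(1)]], assumption)
      (rule smooth_on_Icoord[OF open_regular_image[OF c(1)]], blast)
qed

text \<open>The differential of an invariant vanishes on the span of the lifts, which is the kernel
  of dI; this is exactly the hypothesis of the local factorisation in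
  \<open>function_of_Icoord\<close>.\<close>

lemma invariants_near:
  assumes \<zeta>0: "\<zeta>0 \<in> regular_jets"
  shows "\<exists>U. atlas_open (J2_atlas A) U \<and> \<zeta>0 \<in> U \<and> U \<subseteq> regular_jets
    \<and> (\<forall>F. smooth_fun_on (J2_atlas A) U F \<and> invariant_on A U F \<longrightarrow>
      (\<exists>S f. open S \<and> Ifun A ` U \<subseteq> S \<and> smooth_on S (f :: real \<Rightarrow> real) \<and> (\<forall>\<zeta>'\<in>U. F \<zeta>' = f (Ifun A \<zeta>'))))"
proof -
  obtain c where c: "c \<in> A" "\<zeta>0 \<in> J2dom c"
    using \<zeta>0 J2_in_some_chart[of \<zeta>0] unfolding regular_jets_def J2_carrier by blast
  let ?G = "{t. tpos t \<in> snd c ` fst c} \<times> UNIV \<inter> {e. regular e}"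
  note CB = J2_chart_in_atlas[OF c(1)]
  have G: "J2co c ` (regular_jets \<inter> J2dom c) = ?G" by (rule regular_jets_image[OF c(1)])
  have regG: "regular e" if "e \<in> ?G" for e using that by blast
  have memG: "J2co c \<zeta>0 \<in> ?G" using G \<zeta>0 c(2) by blast
  obtain V where V: "open V" "J2co c \<zeta>0 \<in> V" "V \<subseteq> ?G"
    and fac: "\<forall>F. smooth_on V F \<longrightarrow>
       (\<forall>e\<in>V. \<forall>w. frechet_derivative Icoord (at e) w = 0 \<longrightarrow> frechet_derivative F (at e) w = 0) \<longrightarrow>
       (\<exists>S f. open S \<and> Icoord ` V \<subseteq> S \<and> smooth_on S (f :: real \<Rightarrow> real) \<and> (\<forall>e\<in>V. F e = f (Icoord e)))"
    by (rule function_of_Icoord[OF open_regular_image[OF c(1)] _ memG])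
      (erule regG, (rule that; assumption))
  define U where "U = {\<zeta> \<in> regular_jets \<inter> J2dom c. J2co c \<zeta> \<in> V}"
  have UV: "J2co c ` U = V"
  proof (intro equalityI subsetI)
    fix e assume e: "e \<in> V"
    then have "e \<in> J2co c ` (regular_jets \<inter> J2dom c)" using V(3) G by auto
    then obtain \<zeta> where "\<zeta> \<in> regular_jets \<inter> J2dom c" "e = J2co c \<zeta>" by (rule imageE) simp
    with e show "e \<in> J2co c ` U" by (simp add: U_def)
  qed (auto simp: U_def)
  show ?thesis
  proof (intro exI[of _ U] conjI allI impI)
    show "atlas_open (J2_atlas A) U"
      by (rule J2.atlas_openI_chart[OF CB]) (use V(1) UV in \<open>auto simp: U_def\<close>)
    show "\<zeta>0 \<in> U" using \<zeta>0 c(2) V(2) by (simp add: U_def)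
    show "U \<subseteq> regular_jets" by (auto simp: U_def)
    fix F assume F: "smooth_fun_on (J2_atlas A) U F \<and> invariant_on A U F"
    let ?F = "F \<circ> chart_inv (J2_chart A c)"
    have "U \<inter> J2dom c = U" by (auto simp: U_def)
    then have sm: "smooth_on V ?F" using F CB UV by (auto simp: smooth_fun_on_def)
    have inv: "frechet_derivative ?F (at e) w = 0" if e: "e \<in> V" and w: "frechet_derivative Icoord (at e) w = 0" for e w
    proof -
      obtain \<zeta> where \<zeta>: "\<zeta> \<in> U" "e = J2co c \<zeta>" using e UV by blast
      have dom: "\<zeta> \<in> J2dom c" "regular (J2co c \<zeta>)"
        using \<zeta>(1) regular_jets_iff[OF c(1), of \<zeta>] by (auto simp: U_def)
      have reg: "regular e" using dom(2) \<zeta>(2) by simp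
      have lin: "linear (frechet_derivative ?F (at e))"
        by (rule has_derivative_linear[OF smooth_on_has_derivative[OF sm e]])
      obtain g where g: "\<And>w. dI_form (qvec e) (vgrad (snd e) \<bullet> qvec e / snd e $ Mindex {#}) (snd w) = g \<bullet> w"
        "distribution2 A c \<zeta> = {w. g \<bullet> w = 0}"
        using distribution2_eq[OF c(1) dom] unfolding \<zeta>(2)[symmetric] by metis
      have "frechet_derivative Icoord (at e) w = g \<bullet> w / snd e $ Mindex {#}"
        using fun_cong[OF frechet_derivative_at[OF Icoord_has_derivative[OF reg]], of w] g(1) by simp
      then have "g \<bullet> w = 0" using w reg by (simp add: regular_def)
      then have "w \<in> span {lift2 A X c \<zeta> | X. p_projectable A X}" using g(2) by (simp add: distribution2_def)
      moreover have "frechet_derivative ?F (at e) v = 0" if "v \<in> {lift2 A X c \<zeta> | X. p_projectable A X}" for v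
        using that F \<zeta> c(1) dom(1) by (auto simp: invariant_on_def chart_diff_def)
      ultimately show ?thesis by (rule linear_eq_0_on_span[OF lin, rotated])
    qed
    then have "\<forall>e\<in>V. \<forall>w. frechet_derivative Icoord (at e) w = 0 \<longrightarrow> frechet_derivative ?F (at e) w = 0"
      by blast
    from fac[THEN spec, THEN mp, OF sm, THEN mp, OF this] obtain S f where S: "open S" "Icoord ` V \<subseteq> S" "smooth_on S (f :: real \<Rightarrow> real)"
      and f: "\<forall>e\<in>V. ?F e = f (Icoord e)" by (elim exE conjE) (rule that; assumption)
    have I: "Ifun A \<zeta> = Icoord (J2co c \<zeta>)" "J2co c \<zeta> \<in> V" "?F (J2co c \<zeta>) = F \<zeta>" if "\<zeta> \<in> U" for \<zeta>
      using that Ifun_eq_Icoord[OF c(1), of \<zeta>] J2.chart_inv_left[OF CB, of \<zeta>] by (auto simp: U_def)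
    show "\<exists>S f. open S \<and> Ifun A ` U \<subseteq> S \<and> smooth_on S (f :: real \<Rightarrow> real) \<and> (\<forall>\<zeta>'\<in>U. F \<zeta>' = f (Ifun A \<zeta>'))"
    proof (intro exI[of _ S] exI[of _ f] conjI S ballI)
      show "Ifun A ` U \<subseteq> S"
      proof
        fix r assume "r \<in> Ifun A ` U"
        then obtain \<zeta> where "\<zeta> \<in> U" "r = Ifun A \<zeta>" by (rule imageE) simp
        then show "r \<in> S" using S(2) I(1,2)[of \<zeta>] by auto
      qed
      show "F \<zeta>' = f (Ifun A \<zeta>')" if "\<zeta>' \<in> U" for \<zeta>'
        unfolding I(1)[OF that] I(3)[OF that, symmetric] using f I(2)[OF that] by (rule bspec)
    qed
  qed
qed

end

text \<open>The base contributes 2m + 1, and the multi-indices of order at most 2 in 2m + 1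
  variables contribute (m + 1)(2m + 3).\<close>

lemma DIM_jcoords: "DIM('m::finite tidx jcoords) = 2 * CARD('m)\<^sup>2 + 7 * CARD('m) + 4"
proof -
  have "2 * CARD('m tidx mindex) = 2 * (2 * CARD('m)\<^sup>2 + 5 * CARD('m) + 3)"
    unfolding CARD_mindex CARD_tidx by (simp add: power2_eq_square algebra_simps)
  then have "CARD('m tidx mindex) = 2 * CARD('m)\<^sup>2 + 5 * CARD('m) + 3" by simp
  then show ?thesis by (simp add: CARD_tidx)
qed

theorem theorem3p4:
  fixes M :: "'a topology" and A :: "('a, real ^ ('m::finite)) chart set"
  assumes "smooth_manifold M A" and "connected_space M"
  shows "DIM('m tidx jcoords) = 2 * CARD('m)^2 + 7 * CARD('m) + 4
    \<and> 2 * CARD('m)^2 + 7 * CARD('m) + 3 = (CARD('m) + 3) * (2 * CARD('m) + 1)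
    \<and> (\<exists>O'. atlas_open (J2_atlas A) O'
        \<and> (\<forall>W. atlas_open (J2_atlas A) W \<and> W \<noteq> {} \<longrightarrow> W \<inter> O' \<noteq> {})
        \<and> O' \<subseteq> O2 A
        \<and> (\<forall>\<zeta>\<in>O'. jet2_value \<zeta> \<noteq> 0)
        \<and> (\<forall>\<zeta>\<in>O'. \<forall>c\<in>A. \<zeta> \<in> fst (J2_chart A c) \<longrightarrow>
              dim (distribution2 A c \<zeta>) = 2 * CARD('m)^2 + 7 * CARD('m) + 3)
        \<and> smooth_fun_on (J2_atlas A) O' (Ifun A)
        \<and> invariant_on A O' (Ifun A)
        \<and> (\<forall>\<zeta>\<in>O'. \<forall>c\<in>A. \<zeta> \<in> fst (J2_chart A c) \<longrightarrow>
              (\<exists>w. chart_diff (J2_chart A c) (Ifun A) \<zeta> w \<noteq> 0))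
        \<and> (\<forall>\<zeta>\<in>O'. \<exists>U. atlas_open (J2_atlas A) U \<and> \<zeta> \<in> U \<and> U \<subseteq> O'
              \<and> (\<forall>F. smooth_fun_on (J2_atlas A) U F \<and> invariant_on A U F \<longrightarrow>
                    (\<exists>S f. open S \<and> Ifun A ` U \<subseteq> S \<and> smooth_on S (f :: real \<Rightarrow> real)
                       \<and> (\<forall>\<zeta>'\<in>U. F \<zeta>' = f (Ifun A \<zeta>'))))))"
proof -
  interpret smfd M A by unfold_locales (rule assms(1))
  have dI: "chart_diff (J2_chart A c) (Ifun A) \<zeta> w =
      dI_form (qvec (J2co c \<zeta>)) (vgrad (snd (J2co c \<zeta>)) \<bullet> qvec (J2co c \<zeta>) / snd (J2co c \<zeta>) $ Mindex {#}) (snd w)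
        / snd (J2co c \<zeta>) $ Mindex {#}"
    if "\<zeta> \<in> regular_jets" "c \<in> A" "\<zeta> \<in> J2dom c" for \<zeta> c w
  proof -
    have reg: "regular (J2co c \<zeta>)" using that(1) regular_jets_iff[OF that(2,3)] by simp
    show ?thesis
      unfolding chart_diff_Ifun[OF that(2,3,1)]
      using fun_cong[OF frechet_derivative_at[OF Icoord_has_derivative[OF reg]], of w] by simp
  qed
  have 1: "regular_jets \<subseteq> O2 A"
    by (auto simp: O2_def regular_jets_def Hess_matrix_eq regular_def invertible_det_nz)
  have 2: "jet2_value \<zeta> \<noteq> 0" if z: "\<zeta> \<in> regular_jets" for \<zeta>
  proof -
    obtain c where "c \<in> A" "\<zeta> \<in> J2dom c"
      using z J2_in_some_chart[of \<zeta>] unfolding regular_jets_def J2_carrier by blast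
    then show ?thesis using z regular_jets_iff[of c \<zeta>] by (simp add: J2_value regular_def)
  qed
  have 3: "dim (distribution2 A c \<zeta>) = 2 * CARD('m)^2 + 7 * CARD('m) + 3"
    if \<zeta>: "\<zeta> \<in> regular_jets" "c \<in> A" "\<zeta> \<in> J2dom c" for \<zeta> c
  proof -
    have reg: "regular (J2co c \<zeta>)" using that(1) regular_jets_iff[OF that(2,3)] by simp
    obtain g where "g \<noteq> 0" "distribution2 A c \<zeta> = {w. g \<bullet> w = 0}"
      by (rule distribution2_eq[OF \<zeta>(2,3) reg]) (rule that; assumption)
    then show ?thesis using dim_hyperplane[of g] DIM_jcoords[where 'm = 'm] by simp
  qed
  have 4: "invariant_on A regular_jets (Ifun A)"
    unfolding invariant_on_def
  proof (intro allI impI ballI)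
    fix X \<zeta> c assume "p_projectable A X" "\<zeta> \<in> regular_jets" "c \<in> A" "\<zeta> \<in> J2dom c"
    then show "chart_diff (J2_chart A c) (Ifun A) \<zeta> (lift2 A X c \<zeta>) = 0"
      by (simp add: dI dI_form_lift2 regular_jets_iff)
  qed
  have 5: "\<exists>w. chart_diff (J2_chart A c) (Ifun A) \<zeta> w \<noteq> 0"
    if "\<zeta> \<in> regular_jets" "c \<in> A" "\<zeta> \<in> J2dom c" for \<zeta> c
  proof -
    have reg: "regular (J2co c \<zeta>)" using that(1) regular_jets_iff[OF that(2,3)] by simp
    obtain ww where "dI_form (qvec (J2co c \<zeta>)) (vgrad (snd (J2co c \<zeta>)) \<bullet> qvec (J2co c \<zeta>) / snd (J2co c \<zeta>) $ Mindex {#}) ww \<noteq> 0"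
      using dI_form_nonzero[OF qvec_nonzero[OF reg]] by blast
    then show ?thesis using reg by (intro exI[of _ "(0, ww)"]) (simp add: dI[OF that] regular_def)
  qed
  have 6: "2 * CARD('m)^2 + 7 * CARD('m) + 3 = (CARD('m) + 3) * (2 * CARD('m) + 1)"
    by (simp add: power2_eq_square algebra_simps)
  show ?thesis
  proof (intro conjI DIM_jcoords 6 exI[of _ regular_jets])
    show "\<forall>\<zeta>\<in>regular_jets. \<exists>U. atlas_open (J2_atlas A) U \<and> \<zeta> \<in> U \<and> U \<subseteq> regular_jets
        \<and> (\<forall>F. smooth_fun_on (J2_atlas A) U F \<and> invariant_on A U F \<longrightarrow>
              (\<exists>S f. open S \<and> Ifun A ` U \<subseteq> S \<and> smooth_on S (f :: real \<Rightarrow> real)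
                 \<and> (\<forall>\<zeta>'\<in>U. F \<zeta>' = f (Ifun A \<zeta>'))))"
      by (rule ballI) (rule invariants_near)
  qed (use regular_jets_open regular_jets_dense Ifun_smooth 1 2 3 4 5 in auto)
qed

end
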